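(* Fix integers $d\ge 10$ and $k$ such that $0\le k\le \nu_j(d)$. Then there is a smooth degree $d$ surface $Y\subset\mathbb{CP}^3$ containing $k$ general twistor lines and containing no other line $L$ that does not intersect any of the $k$ twistor lines.
   Context: Let $j:\mathbb{CP}^3\to\mathbb{CP}^3$ be the fixed-point-free anti-holomorphic involution $j[z_0,z_1,z_2,z_3]=[-\bar z_1,\bar z_0,-\bar z_3,\bar z_2]$. A projective line $l\subset\mathbb{CP}^3$ is a twistor line if $j(l)=l$; distinct twistor lines are disjoint. Let $Gr(2,4)$ be the Grassmannian of lines in $\mathbb{CP}^3$ and $\Lambda\subset Gr(2,4)$ the set of twistor lines. A property of $k$ distinct twistor lines ($k>0$) is said to hold for $k$ general twistor lines if there is a non-empty Zariski open subset $U\subseteq Gr(2,4)^k$ such that the property holds for all $(L_1,\dots,L_k)\in U\cap\Lambda^k$, where the property is regarded as false for $k$-tuples whose entries are not pairwise distinct. "There is a surface $Y$ with certain properties containing $k$ general twistor lines" means that, for $k$ general twistor lines $L_1,\dots,L_k$, there is such a $Y$ containing $L_1\cup\dots\cup L_k$ (for $k=0$ the condition of containing the lines is empty, and the conclusion is that $Y$ contains no line). Set $\nu(d):=\left\lfloor\left(\binom{d+3}{3}-1\right)/(d+1)\right\rfloor$ and $\nu_j(d):=\nu(d-9)$ if $d\ge 9$, $\nu_j(d):=0$ if $d\le 8$. *)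

theory Defs
  imports "HOL-Analysis.Analysis" "HOL-Library.Poly_Mapping"
begin

section \<open>Complex projective 3-space and its lines\<close>

text \<open>The homogeneous coordinates \<open>z\<^sub>0, \<dots>, z\<^sub>3\<close> of a vector are its components
  \<open>z $ 1, \<dots>, z $ 4\<close>. A point \<open>[z]\<close> is the one-dimensional subspace spanned by \<open>z \<noteq> 0\<close>.\<close>

type_synonym cpoint = "(complex ^ 4) set"

definition hpoint :: "complex ^ 4 \<Rightarrow> cpoint" where
  "hpoint z = vec.span {z}"

definition projectivization :: "(complex ^ 4) set \<Rightarrow> cpoint set" where
  "projectivization W = {hpoint z | z. z \<in> W \<and> z \<noteq> 0}"

definition Gr24 :: "cpoint set set" where
  "Gr24 = {projectivization W | W. vec.subspace W \<and> vec.dim W = 2}"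

definition jvec :: "complex ^ 4 \<Rightarrow> complex ^ 4" where
  "jvec z = (\<chi> i. if i = 1 then - cnj (z $ 2)
                  else if i = 2 then cnj (z $ 1)
                  else if i = 3 then - cnj (z $ 4)
                  else cnj (z $ 3))"

definition twistor_j :: "cpoint \<Rightarrow> cpoint" where
  "twistor_j p = jvec ` p"

lemma twistor_j_hpoint: "twistor_j (hpoint z) = hpoint (jvec z)"
proof -
  have *: "jvec (c *s z) = cnj c *s jvec z" for c
    by (simp add: jvec_def vec_eq_iff)
  have "jvec ` range (\<lambda>c. c *s z) = range (\<lambda>c. cnj c *s jvec z)"
    by (auto simp: image_image *)
  also have "\<dots> = range (\<lambda>c. c *s jvec z)"
    by (auto intro: range_eqI[of _ _ "cnj _"])
  finally show ?thesis
    by (simp add: twistor_j_def hpoint_def vec.span_singleton)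
qed

definition twistor_lines :: "cpoint set set" where
  "twistor_lines = {l \<in> Gr24. twistor_j ` l = l}"

section \<open>Polynomials\<close>

text \<open>Complex polynomials in the variables \<open>'v\<close>: finitely supported maps from exponent vectors to
  coefficients.\<close>

type_synonym 'v cpoly = "('v \<Rightarrow>\<^sub>0 nat) \<Rightarrow>\<^sub>0 complex"

definition poly_eval :: "'v cpoly \<Rightarrow> ('v \<Rightarrow> complex) \<Rightarrow> complex" where
  "poly_eval f x = (\<Sum>m\<in>Poly_Mapping.keys f. Poly_Mapping.lookup f m *
      (\<Prod>v\<in>Poly_Mapping.keys m. x v ^ Poly_Mapping.lookup m v))"

text \<open>Every degree is allowed for the zero polynomial.\<close>

definition homogeneous :: "nat \<Rightarrow> 'v cpoly \<Rightarrow> bool" where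
  "homogeneous d f \<longleftrightarrow>
     (\<forall>m\<in>Poly_Mapping.keys f. (\<Sum>v\<in>Poly_Mapping.keys m. Poly_Mapping.lookup m v) = d)"

definition partial_derivative :: "'v \<Rightarrow> 'v cpoly \<Rightarrow> 'v cpoly" where
  "partial_derivative v f =
     (\<Sum>m\<in>Poly_Mapping.keys f. Poly_Mapping.single (m - Poly_Mapping.single v 1)
        (of_nat (Poly_Mapping.lookup m v) * Poly_Mapping.lookup f m))"

section \<open>Smooth surfaces\<close>

definition zero_locus :: "4 cpoly \<Rightarrow> cpoint set" where
  "zero_locus F = {hpoint z | z. z \<noteq> 0 \<and> poly_eval F (($) z) = 0}"

text \<open>Smoothness by the Jacobian criterion. It makes \<open>F\<close> square-free, so that the degree of the
  point set \<open>Y\<close> is the degree of \<open>F\<close>.\<close>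

definition smooth_surface :: "nat \<Rightarrow> cpoint set \<Rightarrow> bool" where
  "smooth_surface d Y \<longleftrightarrow>
     (\<exists>F. F \<noteq> 0 \<and> homogeneous d F \<and> Y = zero_locus F \<and>
        (\<forall>z. z \<noteq> 0 \<longrightarrow> poly_eval F (($) z) = 0 \<longrightarrow>
           (\<exists>i. poly_eval (partial_derivative i F) (($) z) \<noteq> 0)))"

section \<open>The Zariski topology on \<open>Gr(2,4)\<^sup>k\<close>\<close>

text \<open>Pluecker coordinates are indexed by all pairs \<open>(i, j)\<close> and not only by those with \<open>i < j\<close>: the
  ambient \<open>P\<^sup>5\<close> is the space of skew-symmetric matrices in \<open>P\<^sup>1\<^sup>5\<close>. The extra
  coordinates are \<open>0\<close> or negatives of the usual ones, so the closed sets are the usual ones.\<close>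

definition pluecker_coords :: "cpoint set \<Rightarrow> (4 \<times> 4 \<Rightarrow> complex) \<Rightarrow> bool" where
  "pluecker_coords l p \<longleftrightarrow>
     (\<exists>u v. u \<noteq> v \<and> vec.independent {u, v} \<and> l = projectivization (vec.span {u, v}) \<and>
        p = (\<lambda>(i, j). u $ i * v $ j - u $ j * v $ i))"

text \<open>A \<open>k\<close>-tuple is an extensional function on \<open>{..<k}\<close>.\<close>

definition Gr24_power :: "nat \<Rightarrow> (nat \<Rightarrow> cpoint set) set" where
  "Gr24_power k = {..<k} \<rightarrow>\<^sub>E Gr24"

definition twistor_power :: "nat \<Rightarrow> (nat \<Rightarrow> cpoint set) set" where
  "twistor_power k = {..<k} \<rightarrow>\<^sub>E twistor_lines"

text \<open>The variable \<open>(a, i, j)\<close> is the Pluecker coordinate \<open>(i, j)\<close> of the \<open>a\<close>-th factor. \<open>D a\<close> is the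
  degree in the \<open>a\<close>-th group of variables.\<close>

definition multihomogeneous :: "nat \<Rightarrow> (nat \<times> 4 \<times> 4) cpoly \<Rightarrow> bool" where
  "multihomogeneous k f \<longleftrightarrow>
     (\<forall>m\<in>Poly_Mapping.keys f. \<forall>v\<in>Poly_Mapping.keys m. fst v < k) \<and>
     (\<exists>D. \<forall>m\<in>Poly_Mapping.keys f. \<forall>a<k.
        (\<Sum>v\<in>{v \<in> Poly_Mapping.keys m. fst v = a}. Poly_Mapping.lookup m v) = D a)"

text \<open>For multihomogeneous \<open>f\<close> this does not depend on the choice of the Pluecker coordinates.\<close>

definition vanishes_at :: "nat \<Rightarrow> (nat \<times> 4 \<times> 4) cpoly \<Rightarrow> (nat \<Rightarrow> cpoint set) \<Rightarrow> bool" where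
  "vanishes_at k f L \<longleftrightarrow>
     (\<forall>p. (\<forall>a<k. pluecker_coords (L a) (p a)) \<longrightarrow> poly_eval f (\<lambda>(a, ij). p a ij) = 0)"

definition zariski_closed :: "nat \<Rightarrow> (nat \<Rightarrow> cpoint set) set \<Rightarrow> bool" where
  "zariski_closed k Z \<longleftrightarrow>
     (\<exists>S. (\<forall>f\<in>S. multihomogeneous k f) \<and>
        Z = {L \<in> Gr24_power k. \<forall>f\<in>S. vanishes_at k f L})"

definition zariski_open :: "nat \<Rightarrow> (nat \<Rightarrow> cpoint set) set \<Rightarrow> bool" where
  "zariski_open k U \<longleftrightarrow> U \<subseteq> Gr24_power k \<and> zariski_closed k (Gr24_power k - U)"

section \<open>General twistor lines\<close>

text \<open>\<open>inj_on\<close> expresses that the entries of the tuple are pairwise distinct. For \<open>k = 0\<close> the only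
  tuple is the empty one, and the definition says that \<open>P\<close> holds for it.\<close>

definition for_general_twistor_lines ::
  "nat \<Rightarrow> ((nat \<Rightarrow> cpoint set) \<Rightarrow> bool) \<Rightarrow> bool" where
  "for_general_twistor_lines k P \<longleftrightarrow>
     (\<exists>U. zariski_open k U \<and> U \<noteq> {} \<and>
        (\<forall>L \<in> U \<inter> twistor_power k. inj_on L {..<k} \<and> P L))"

text \<open>On natural numbers \<open>div\<close> is the floor of the quotient.\<close>

definition nu :: "nat \<Rightarrow> nat" where
  "nu d = (((d + 3) choose 3) - 1) div (d + 1)"

definition nu_j :: "nat \<Rightarrow> nat" where
  "nu_j d = (if d \<ge> 9 then nu (d - 9) else 0)"

end

theory Submission
  imports Defs
begin

text \<open>For \<open>e = d - 5\<close>, general lines \<open>L\<^sub>1, \<dots>, L\<^sub>k\<close> impose independent conditions on forms of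
  degree \<open>e\<close>. This is an open condition on the lines, given by the non-vanishing of a determinant
  in Pluecker coordinates, so one example is enough. Examples arise by the Hartshorne--Hirschowitz
  induction from \<open>e\<close> to \<open>e + 2\<close>: add lines of one ruling of a smooth quadric \<open>Q\<close> to general chords of
  \<open>Q\<close>; forms with prescribed restrictions to the ruling lines and prescribed values at the end points
  of the chords come from bidegree interpolation on \<open>Q\<close>, and are corrected on the chords by multiples of \<open>Q\<close>.

  If the lines are independent in degree \<open>e\<close>, then a general form \<open>F\<close> of degree \<open>e + 5\<close> through them
  has the required properties by a dimension count: a singular point off the lines is 4 conditions
  on \<open>F\<close> for 3 parameters, a singular point on one of the lines is 2 conditions for 1 parameter, and
  a line off the given ones is at least 5 conditions for 4 parameters. In each case the conditions can be
  solved for as many coefficients of \<open>F\<close>, so the bad coefficient vectors lie in the image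
  of a rational map from a space of smaller dimension, hence in a hypersurface.\<close>

text \<open>The shift by 5 comes from the extra lines. To solve for coefficients of
  \<open>F\<close>, the linear system must contain products of a form \<open>G\<close> through the
  lines that is nonzero at the point concerned and a form that carries the condition. Independence
  in degree e provides such a \<open>G\<close> off the lines from degree e + 1 on. On an extra line
  this \<open>G\<close> has at most e + 1 zeros, so of e + 6 test points five remain where it is
  nonzero. Five values are separated by Lagrange forms of degree 4, and (e + 1) + 4 = e + 5.
  Singular points need only linear factors, with \<open>G\<close> of degree e + 4. The bound on k
  fits this shift: with m = d - 9 one has e = m + 4, and k (m + 1) < (m + 3 choose 3) yields 6 k
  \<le> (m + 3) (m + 2) = (e - 1) (e - 2). Dimension theory is avoided: independence means that
  restrictions to the lines can be prescribed, and small sets are those on which some nonzero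
  polynomial function vanishes.\<close>

section \<open>Evaluation of polynomials\<close>

abbreviation monom_val :: "('v \<Rightarrow>\<^sub>0 nat) \<Rightarrow> ('v \<Rightarrow> complex) \<Rightarrow> complex" where
  "monom_val m x \<equiv> (\<Prod>v\<in>Poly_Mapping.keys m. x v ^ Poly_Mapping.lookup m v)"

lemma monom_val_superset:
  assumes "finite S" "Poly_Mapping.keys m \<subseteq> S"
  shows "monom_val m x = (\<Prod>v\<in>S. x v ^ Poly_Mapping.lookup m v)"
  by (rule prod.mono_neutral_left) (use assms in \<open>auto simp: in_keys_iff\<close>)

lemma monom_val_add: "monom_val (m + m') x = monom_val m x * monom_val m' x"
proof -
  let ?S = "Poly_Mapping.keys m \<union> Poly_Mapping.keys m'"
  have "monom_val (m + m') x = (\<Prod>v\<in>?S. x v ^ Poly_Mapping.lookup (m + m') v)"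
    using Poly_Mapping.keys_add[of m m'] by (intro monom_val_superset) auto
  also have "\<dots> = monom_val m x * monom_val m' x"
    by (simp add: monom_val_superset[of ?S m] monom_val_superset[of ?S m']
        lookup_add power_add prod.distrib)
  finally show ?thesis .
qed

lemma poly_eval_superset:
  assumes "finite S" "Poly_Mapping.keys f \<subseteq> S"
  shows "poly_eval f x = (\<Sum>m\<in>S. Poly_Mapping.lookup f m * monom_val m x)"
  unfolding poly_eval_def
  by (rule sum.mono_neutral_left) (use assms in \<open>auto simp: in_keys_iff\<close>)

lemma poly_eval_0 [simp]: "poly_eval 0 x = 0"
  by (simp add: poly_eval_def)

lemma poly_eval_single: "poly_eval (Poly_Mapping.single m c) x = c * monom_val m x"
  by (subst poly_eval_superset[of "{m}"]) auto

lemma poly_eval_const [simp]: "poly_eval (Poly_Mapping.single 0 c) x = c"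
  by (simp add: poly_eval_single)

lemma poly_eval_1 [simp]: "poly_eval 1 x = 1"
  using poly_eval_const[of 1 x] by (simp del: poly_eval_const)

lemma poly_eval_add [simp]: "poly_eval (f + g) x = poly_eval f x + poly_eval g x"
proof -
  let ?S = "Poly_Mapping.keys f \<union> Poly_Mapping.keys g"
  have "Poly_Mapping.keys (f + g) \<subseteq> ?S"
    by (rule Poly_Mapping.keys_add)
  then show ?thesis
    by (simp add: poly_eval_superset[of ?S] lookup_add distrib_right sum.distrib)
qed

lemma poly_eval_uminus [simp]: "poly_eval (- f) x = - poly_eval f x"
  using poly_eval_add[of f "- f" x] by (simp add: eq_neg_iff_add_eq_0 add.commute)

lemma poly_eval_diff [simp]: "poly_eval (f - g) x = poly_eval f x - poly_eval g x"
  using poly_eval_add[of f "- g" x] by simp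

lemma poly_eval_sum [simp]: "poly_eval (\<Sum>i\<in>I. f i) x = (\<Sum>i\<in>I. poly_eval (f i) x)"
  by (induction I rule: infinite_finite_induct) auto

lemma poly_mapping_sum_singles:
  "f = (\<Sum>m\<in>Poly_Mapping.keys f. Poly_Mapping.single m (Poly_Mapping.lookup f m))"
proof (rule poly_mapping_eqI)
  fix k
  show "Poly_Mapping.lookup f k = Poly_Mapping.lookup
      (\<Sum>m\<in>Poly_Mapping.keys f. Poly_Mapping.single m (Poly_Mapping.lookup f m)) k"
    by (auto simp: lookup_sum lookup_single when_def sum.delta' in_keys_iff)
qed

lemma poly_eval_mult [simp]: "poly_eval (f * g) x = poly_eval f x * poly_eval g x"
proof -
  let ?s = "\<lambda>f m. Poly_Mapping.single m (Poly_Mapping.lookup f m)"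
  have "f * g = (\<Sum>m\<in>Poly_Mapping.keys f. ?s f m) * (\<Sum>m\<in>Poly_Mapping.keys g. ?s g m)"
    using poly_mapping_sum_singles[of f] poly_mapping_sum_singles[of g] by simp
  also have "\<dots> = (\<Sum>m\<in>Poly_Mapping.keys f. \<Sum>m'\<in>Poly_Mapping.keys g.
      Poly_Mapping.single (m + m') (Poly_Mapping.lookup f m * Poly_Mapping.lookup g m'))"
    by (simp add: sum_product mult_single)
  finally have "poly_eval (f * g) x = (\<Sum>m\<in>Poly_Mapping.keys f. \<Sum>m'\<in>Poly_Mapping.keys g.
      Poly_Mapping.lookup f m * Poly_Mapping.lookup g m' * (monom_val m x * monom_val m' x))"
    by (simp add: poly_eval_single monom_val_add)
  also have "\<dots> = poly_eval f x * poly_eval g x"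
    by (simp add: poly_eval_def sum_product algebra_simps)
  finally show ?thesis .
qed

lemma poly_eval_power [simp]: "poly_eval (f ^ n) x = poly_eval f x ^ n"
  by (induction n) auto

lemma poly_eval_prod [simp]: "poly_eval (\<Prod>i\<in>I. f i) x = (\<Prod>i\<in>I. poly_eval (f i) x)"
  by (induction I rule: infinite_finite_induct) auto

definition pvar :: "'v \<Rightarrow> 'v cpoly" where
  "pvar v = Poly_Mapping.single (Poly_Mapping.single v 1) 1"

definition pconst :: "complex \<Rightarrow> 'v cpoly" where
  "pconst c = Poly_Mapping.single 0 c"

lemma poly_eval_pvar [simp]: "poly_eval (pvar v) x = x v"
  by (simp add: pvar_def poly_eval_single)

lemma poly_eval_pconst [simp]: "poly_eval (pconst c) x = c"
  by (simp add: pconst_def)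

definition psubst :: "'u cpoly \<Rightarrow> ('u \<Rightarrow> 'v cpoly) \<Rightarrow> 'v cpoly" where
  "psubst f y = (\<Sum>m\<in>Poly_Mapping.keys f. pconst (Poly_Mapping.lookup f m) *
      (\<Prod>v\<in>Poly_Mapping.keys m. y v ^ Poly_Mapping.lookup m v))"

lemma poly_eval_psubst: "poly_eval (psubst f y) x = poly_eval f (\<lambda>v. poly_eval (y v) x)"
  by (simp add: psubst_def poly_eval_def[of f])

section \<open>Weighted homogeneity\<close>

text \<open>Weights cover both gradings in use: weight 1 everywhere gives the total degree, the
  indicator of one group of variables gives one component of a multidegree.\<close>

definition wdeg :: "('v \<Rightarrow> nat) \<Rightarrow> ('v \<Rightarrow>\<^sub>0 nat) \<Rightarrow> nat" where
  "wdeg w m = (\<Sum>v\<in>Poly_Mapping.keys m. w v * Poly_Mapping.lookup m v)"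

definition whom :: "('v \<Rightarrow> nat) \<Rightarrow> nat \<Rightarrow> 'v cpoly \<Rightarrow> bool" where
  "whom w n f \<longleftrightarrow> (\<forall>m\<in>Poly_Mapping.keys f. wdeg w m = n)"

lemma homogeneous_iff_whom: "homogeneous n f \<longleftrightarrow> whom (\<lambda>_. 1) n f"
  by (simp add: homogeneous_def whom_def wdeg_def)

lemma wdeg_superset:
  assumes "finite S" "Poly_Mapping.keys m \<subseteq> S"
  shows "wdeg w m = (\<Sum>v\<in>S. w v * Poly_Mapping.lookup m v)"
  unfolding wdeg_def
  by (rule sum.mono_neutral_left) (use assms in \<open>auto simp: in_keys_iff\<close>)

lemma wdeg_add: "wdeg w (m + m') = wdeg w m + wdeg w m'"
proof -
  let ?S = "Poly_Mapping.keys m \<union> Poly_Mapping.keys m'"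
  have "Poly_Mapping.keys (m + m') \<subseteq> ?S"
    by (rule Poly_Mapping.keys_add)
  then show ?thesis
    by (simp add: wdeg_superset[of ?S] lookup_add algebra_simps sum.distrib)
qed

lemma whom_0: "whom w n 0"
  by (simp add: whom_def)

lemma whom_add: "whom w n f \<Longrightarrow> whom w n g \<Longrightarrow> whom w n (f + g)"
  using Poly_Mapping.keys_add[of f g] by (auto simp: whom_def)

lemma whom_uminus: "whom w n f \<Longrightarrow> whom w n (- f)"
  by (auto simp: whom_def in_keys_iff)

lemma whom_diff: "whom w n f \<Longrightarrow> whom w n g \<Longrightarrow> whom w n (f - g)"
  using whom_add[of w n f "- g"] whom_uminus by auto

lemma whom_sum: "(\<And>i. i \<in> I \<Longrightarrow> whom w n (f i)) \<Longrightarrow> whom w n (\<Sum>i\<in>I. f i)"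
  by (induction I rule: infinite_finite_induct) (auto intro: whom_0 whom_add)

lemma whom_mult: "whom w n f \<Longrightarrow> whom w n' g \<Longrightarrow> whom w (n + n') (f * g)"
  using keys_mult[of f g] by (fastforce simp: whom_def wdeg_add)

lemma whom_pconst: "whom w 0 (pconst c)"
  by (auto simp: whom_def pconst_def wdeg_def)

lemma whom_1: "whom w 0 1"
  by (auto simp: whom_def wdeg_def)

lemma whom_pconst_mult: "whom w n f \<Longrightarrow> whom w n (pconst c * f)"
  using whom_mult[OF whom_pconst] by force

lemma whom_pvar: "whom w (w v) (pvar v)"
  by (auto simp: whom_def pvar_def wdeg_def)

lemma whom_power: "whom w n f \<Longrightarrow> whom w (n * k) (f ^ k)"
  by (induction k) (auto intro: whom_1 whom_mult)

lemma whom_prod: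
  "(\<And>i. i \<in> I \<Longrightarrow> whom w (n i) (f i)) \<Longrightarrow> whom w (\<Sum>i\<in>I. n i) (\<Prod>i\<in>I. f i)"
  by (induction I rule: infinite_finite_induct) (auto intro: whom_1 whom_mult)

lemma whom_psubst:
  assumes "homogeneous n f" "\<And>v. whom w k (y v)"
  shows "whom w (k * n) (psubst f y)"
  unfolding psubst_def
proof (intro whom_sum whom_pconst_mult)
  fix m assume m: "m \<in> Poly_Mapping.keys f"
  have "whom w (\<Sum>v\<in>Poly_Mapping.keys m. k * Poly_Mapping.lookup m v)
      (\<Prod>v\<in>Poly_Mapping.keys m. y v ^ Poly_Mapping.lookup m v)"
    by (intro whom_prod whom_power assms)
  moreover have "(\<Sum>v\<in>Poly_Mapping.keys m. k * Poly_Mapping.lookup m v) = k * n"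
    using assms(1) m by (simp add: homogeneous_def flip: sum_distrib_left)
  ultimately show "whom w (k * n) (\<Prod>v\<in>Poly_Mapping.keys m. y v ^ Poly_Mapping.lookup m v)"
    by simp
qed

lemma poly_eval_homogeneous_scale:
  assumes "homogeneous n f"
  shows "poly_eval f (\<lambda>v. c * x v) = c ^ n * poly_eval f x"
proof -
  have "monom_val m (\<lambda>v. c * x v) = c ^ n * monom_val m x" if "m \<in> Poly_Mapping.keys f" for m
    using assms that by (simp add: homogeneous_def power_mult_distrib prod.distrib flip: power_sum)
  then show ?thesis
    by (simp add: poly_eval_def sum_distrib_left mult.left_commute)
qed

section \<open>Partial derivatives\<close>

lemma monom_val_has_derivative:
  "((\<lambda>t. monom_val m (x(v := t))) has_field_derivative
     of_nat (Poly_Mapping.lookup m v) * monom_val (m - Poly_Mapping.single v 1) x) (at (x v))"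
proof -
  let ?R = "\<Prod>u\<in>Poly_Mapping.keys m - {v}. x u ^ Poly_Mapping.lookup m u"
  have split: "monom_val m' (x(v := t)) = t ^ Poly_Mapping.lookup m' v *
      (\<Prod>u\<in>Poly_Mapping.keys m - {v}. x u ^ Poly_Mapping.lookup m' u)"
    if "Poly_Mapping.keys m' \<subseteq> Poly_Mapping.keys m" for m' t
  proof -
    have "monom_val m' (x(v := t)) =
        (\<Prod>u\<in>insert v (Poly_Mapping.keys m - {v}). (x(v := t)) u ^ Poly_Mapping.lookup m' u)"
      by (rule monom_val_superset) (use that in auto)
    also have "\<dots> = t ^ Poly_Mapping.lookup m' v *
      (\<Prod>u\<in>Poly_Mapping.keys m - {v}. (x(v := t)) u ^ Poly_Mapping.lookup m' u)"
      by (subst prod.insert) auto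
    also have "(\<Prod>u\<in>Poly_Mapping.keys m - {v}. (x(v := t)) u ^ Poly_Mapping.lookup m' u) =
       (\<Prod>u\<in>Poly_Mapping.keys m - {v}. x u ^ Poly_Mapping.lookup m' u)"
      by (rule prod.cong) auto
    finally show ?thesis .
  qed
  let ?m = "m - Poly_Mapping.single v 1"
  have "Poly_Mapping.keys ?m \<subseteq> Poly_Mapping.keys m"
    by (auto simp: in_keys_iff lookup_minus)
  moreover have "(\<Prod>u\<in>Poly_Mapping.keys m - {v}. x u ^ Poly_Mapping.lookup ?m u) = ?R"
    by (rule prod.cong) (auto simp: lookup_minus lookup_single when_def)
  ultimately have "monom_val ?m x = x v ^ (Poly_Mapping.lookup m v - 1) * ?R"
    using split[of ?m "x v"] by (simp add: lookup_minus lookup_single)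
  then have deriv: "of_nat (Poly_Mapping.lookup m v) * monom_val ?m x =
      of_nat (Poly_Mapping.lookup m v) * x v ^ (Poly_Mapping.lookup m v - 1) * ?R"
    by simp
  moreover have "((\<lambda>t. t ^ Poly_Mapping.lookup m v * ?R) has_field_derivative
      of_nat (Poly_Mapping.lookup m v) * x v ^ (Poly_Mapping.lookup m v - 1) * ?R) (at (x v))"
    by (auto intro!: derivative_eq_intros)
  ultimately show ?thesis
    by (simp only: split[OF order_refl] deriv)
qed

lemma partial_derivative_has_derivative:
  "((\<lambda>t. poly_eval f (x(v := t))) has_field_derivative
     poly_eval (partial_derivative v f) x) (at (x v))"
proof -
  have "poly_eval (partial_derivative v f) x =
     (\<Sum>m\<in>Poly_Mapping.keys f. Poly_Mapping.lookup f m *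
       (of_nat (Poly_Mapping.lookup m v) * monom_val (m - Poly_Mapping.single v 1) x))"
    by (simp add: partial_derivative_def poly_eval_single mult_ac)
  then show ?thesis
    unfolding poly_eval_def[of f]
    by (simp only:) (intro DERIV_sum DERIV_cmult monom_val_has_derivative)
qed

text \<open>The formal derivative agrees with the analytic one, so uniqueness of derivatives
  replaces computations with coefficients, for instance in the product rule.\<close>

lemma partial_derivative_eqI:
  assumes "((\<lambda>t. poly_eval f (x(v := t))) has_field_derivative D) (at (x v))"
  shows "poly_eval (partial_derivative v f) x = D"
  using DERIV_unique[OF partial_derivative_has_derivative assms] .

lemma poly_eval_partial_derivative_mult:
  "poly_eval (partial_derivative v (f * g)) x =
     poly_eval (partial_derivative v f) x * poly_eval g x +
     poly_eval f x * poly_eval (partial_derivative v g) x"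
  using DERIV_mult[OF partial_derivative_has_derivative[of f x v]
      partial_derivative_has_derivative[of g x v]]
  by (intro partial_derivative_eqI) (simp add: mult_ac)

lemma poly_eval_partial_derivative_linear:
  "poly_eval (partial_derivative v (\<Sum>i\<in>I. pconst (c i) * f i)) x =
     (\<Sum>i\<in>I. c i * poly_eval (partial_derivative v (f i)) x)"
  by (intro partial_derivative_eqI, simp)
    (intro DERIV_sum DERIV_cmult partial_derivative_has_derivative)

lemma poly_eval_partial_derivative_pvar:
  "poly_eval (partial_derivative v (pvar u)) x = of_bool (u = v)"
  by (rule partial_derivative_eqI) (auto intro!: derivative_eq_intros)

lemma homogeneous_partial_derivative:
  assumes "homogeneous n f"
  shows "homogeneous (n - 1) (partial_derivative v f)"
  unfolding homogeneous_iff_whom partial_derivative_def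
proof (rule whom_sum)
  fix m assume m: "m \<in> Poly_Mapping.keys f"
  let ?m = "m - Poly_Mapping.single v 1"
  have "wdeg (\<lambda>_. 1) ?m = n - 1" if "Poly_Mapping.lookup m v \<noteq> 0"
  proof -
    have "m = ?m + Poly_Mapping.single v 1"
      by (rule poly_mapping_eqI) (use that in \<open>auto simp: lookup_add lookup_minus lookup_single when_def\<close>)
    then have "wdeg (\<lambda>_. 1) m = wdeg (\<lambda>_. 1) ?m + wdeg (\<lambda>_. 1) (Poly_Mapping.single v 1)"
      by (metis wdeg_add)
    moreover have "wdeg (\<lambda>_. 1) m = n"
      using assms m by (simp add: homogeneous_iff_whom whom_def)
    ultimately show ?thesis
      by (simp add: wdeg_def)
  qed
  then show "whom (\<lambda>_. 1) (n - 1) (Poly_Mapping.single ?m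
        (of_nat (Poly_Mapping.lookup m v) * Poly_Mapping.lookup f m))"
    by (cases "Poly_Mapping.lookup m v = 0") (auto simp: whom_def)
qed

section \<open>Linear systems with more unknowns than equations\<close>

lemma underdetermined_system:
  fixes a :: "'a \<Rightarrow> 'b \<Rightarrow> complex"
  assumes "finite B" "finite A" "card B < card A"
  shows "\<exists>x. (\<exists>i\<in>A. x i \<noteq> 0) \<and> (\<forall>b\<in>B. (\<Sum>i\<in>A. a i b * x i) = 0)"
  using assms
proof (induction B arbitrary: A a rule: finite_induct)
  case empty
  then have "A \<noteq> {}"
    by auto
  then show ?case
    by (auto intro!: exI[of _ "\<lambda>_. 1"])
next
  case (insert b B)
  show ?case
  proof (cases "\<forall>i\<in>A. a i b = 0")
    case True
    have "card B < card A"
      using insert.prems insert.hyps by auto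
    from insert.IH[OF insert.prems(1) this, of a] show ?thesis
      using True by auto
  next
    case False
    then obtain j where j: "j \<in> A" "a j b \<noteq> 0"
      by auto
    let ?A = "A - {j}"
    have "card B < card ?A"
      using insert.prems insert.hyps j by auto
    \<comment> \<open>Equation \<open>b\<close> is solved for the unknown \<open>j\<close>; the
      induction hypothesis handles the equations that remain after substituting.\<close>
    from insert.IH[OF _ this, of "\<lambda>i b'. a i b' - a i b / a j b * a j b'"] insert.prems
    obtain x where x: "\<exists>i\<in>?A. x i \<noteq> 0"
      "\<And>b'. b' \<in> B \<Longrightarrow> (\<Sum>i\<in>?A. (a i b' - a i b / a j b * a j b') * x i) = 0"
      by auto
    define y where "y = x(j := - (\<Sum>i\<in>?A. a i b * x i) / a j b)"
    have sum_y: "(\<Sum>i\<in>A. a i b' * y i) =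
        (\<Sum>i\<in>?A. a i b' * x i) - (\<Sum>i\<in>?A. a i b * x i) / a j b * a j b'" for b'
    proof -
      have "(\<Sum>i\<in>A. a i b' * y i) = a j b' * y j + (\<Sum>i\<in>?A. a i b' * y i)"
        using j insert.prems by (simp add: sum.remove)
      also have "(\<Sum>i\<in>?A. a i b' * y i) = (\<Sum>i\<in>?A. a i b' * x i)"
        by (rule sum.cong) (auto simp: y_def)
      finally show ?thesis
        by (simp add: y_def)
    qed
    have "(\<Sum>i\<in>A. a i b' * y i) = 0" if "b' \<in> insert b B" for b'
    proof (cases "b' = b")
      case True
      then show ?thesis
        using j by (simp add: sum_y)
    next
      case False
      then have "(\<Sum>i\<in>?A. (a i b' - a i b / a j b * a j b') * x i) = 0"
        using x(2) that by auto
      then show ?thesis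
        unfolding sum_y
        by (simp add: algebra_simps sum_subtractf sum_divide_distrib sum_distrib_left)
    qed
    moreover have "\<exists>i\<in>A. y i \<noteq> 0"
      using x(1) by (auto simp: y_def)
    ultimately show ?thesis
      by blast
  qed
qed

section \<open>Polynomial functions\<close>

text \<open>The degree is bounded in each variable separately, so the exponents fill a box and there
  are (n + 1) ^ card W monomials. This count is what \<open>thin_rational_image\<close>
  compares.\<close>

definition polyrep :: "'v set \<Rightarrow> nat \<Rightarrow> (('v \<Rightarrow> complex) \<Rightarrow> complex) \<Rightarrow> bool" where
  "polyrep W n f \<longleftrightarrow>
     (\<exists>a. \<forall>x. f x = (\<Sum>m\<in>PiE W (\<lambda>_. {..n}). a m * (\<Prod>v\<in>W. x v ^ m v)))"

lemma polyrep_0: "polyrep W n (\<lambda>_. 0)"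
  unfolding polyrep_def by (rule exI[of _ "\<lambda>_. 0"]) simp

lemma polyrep_add:
  assumes "polyrep W n f" "polyrep W n g"
  shows "polyrep W n (\<lambda>x. f x + g x)"
proof -
  obtain a b where "\<And>x. f x = (\<Sum>m\<in>PiE W (\<lambda>_. {..n}). a m * (\<Prod>v\<in>W. x v ^ m v))"
    "\<And>x. g x = (\<Sum>m\<in>PiE W (\<lambda>_. {..n}). b m * (\<Prod>v\<in>W. x v ^ m v))"
    using assms unfolding polyrep_def by blast
  then show ?thesis
    unfolding polyrep_def
    by (intro exI[of _ "\<lambda>m. a m + b m"]) (simp add: distrib_right sum.distrib)
qed

lemma polyrep_sum:
  "(\<And>i. i \<in> I \<Longrightarrow> polyrep W n (f i)) \<Longrightarrow> polyrep W n (\<lambda>x. \<Sum>i\<in>I. f i x)"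
  by (induction I rule: infinite_finite_induct) (auto intro: polyrep_0 polyrep_add)

lemma polyrep_monom:
  assumes "finite W" "\<And>v. v \<in> W \<Longrightarrow> m v \<le> n"
  shows "polyrep W n (\<lambda>x. c * (\<Prod>v\<in>W. x v ^ m v))"
  unfolding polyrep_def
proof (intro exI[of _ "\<lambda>m'. c * of_bool (m' = restrict m W)"] allI)
  fix x :: "'a \<Rightarrow> complex"
  let ?E = "PiE W (\<lambda>_. {..n})"
  have "restrict m W \<in> ?E"
    using assms by auto
  moreover have "finite ?E"
    using assms by (simp add: finite_PiE)
  ultimately have "(\<Sum>m'\<in>?E. c * of_bool (m' = restrict m W) * (\<Prod>v\<in>W. x v ^ m' v)) =
      (\<Sum>m'\<in>{restrict m W}. c * of_bool (m' = restrict m W) * (\<Prod>v\<in>W. x v ^ m' v))"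
    by (intro sum.mono_neutral_right) auto
  then show "c * (\<Prod>v\<in>W. x v ^ m v) =
      (\<Sum>m'\<in>?E. c * of_bool (m' = restrict m W) * (\<Prod>v\<in>W. x v ^ m' v))"
    by simp
qed

lemma polyrep_mult:
  assumes "finite W" "polyrep W n f" "polyrep W n' g"
  shows "polyrep W (n + n') (\<lambda>x. f x * g x)"
proof -
  let ?E = "\<lambda>n. PiE W (\<lambda>_. {..n})"
  obtain a b where "\<And>x. f x = (\<Sum>m\<in>?E n. a m * (\<Prod>v\<in>W. x v ^ m v))"
    "\<And>x. g x = (\<Sum>m\<in>?E n'. b m * (\<Prod>v\<in>W. x v ^ m v))"
    using assms unfolding polyrep_def by blast
  then have "(\<lambda>x. f x * g x) =
      (\<lambda>x. \<Sum>m\<in>?E n. \<Sum>m'\<in>?E n'. a m * b m' * (\<Prod>v\<in>W. x v ^ (m v + m' v)))"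
    by (auto simp: sum_product power_add prod.distrib mult_ac intro!: sum.cong)
  moreover have "polyrep W (n + n') (\<lambda>x. \<Sum>m\<in>?E n. \<Sum>m'\<in>?E n'.
      a m * b m' * (\<Prod>v\<in>W. x v ^ (m v + m' v)))"
    using assms(1) by (intro polyrep_sum polyrep_monom) (auto intro!: add_mono simp: PiE_iff)
  ultimately show ?thesis
    by simp
qed

lemma polyrep_mono:
  assumes "finite W" "polyrep W n f" "n \<le> n'"
  shows "polyrep W n' f"
proof -
  obtain a where "\<And>x. f x = (\<Sum>m\<in>PiE W (\<lambda>_. {..n}). a m * (\<Prod>v\<in>W. x v ^ m v))"
    using assms unfolding polyrep_def by blast
  then have "f = (\<lambda>x. \<Sum>m\<in>PiE W (\<lambda>_. {..n}). a m * (\<Prod>v\<in>W. x v ^ m v))"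
    by auto
  then show ?thesis
    using assms by (auto intro!: polyrep_sum polyrep_monom simp: PiE_iff intro: order_trans)
qed

lemma polyrep_const: "finite W \<Longrightarrow> polyrep W n (\<lambda>_. c)"
  using polyrep_monom[of W "\<lambda>_. 0" n c] by simp

lemma polyrep_var:
  assumes "finite W" "v \<in> W"
  shows "polyrep W 1 (\<lambda>x. x v)"
proof -
  have "(\<Prod>u\<in>W. x u ^ of_bool (u = v)) = (\<Prod>u\<in>W. if u = v then x u else 1)" for x :: "'a \<Rightarrow> complex"
    by (rule prod.cong) auto
  then show ?thesis
    using polyrep_monom[of W "\<lambda>u. of_bool (u = v)" 1 1] assms by simp
qed

lemma polyrep_power: "finite W \<Longrightarrow> polyrep W n f \<Longrightarrow> polyrep W (k * n) (\<lambda>x. f x ^ k)"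
  by (induction k) (auto intro: polyrep_const polyrep_mult)

lemma polyrep_prod:
  "finite W \<Longrightarrow> (\<And>i. i \<in> I \<Longrightarrow> polyrep W (n i) (f i)) \<Longrightarrow>
     polyrep W (\<Sum>i\<in>I. n i) (\<lambda>x. \<Prod>i\<in>I. f i x)"
  by (induction I rule: infinite_finite_induct) (auto intro: polyrep_const polyrep_mult)

definition polyfn :: "'v set \<Rightarrow> (('v \<Rightarrow> complex) \<Rightarrow> complex) \<Rightarrow> bool" where
  "polyfn W f \<longleftrightarrow> finite W \<and> (\<exists>n. polyrep W n f)"

lemma polyfn_const: "finite W \<Longrightarrow> polyfn W (\<lambda>_. c)"
  by (auto simp: polyfn_def intro: polyrep_const)

lemma polyfn_var: "finite W \<Longrightarrow> v \<in> W \<Longrightarrow> polyfn W (\<lambda>x. x v)"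
  by (auto simp: polyfn_def intro: polyrep_var)

lemma polyfn_mult: "polyfn W f \<Longrightarrow> polyfn W g \<Longrightarrow> polyfn W (\<lambda>x. f x * g x)"
  by (auto simp: polyfn_def intro: polyrep_mult)

lemma polyfn_add:
  assumes "polyfn W f" "polyfn W g"
  shows "polyfn W (\<lambda>x. f x + g x)"
proof -
  obtain n n' where "polyrep W n f" "polyrep W n' g" "finite W"
    using assms by (auto simp: polyfn_def)
  then have "polyrep W (max n n') (\<lambda>x. f x + g x)"
    by (intro polyrep_add) (auto intro: polyrep_mono)
  then show ?thesis
    using \<open>finite W\<close> by (auto simp: polyfn_def)
qed

lemma polyfn_uminus: "polyfn W f \<Longrightarrow> polyfn W (\<lambda>x. - f x)"
  using polyfn_mult[of W "\<lambda>_. - 1" f] polyfn_const[of W "- 1"] by (auto simp: polyfn_def)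

lemma polyfn_diff: "polyfn W f \<Longrightarrow> polyfn W g \<Longrightarrow> polyfn W (\<lambda>x. f x - g x)"
  using polyfn_add[OF _ polyfn_uminus] by auto

lemma polyfn_sum:
  "finite W \<Longrightarrow> (\<And>i. i \<in> I \<Longrightarrow> polyfn W (f i)) \<Longrightarrow> polyfn W (\<lambda>x. \<Sum>i\<in>I. f i x)"
  by (induction I rule: infinite_finite_induct) (auto intro: polyfn_const polyfn_add)

lemma polyfn_prod:
  "finite W \<Longrightarrow> (\<And>i. i \<in> I \<Longrightarrow> polyfn W (f i)) \<Longrightarrow> polyfn W (\<lambda>x. \<Prod>i\<in>I. f i x)"
  by (induction I rule: infinite_finite_induct) (auto intro: polyfn_const polyfn_mult)

lemma polyfn_power: "polyfn W f \<Longrightarrow> polyfn W (\<lambda>x. f x ^ k)"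
  by (auto simp: polyfn_def intro: polyrep_power)

lemma polyfn_poly_eval:
  "finite W \<Longrightarrow> (\<And>v. polyfn W (\<lambda>x. g x v)) \<Longrightarrow> polyfn W (\<lambda>x. poly_eval f (g x))"
  unfolding poly_eval_def
  by (intro polyfn_sum polyfn_mult polyfn_prod polyfn_power polyfn_const)

lemmas polyfn_intros = polyfn_const polyfn_var polyfn_mult polyfn_add polyfn_uminus polyfn_diff
  polyfn_sum polyfn_prod polyfn_power polyfn_poly_eval

text \<open>Induction on the variables: if the others are given values that keep one coefficient of
  the last variable alive, a nonzero polynomial in one variable remains, and it has only finitely
  many roots.\<close>

lemma polynomial_function_nonzero:
  fixes a :: "('i \<Rightarrow> nat) \<Rightarrow> complex"
  assumes "finite I" "m \<in> PiE I (\<lambda>_. {..D})" "a m \<noteq> 0"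
  shows "\<exists>x. (\<Sum>m\<in>PiE I (\<lambda>_. {..D}). a m * (\<Prod>i\<in>I. x i ^ m i)) \<noteq> 0"
  using assms
proof (induction I arbitrary: a m rule: finite_induct)
  case empty
  then show ?case
    by auto
next
  case (insert v I)
  let ?E = "PiE I (\<lambda>_. {..D})"
  obtain m' j where m': "m' \<in> ?E" "j \<le> D" "m = m'(v := j)"
    using insert.prems(1) unfolding PiE_insert_eq by auto
  obtain x where x: "(\<Sum>m\<in>?E. a (m(v := j)) * (\<Prod>i\<in>I. x i ^ m i)) \<noteq> 0"
  proof -
    have "a (m'(v := j)) \<noteq> 0"
      using m'(3) insert.prems(2) by metis
    from insert.IH[OF m'(1), of "\<lambda>m. a (m(v := j))", OF this] show ?thesis
      using that by (elim exE)
  qed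
  \<comment> \<open>\<open>b l\<close> is the coefficient of t ^ l after substituting
    \<open>x\<close> for the variables in \<open>I\<close>; by the choice of \<open>x\<close>,
    \<open>b j\<close> is nonzero.\<close>
  define b where "b l = (\<Sum>m\<in>?E. a (m(v := l)) * (\<Prod>i\<in>I. x i ^ m i))" for l
  define p where "p = (\<Sum>l\<le>D. Polynomial.monom (b l) l)"
  have "coeff p j = b j"
    using m' by (simp add: p_def coeff_sum)
  then have "p \<noteq> 0"
    using x by (auto simp: b_def)
  then have "finite {t. poly p t = 0}"
    by (rule poly_roots_finite)
  then obtain t where t: "poly p t \<noteq> 0"
    using ex_new_if_finite[OF infinite_UNIV_char_0] by blast
  have inj: "inj_on (\<lambda>(l, m). m(v := l)) ({..D} \<times> ?E)"
  proof (rule inj_onI, clarify)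
    fix l m l' m'
    assume *: "m \<in> ?E" "m' \<in> ?E" and eq: "m(v := l) = m'(v := l')"
    have "l = l'"
      using fun_cong[OF eq, of v] by simp
    \<comment> \<open>As \<open>v\<close> is not in \<open>I\<close>, both extensional functions are
      \<open>undefined\<close> at \<open>v\<close>.\<close>
    moreover have "m i = m' i" for i
    proof (cases "i = v")
      case True
      then show ?thesis
        using PiE_arb[OF *(1), of v] PiE_arb[OF *(2), of v] insert.hyps by metis
    next
      case False
      then show ?thesis
        using fun_cong[OF eq, of i] by simp
    qed
    ultimately show "l = l' \<and> m = m'"
      by blast
  qed
  have prod: "(\<Prod>i\<in>insert v I. (x(v := t)) i ^ (m(v := l)) i) = t ^ l * (\<Prod>i\<in>I. x i ^ m i)" for m l
  proof -
    have "(\<Prod>i\<in>I. (x(v := t)) i ^ (m(v := l)) i) = (\<Prod>i\<in>I. x i ^ m i)"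
      using insert.hyps by (intro prod.cong) auto
    then show ?thesis
      using insert.hyps by simp
  qed
  have "(\<Sum>m\<in>PiE (insert v I) (\<lambda>_. {..D}). a m * (\<Prod>i\<in>insert v I. (x(v := t)) i ^ m i)) =
      (\<Sum>(l, m)\<in>{..D} \<times> ?E. a (m(v := l)) * (\<Prod>i\<in>insert v I. (x(v := t)) i ^ (m(v := l)) i))"
    unfolding PiE_insert_eq by (subst sum.reindex[OF inj]) (simp add: case_prod_unfold)
  also have "\<dots> = (\<Sum>(l, m)\<in>{..D} \<times> ?E. t ^ l * (a (m(v := l)) * (\<Prod>i\<in>I. x i ^ m i)))"
    unfolding prod by (simp add: mult_ac)
  also have "\<dots> = poly p t"
    by (simp add: p_def poly_sum poly_monom b_def sum_distrib_left mult_ac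
        sum.cartesian_product)
  finally show ?case
    using t by metis
qed

text \<open>To satisfy two non-vanishing conditions at once, only the restriction to the line
  joining two points matters. The index type may be infinite, as it is for the coefficient vectors
  of the linear system below.\<close>

definition linepoly :: "(('i \<Rightarrow> complex) \<Rightarrow> complex) \<Rightarrow> bool" where
  "linepoly P \<longleftrightarrow> (\<forall>x y. \<exists>p. \<forall>t. P (\<lambda>i. x i + t * y i) = poly p t)"

lemma linepoly_const: "linepoly (\<lambda>_. c)"
  unfolding linepoly_def by (intro allI exI[of _ "[:c:]"]) simp

lemma linepoly_var: "linepoly (\<lambda>x. x i)"
  unfolding linepoly_def by (intro allI, rule_tac x="[:x i, y i:]" in exI) simp

lemma linepoly_add:
  assumes "linepoly P" "linepoly Q"
  shows "linepoly (\<lambda>x. P x + Q x)"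
  unfolding linepoly_def
proof (intro allI)
  fix x y
  obtain p q where "\<forall>t. P (\<lambda>i. x i + t * y i) = poly p t" "\<forall>t. Q (\<lambda>i. x i + t * y i) = poly q t"
    using assms unfolding linepoly_def by blast
  then show "\<exists>r. \<forall>t. P (\<lambda>i. x i + t * y i) + Q (\<lambda>i. x i + t * y i) = poly r t"
    by (intro exI[of _ "p + q"]) simp
qed

lemma linepoly_mult:
  assumes "linepoly P" "linepoly Q"
  shows "linepoly (\<lambda>x. P x * Q x)"
  unfolding linepoly_def
proof (intro allI)
  fix x y
  obtain p q where "\<forall>t. P (\<lambda>i. x i + t * y i) = poly p t" "\<forall>t. Q (\<lambda>i. x i + t * y i) = poly q t"
    using assms unfolding linepoly_def by blast
  then show "\<exists>r. \<forall>t. P (\<lambda>i. x i + t * y i) * Q (\<lambda>i. x i + t * y i) = poly r t"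
    by (intro exI[of _ "p * q"]) simp
qed

lemma linepoly_sum: "(\<And>i. i \<in> I \<Longrightarrow> linepoly (f i)) \<Longrightarrow> linepoly (\<lambda>x. \<Sum>i\<in>I. f i x)"
  by (induction I rule: infinite_finite_induct) (auto intro: linepoly_const linepoly_add)

lemma linepoly_prod: "(\<And>i. i \<in> I \<Longrightarrow> linepoly (f i)) \<Longrightarrow> linepoly (\<lambda>x. \<Prod>i\<in>I. f i x)"
  by (induction I rule: infinite_finite_induct) (auto intro: linepoly_const linepoly_mult)

lemma linepoly_power: "linepoly P \<Longrightarrow> linepoly (\<lambda>x. P x ^ k)"
  by (induction k) (auto intro: linepoly_const linepoly_mult)

lemma linepoly_poly_eval: "linepoly (poly_eval f)"
  unfolding poly_eval_def
  by (intro linepoly_sum linepoly_mult linepoly_prod linepoly_power linepoly_const linepoly_var)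

text \<open>On the line from \<open>x\<close> to \<open>y\<close>, \<open>P\<close> is nonzero at t
  = 0 and \<open>Q\<close> at t = 1, so the product of the two restrictions is a nonzero polynomial
  in t.\<close>

lemma linepoly_common_nonzero:
  assumes "linepoly P" "linepoly Q" "P x \<noteq> 0" "Q y \<noteq> 0"
  shows "\<exists>z. P z \<noteq> 0 \<and> Q z \<noteq> 0"
proof -
  let ?l = "\<lambda>t i. x i + t * (y i - x i)"
  obtain p where p: "\<forall>t. P (?l t) = poly p t"
    using assms(1)[unfolded linepoly_def, rule_format, of x "\<lambda>i. y i - x i"] by (elim exE)
  obtain q where q: "\<forall>t. Q (?l t) = poly q t"
    using assms(2)[unfolded linepoly_def, rule_format, of x "\<lambda>i. y i - x i"] by (elim exE)
  have "poly p 0 \<noteq> 0" "poly q 1 \<noteq> 0"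
    using p[rule_format, of 0] q[rule_format, of 1] assms by auto
  then have "p * q \<noteq> 0"
    by auto
  then have "finite {t. poly (p * q) t = 0}"
    by (rule poly_roots_finite)
  then obtain t where "poly (p * q) t \<noteq> 0"
    using ex_new_if_finite[OF infinite_UNIV_char_0] by blast
  then show ?thesis
    using p q by (intro exI[of _ "?l t"]) auto
qed

section \<open>Thin sets\<close>

text \<open>Substitute for being contained in a proper Zariski closed subset: stable under finite
  unions, and never the whole space.\<close>

definition thin :: "('i \<Rightarrow> complex) set \<Rightarrow> bool" where
  "thin B \<longleftrightarrow> (\<exists>P. linepoly P \<and> (\<exists>x. P x \<noteq> 0) \<and> (\<forall>c\<in>B. P c = 0))"

lemma thin_subset: "thin B \<Longrightarrow> A \<subseteq> B \<Longrightarrow> thin A"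
  unfolding thin_def by blast

lemma thin_UN:
  assumes "finite S" "\<And>s. s \<in> S \<Longrightarrow> thin (B s)"
  shows "thin (\<Union>s\<in>S. B s)"
  using assms
proof (induction S rule: finite_induct)
  case empty
  then show ?case
    unfolding thin_def by (auto intro!: exI[of _ "\<lambda>_. 1"] linepoly_const)
next
  case (insert s S)
  have "thin (B s)" "thin (\<Union>s\<in>S. B s)"
    using insert by auto
  then obtain P Q x y where "linepoly P" "P x \<noteq> 0" "\<forall>c\<in>B s. P c = 0"
    "linepoly Q" "Q y \<noteq> 0" "\<forall>c\<in>(\<Union>s\<in>S. B s). Q c = 0"
    unfolding thin_def by blast
  moreover from this obtain z where "P z \<noteq> 0 \<and> Q z \<noteq> 0"
    using linepoly_common_nonzero by blast
  ultimately show ?case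
    unfolding thin_def by (intro exI[of _ "\<lambda>c. P c * Q c"] conjI linepoly_mult) auto
qed

lemma thin_not_UNIV: "thin B \<Longrightarrow> \<exists>c. c \<notin> B"
  unfolding thin_def by blast

text \<open>If \<open>card W < card I\<close>, then for large \<open>D\<close> the monomials in \<open>card I\<close> variables with exponents
  at most \<open>D\<close> outnumber the monomials in the parameters that occur after substituting
  \<open>g\<^sub>i / h\<^sub>i\<close> and clearing denominators.\<close>

lemma thin_rational_image:
  fixes g h :: "'i \<Rightarrow> ('w \<Rightarrow> complex) \<Rightarrow> complex"
  assumes "finite I" "finite W" "card W < card I"
    and "\<And>i. i \<in> I \<Longrightarrow> polyfn W (g i)" "\<And>i. i \<in> I \<Longrightarrow> polyfn W (h i)"
  shows "thin {c. \<exists>x. \<forall>i\<in>I. h i x \<noteq> 0 \<and> c i * h i x = g i x}"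
proof -
  have "\<forall>i\<in>I. \<exists>n. polyrep W n (g i) \<and> polyrep W n (h i)"
  proof
    fix i assume "i \<in> I"
    then obtain n n' where "polyrep W n (g i)" "polyrep W n' (h i)"
      using assms unfolding polyfn_def by blast
    then have "polyrep W (max n n') (g i) \<and> polyrep W (max n n') (h i)"
      using assms(2) by (auto intro: polyrep_mono)
    then show "\<exists>n. polyrep W n (g i) \<and> polyrep W n (h i)" ..
  qed
  then obtain n where n: "\<And>i. i \<in> I \<Longrightarrow> polyrep W (n i) (g i) \<and> polyrep W (n i) (h i)"
    by metis
  define \<delta> where "\<delta> = (\<Sum>i\<in>I. n i)"
  have \<delta>: "polyrep W \<delta> (g i)" "polyrep W \<delta> (h i)" if "i \<in> I" for i
    using n[OF that] member_le_sum[OF that, of n] assms(1,2)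
    by (auto simp: \<delta>_def intro: polyrep_mono)
  \<comment> \<open>Since N + 1 \<le> C (D + 1), at most C ^ card W * (D + 1) ^ card W monomials
    occur in the parameters. Taking \<open>D\<close> to be C ^ card W keeps this below (D + 1) ^
    (card W + 1).\<close>
  define C where "C = card I * \<delta> + 1"
  define D where "D = C ^ card W"
  define N where "N = card I * (D * \<delta>)"
  let ?E = "PiE I (\<lambda>_. {..D})" and ?M = "PiE W (\<lambda>_. {..N})"
  have "N + 1 \<le> C * (D + 1)"
    by (simp add: N_def C_def algebra_simps)
  then have "(N + 1) ^ card W \<le> D * (D + 1) ^ card W"
    by (metis D_def power_mono power_mult_distrib zero_le)
  also have "\<dots> < (D + 1) ^ (card W + 1)"
    by simp
  also have "\<dots> \<le> (D + 1) ^ card I"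
    using assms(3) by (intro power_increasing) auto
  finally have "card ?M < card ?E"
    using assms by (simp add: card_PiE)
  \<comment> \<open>The monomial \<open>m\<close> in the quotients g / h, multiplied by the
    \<open>D\<close>-th power of the product of all h.\<close>
  define f where "f m x = (\<Prod>i\<in>I. g i x ^ m i * h i x ^ (D - m i))" for m x
  have "polyrep W N (f m)" if "m \<in> ?E" for m
  proof -
    have "polyrep W (\<Sum>i\<in>I. D * \<delta>) (f m)"
      unfolding f_def
    proof (rule polyrep_prod[OF assms(2)])
      fix i assume i: "i \<in> I"
      then have "m i * \<delta> + (D - m i) * \<delta> = D * \<delta>"
        using that by (auto simp: PiE_iff simp flip: add_mult_distrib)
      then show "polyrep W (D * \<delta>) (\<lambda>x. g i x ^ m i * h i x ^ (D - m i))"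
        using polyrep_mult[OF assms(2) polyrep_power[OF assms(2) \<delta>(1)[OF i], of "m i"]
            polyrep_power[OF assms(2) \<delta>(2)[OF i], of "D - m i"]] by simp
    qed
    then show ?thesis
      by (simp add: N_def)
  qed
  then obtain a where a: "\<And>m x. m \<in> ?E \<Longrightarrow> f m x = (\<Sum>l\<in>?M. a m l * (\<Prod>v\<in>W. x v ^ l v))"
    unfolding polyrep_def by metis
  have "finite ?E" "finite ?M"
    using assms by (auto intro!: finite_PiE)
  from underdetermined_system[OF this(2,1) \<open>card ?M < card ?E\<close>, of a]
  obtain \<alpha> m0 where m0: "m0 \<in> ?E" "\<alpha> m0 \<noteq> 0"
    and \<alpha>: "\<And>l. l \<in> ?M \<Longrightarrow> (\<Sum>m\<in>?E. a m l * \<alpha> m) = 0"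
    by auto
  \<comment> \<open>The coefficients form a linear relation between the functions
    \<open>f m\<close>, so \<open>P\<close> vanishes after the substitution, up to the nonzero
    common denominator.\<close>
  define P where "P c = (\<Sum>m\<in>?E. \<alpha> m * (\<Prod>i\<in>I. c i ^ m i))" for c :: "'i \<Rightarrow> complex"
  have "linepoly P"
    unfolding P_def
    by (intro linepoly_sum linepoly_mult linepoly_prod linepoly_power linepoly_const linepoly_var)
  moreover have "\<exists>c. P c \<noteq> 0"
    unfolding P_def using m0 assms(1) by (intro polynomial_function_nonzero)
  moreover have "P c = 0" if c: "\<And>i. i \<in> I \<Longrightarrow> h i x \<noteq> 0 \<and> c i * h i x = g i x" for c x
  proof -
    have f: "(\<Prod>i\<in>I. h i x) ^ D * (\<Prod>i\<in>I. c i ^ m i) = f m x" if m: "m \<in> ?E" for m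
    proof -
      have "(\<Prod>i\<in>I. h i x) ^ D * (\<Prod>i\<in>I. c i ^ m i) = (\<Prod>i\<in>I. h i x ^ D * c i ^ m i)"
        by (simp add: prod.distrib prod_power_distrib)
      also have "\<dots> = f m x"
        unfolding f_def
      proof (rule prod.cong)
        fix i assume i: "i \<in> I"
        then have "h i x ^ D = h i x ^ m i * h i x ^ (D - m i)"
          using m by (auto simp: PiE_iff simp flip: power_add)
        then show "h i x ^ D * c i ^ m i = g i x ^ m i * h i x ^ (D - m i)"
          using c[OF i] by (metis mult.commute mult.left_commute power_mult_distrib)
      qed simp
      finally show ?thesis .
    qed
    have "(\<Prod>i\<in>I. h i x) ^ D * P c = (\<Sum>m\<in>?E. \<alpha> m * f m x)"
      unfolding P_def sum_distrib_left
    proof (rule sum.cong)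
      fix m assume "m \<in> ?E"
      from f[OF this] show "(\<Prod>i\<in>I. h i x) ^ D * (\<alpha> m * (\<Prod>i\<in>I. c i ^ m i)) = \<alpha> m * f m x"
        by (metis mult.left_commute)
    qed simp
    also have "\<dots> = (\<Sum>m\<in>?E. \<Sum>l\<in>?M. a m l * \<alpha> m * (\<Prod>v\<in>W. x v ^ l v))"
      by (rule sum.cong) (simp_all add: a sum_distrib_left mult_ac)
    also have "\<dots> = (\<Sum>l\<in>?M. (\<Sum>m\<in>?E. a m l * \<alpha> m) * (\<Prod>v\<in>W. x v ^ l v))"
      by (subst sum.swap) (simp add: sum_distrib_right)
    also have "\<dots> = 0"
      by (simp add: \<alpha>)
    finally show "P c = 0"
      using c assms(1) by auto
  qed
  ultimately show ?thesis
    unfolding thin_def by (intro exI[of _ P]) auto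
qed

text \<open>The bad vectors are parametrized by \<open>W\<close> together with their own
  coefficients outside \<open>J\<close>, which is fewer than card I parameters. In
  \<open>case_sum y c\<close> all of \<open>c\<close> is passed on, but by the \<open>polyfn\<close>
  assumptions \<open>g\<close> and \<open>h\<close> depend only on its entries outside
  \<open>J\<close>.\<close>

lemma thin_graph:
  fixes g h :: "'i \<Rightarrow> ('w + 'i \<Rightarrow> complex) \<Rightarrow> complex"
  assumes "finite I" "J \<subseteq> I" "finite W" "card W < card J"
    and "\<And>j. j \<in> J \<Longrightarrow> polyfn (Inl ` W \<union> Inr ` (I - J)) (g j)"
    and "\<And>j. j \<in> J \<Longrightarrow> polyfn (Inl ` W \<union> Inr ` (I - J)) (h j)"
  shows "thin {c. \<exists>y. \<forall>j\<in>J. h j (case_sum y c) \<noteq> 0 \<and> c j * h j (case_sum y c) = g j (case_sum y c)}"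
proof -
  let ?W = "Inl ` W \<union> Inr ` (I - J)"
  let ?g = "\<lambda>i. if i \<in> J then g i else (\<lambda>x. x (Inr i))"
  let ?h = "\<lambda>i. if i \<in> J then h i else (\<lambda>x. 1)"
  have fin: "finite ?W"
    using assms by auto
  have "card ?W = card W + card (I - J)"
    using assms by (subst card_Un_disjoint) (auto simp: card_image)
  moreover have "card I = card J + card (I - J)"
    using assms by (metis card_Diff_subset card_mono finite_subset le_add_diff_inverse)
  ultimately have "card ?W < card I"
    using assms(4) by simp
  then have "thin {c. \<exists>x. \<forall>i\<in>I. ?h i x \<noteq> 0 \<and> c i * ?h i x = ?g i x}"
    using assms(1,5,6) fin by (intro thin_rational_image[where W = ?W]) (auto intro: polyfn_intros)
  then show ?thesis
  proof (rule thin_subset, safe)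
    fix c y
    assume *: "\<forall>j\<in>J. h j (case_sum y c) \<noteq> 0 \<and> c j * h j (case_sum y c) = g j (case_sum y c)"
    show "\<exists>x. \<forall>i\<in>I. ?h i x \<noteq> 0 \<and> c i * ?h i x = ?g i x"
      by (rule exI[of _ "case_sum y c"]) (use * in auto)
  qed
qed

section \<open>Dual bases under generic perturbation\<close>

text \<open>Elimination by Schur complements; \<open>D\<close> plays the role of the determinant of \<open>A\<close>, and \<open>G\<close> is
  a grading for which it stays homogeneous.\<close>

lemma generic_dual_basis:
  fixes A :: "'i \<Rightarrow> 'i \<Rightarrow> 'v cpoly" and G :: "'d \<Rightarrow> 'v cpoly \<Rightarrow> bool"
  assumes "finite J"
    and G_mult: "\<And>a b f g. G a f \<Longrightarrow> G b g \<Longrightarrow> G (pl a b) (f * g)"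
    and G_diff: "\<And>a f g. G a f \<Longrightarrow> G a g \<Longrightarrow> G a (f - g)"
    and G_one: "G e 1"
    and pl_comm: "\<And>a b. pl a b = pl b a"
    and "\<And>l i. l \<in> J \<Longrightarrow> i \<in> J \<Longrightarrow> poly_eval (A l i) x0 = of_bool (l = i)"
    and "\<And>l i. l \<in> J \<Longrightarrow> i \<in> J \<Longrightarrow> G (d i) (A l i)"
  shows "\<exists>D \<delta>. G \<delta> D \<and> poly_eval D x0 = 1 \<and> (\<forall>x. poly_eval D x \<noteq> 0 \<longrightarrow>
     (\<forall>j\<in>J. \<exists>c. \<forall>i\<in>J. (\<Sum>l\<in>J. c l * poly_eval (A l i) x) = of_bool (i = j)))"
  using assms(1,6,7)
proof (induction J arbitrary: A d rule: finite_induct)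
  case empty
  show ?case
    by (rule exI[of _ 1], rule exI[of _ e]) (simp add: G_one)
next
  case (insert m J)
  \<comment> \<open>Schur complement of the pivot \<open>A m m\<close>, with the denominator
    cleared. Both products have degree \<open>d m\<close> plus \<open>d i\<close>, so the degree
    still depends on the column alone; at \<open>x0\<close> the result is again the identity
    matrix.\<close>
  define B where "B l i = A m m * A l i - A l m * A m i" for l i
  have "\<exists>D \<delta>. G \<delta> D \<and> poly_eval D x0 = 1 \<and> (\<forall>x. poly_eval D x \<noteq> 0 \<longrightarrow>
     (\<forall>j\<in>J. \<exists>c. \<forall>i\<in>J. (\<Sum>l\<in>J. c l * poly_eval (B l i) x) = of_bool (i = j)))"
  proof (rule insert.IH[where d = "\<lambda>i. pl (d m) (d i)"])
    fix l i assume li: "l \<in> J" "i \<in> J"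
    then have "l \<noteq> m" "i \<noteq> m"
      using insert.hyps by auto
    then show "poly_eval (B l i) x0 = of_bool (l = i)"
      using insert.prems(1) li by (simp add: B_def)
    show "G (pl (d m) (d i)) (B l i)"
      unfolding B_def using insert.prems(2) li by (intro G_diff G_mult) auto
  qed
  then obtain D \<delta> where D: "G \<delta> D" "poly_eval D x0 = 1"
    and dual: "\<And>x j. poly_eval D x \<noteq> 0 \<Longrightarrow> j \<in> J \<Longrightarrow>
      \<exists>c. \<forall>i\<in>J. (\<Sum>l\<in>J. c l * poly_eval (B l i) x) = of_bool (i = j)"
    by blast
  show ?case
  proof (rule exI[of _ "A m m * D"], rule exI[of _ "pl (d m) \<delta>"], intro conjI allI impI ballI)
    show "G (pl (d m) \<delta>) (A m m * D)"
      using insert.prems(2) D by (intro G_mult) auto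
    show "poly_eval (A m m * D) x0 = 1"
      using insert.prems(1) D by simp
    fix x j
    assume "poly_eval (A m m * D) x \<noteq> 0" and j: "j \<in> insert m J"
    then have a: "poly_eval (A m m) x \<noteq> 0" and Dx: "poly_eval D x \<noteq> 0"
      by auto
    let ?A = "\<lambda>l i. poly_eval (A l i) x"
    have in_J: "\<exists>c. \<forall>i\<in>insert m J. (\<Sum>l\<in>insert m J. c l * ?A l i) = of_bool (i = j)"
      if j: "j \<in> J" for j
    proof -
      obtain c where c: "\<And>i. i \<in> J \<Longrightarrow> (\<Sum>l\<in>J. c l * poly_eval (B l i) x) = of_bool (i = j)"
        using dual[OF Dx j] by blast
      \<comment> \<open>The coefficient of row \<open>m\<close> is chosen so that the combination of
        the rows of \<open>A\<close> equals the one of the rows of \<open>B\<close>.\<close>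
      define c' where "c' = (\<lambda>l. c l * ?A m m)(m := - (\<Sum>l\<in>J. c l * ?A l m))"
      have sum_c': "(\<Sum>l\<in>insert m J. c' l * ?A l i) = (\<Sum>l\<in>J. c l * poly_eval (B l i) x)" for i
      proof -
        have "(\<Sum>l\<in>J. c' l * ?A l i) = (\<Sum>l\<in>J. c l * ?A m m * ?A l i)"
          using insert.hyps by (intro sum.cong) (auto simp: c'_def)
        then show ?thesis
          using insert.hyps
          by (simp add: c'_def B_def algebra_simps sum_subtractf sum_distrib_left)
      qed
      \<comment> \<open>Column \<open>m\<close> of \<open>B\<close> is zero, so the equation for i =
        m holds by itself.\<close>
      have "(\<Sum>l\<in>J. c l * poly_eval (B l m) x) = 0"
        by (simp add: B_def mult.commute)
      moreover have "j \<noteq> m"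
        using j insert.hyps by auto
      ultimately show ?thesis
        by (intro exI[of _ c']) (auto simp: sum_c' c simp del: sum.insert)
    qed
    show "\<exists>c. \<forall>i\<in>insert m J. (\<Sum>l\<in>insert m J. c l * ?A l i) = of_bool (i = j)"
    proof (cases "j = m")
      case False
      then show ?thesis
        using j by (intro in_J) simp
    next
      case True
      obtain c where c: "\<And>j i. j \<in> J \<Longrightarrow> i \<in> insert m J \<Longrightarrow>
          (\<Sum>l\<in>insert m J. c j l * ?A l i) = of_bool (i = j)"
        using in_J by metis
      \<comment> \<open>Row \<open>m\<close> divided by the pivot has entry 1 in column
        \<open>m\<close>; the dual vectors already found for the other columns remove its remaining
        entries.\<close>
      define c' where "c' l = of_bool (l = m) / ?A m m - (\<Sum>j\<in>J. ?A m j / ?A m m * c j l)" for l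
      have "(\<Sum>l\<in>insert m J. c' l * ?A l i) = of_bool (i = m)" if i: "i \<in> insert m J" for i
      proof -
        have "(\<Sum>l\<in>insert m J. c' l * ?A l i) =
            (\<Sum>l\<in>insert m J. of_bool (l = m) / ?A m m * ?A l i) -
            (\<Sum>l\<in>insert m J. \<Sum>j\<in>J. ?A m j / ?A m m * (c j l * ?A l i))"
          by (simp only: c'_def left_diff_distrib sum_subtractf sum_distrib_right mult.assoc)
        also have "(\<Sum>l\<in>insert m J. of_bool (l = m) / ?A m m * ?A l i) = ?A m i / ?A m m"
        proof -
          have "(\<Sum>l\<in>insert m J. of_bool (l = m) / ?A m m * ?A l i) =
             (\<Sum>l\<in>{m}. of_bool (l = m) / ?A m m * ?A l i)"
            using insert.hyps by (intro sum.mono_neutral_right) auto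
          then show ?thesis
            by simp
        qed
        also have "(\<Sum>l\<in>insert m J. \<Sum>j\<in>J. ?A m j / ?A m m * (c j l * ?A l i)) =
            (\<Sum>j\<in>J. ?A m j / ?A m m * (\<Sum>l\<in>insert m J. c j l * ?A l i))"
          by (subst sum.swap) (simp only: sum_distrib_left)
        also have "\<dots> = (\<Sum>j\<in>J. ?A m j / ?A m m * of_bool (i = j))"
          using c i by (intro sum.cong) auto
        also have "\<dots> = (\<Sum>j\<in>J. if j = i then ?A m j / ?A m m else 0)"
          by (intro sum.cong) auto
        also have "\<dots> = (if i \<in> J then ?A m i / ?A m m else 0)"
          using insert.hyps by simp
        finally show ?thesis
          using i a insert.hyps by auto
      qed
      then show ?thesis
        using True by blast
    qed
  qed
qed

section \<open>Forms in four variables\<close>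

abbreviation ev :: "4 cpoly \<Rightarrow> complex ^ 4 \<Rightarrow> complex" where
  "ev f z \<equiv> poly_eval f (($) z)"

lemma ev_scale: "homogeneous n f \<Longrightarrow> ev f (c *s z) = c ^ n * ev f z"
  using poly_eval_homogeneous_scale[of n f c "($) z"]
  by (simp flip: vector_smult_component)

lemma homogeneous_0: "homogeneous n 0"
  by (simp add: homogeneous_def)

lemma homogeneous_add: "homogeneous n f \<Longrightarrow> homogeneous n g \<Longrightarrow> homogeneous n (f + g)"
  by (simp add: homogeneous_iff_whom whom_add)

lemma homogeneous_diff: "homogeneous n f \<Longrightarrow> homogeneous n g \<Longrightarrow> homogeneous n (f - g)"
  by (simp add: homogeneous_iff_whom whom_diff)

lemma homogeneous_sum:
  "(\<And>i. i \<in> I \<Longrightarrow> homogeneous n (f i)) \<Longrightarrow> homogeneous n (\<Sum>i\<in>I. f i)"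
  by (simp add: homogeneous_iff_whom whom_sum)

lemma homogeneous_mult: "homogeneous n f \<Longrightarrow> homogeneous n' g \<Longrightarrow> homogeneous (n + n') (f * g)"
  by (simp add: homogeneous_iff_whom whom_mult)

lemma homogeneous_cmult: "homogeneous n f \<Longrightarrow> homogeneous n (pconst c * f)"
  by (simp add: homogeneous_iff_whom whom_pconst_mult)

lemma homogeneous_pvar: "homogeneous 1 (pvar v)"
  using whom_pvar[of "\<lambda>_. 1" v] by (simp add: homogeneous_iff_whom)

lemma homogeneous_pvar_power: "homogeneous n (pvar v ^ n)"
  using whom_power[OF whom_pvar, of "\<lambda>_. 1" v n] by (simp add: homogeneous_iff_whom)

lemma homogeneous_prod1:
  "(\<And>i. i \<in> I \<Longrightarrow> homogeneous 1 (f i)) \<Longrightarrow> homogeneous (card I) (\<Prod>i\<in>I. f i)"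
  using whom_prod[of I "\<lambda>_. 1" "\<lambda>_. 1" f] by (simp add: homogeneous_iff_whom)

definition linform :: "complex ^ 4 \<Rightarrow> 4 cpoly" where
  "linform w = (\<Sum>v\<in>UNIV. pconst (w $ v) * pvar v)"

lemma ev_linform: "ev (linform w) z = (\<Sum>v\<in>UNIV. w $ v * z $ v)"
  by (simp add: linform_def)

lemma ev_linform_combination:
  "ev (linform w) (s *s u + t *s v) = s * ev (linform w) u + t * ev (linform w) v"
  by (simp add: ev_linform algebra_simps sum.distrib sum_distrib_left)

lemma ev_linform_left:
  "ev (linform (s *s w + t *s w')) z = s * ev (linform w) z + t * ev (linform w') z"
  by (simp add: ev_linform algebra_simps sum.distrib sum_distrib_left)

lemma ev_linform_axis: "ev (linform (axis k 1)) z = z $ k"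
proof -
  have "ev (linform (axis k 1)) z = (\<Sum>l\<in>UNIV. if l = k then z $ l else 0)"
    unfolding ev_linform by (rule sum.cong) (auto simp: axis_def)
  then show ?thesis
    by simp
qed

lemma homogeneous_linform: "homogeneous 1 (linform w)"
  unfolding linform_def by (intro homogeneous_sum homogeneous_cmult homogeneous_pvar)

section \<open>Planes in affine 4-space\<close>

lemma span_pair: "z \<in> vec.span {u, v} \<longleftrightarrow> (\<exists>s t. z = s *s u + t *s (v :: complex ^ 4))"
proof -
  have "z \<in> vec.span {u, v} \<longleftrightarrow> (\<exists>s t. z - s *s u = t *s v)"
    by (auto simp: vec.span_insert[of u] vec.span_singleton)
  then show ?thesis
    by (simp add: diff_eq_eq add.commute)
qed

lemma independent_pair_iff:
  fixes u v :: "complex ^ 4"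
  shows "u \<noteq> v \<and> vec.independent {u, v} \<longleftrightarrow> (\<exists>i j. u $ i * v $ j - u $ j * v $ i \<noteq> 0)"
proof
  assume *: "u \<noteq> v \<and> vec.independent {u, v}"
  then have "u \<noteq> 0"
    using vec.dependent_zero[of "{u, v}"] by auto
  then obtain i where i: "u $ i \<noteq> 0"
    by (auto simp: vec_eq_iff)
  show "\<exists>i j. u $ i * v $ j - u $ j * v $ i \<noteq> 0"
  proof (rule ccontr)
    assume "\<not> ?thesis"
    then have proportional: "v $ j = v $ i / u $ i * u $ j" for j
      using i by (simp add: field_simps)
    have "v = (v $ i / u $ i) *s u"
      unfolding vec_eq_iff vector_smult_component by (rule allI, rule proportional)
    then have "v \<in> vec.span {u}"
      by (metis insertI1 vec.span_base vec.span_scale)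
    moreover have "vec.independent (insert v {u})"
      using * by (simp add: insert_commute)
    then have "v \<notin> vec.span {u}"
      using * by (auto simp: vec.independent_insert)
    ultimately show False
      by blast
  qed
next
  assume "\<exists>i j. u $ i * v $ j - u $ j * v $ i \<noteq> 0"
  then obtain i j where ij: "u $ i * v $ j - u $ j * v $ i \<noteq> 0"
    by blast
  then have "u \<noteq> v"
    by (auto simp: mult.commute)
  moreover have "u \<noteq> 0"
    using ij by auto
  moreover have "v \<notin> vec.span {u}"
    using ij by (auto simp: vec.span_singleton)
  ultimately show "u \<noteq> v \<and> vec.independent {u, v}"
    by (auto simp: vec.independent_insert insert_commute[of u])
qed

text \<open>Some 2 by 2 minor of a basis is nonzero, and inverting this block normalizes the basis.
  The four remaining entries of \<alpha> and \<beta> are affine coordinates on a chart of the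
  Grassmannian: the four parameters of a line.\<close>

lemma plane_echelon:
  fixes W :: "(complex ^ 4) set"
  assumes "vec.subspace W" "vec.dim W = 2"
  obtains i j \<alpha> \<beta> where "i \<noteq> j" "\<alpha> $ i = 1" "\<alpha> $ j = 0" "\<beta> $ i = 0" "\<beta> $ j = 1"
    "W = vec.span {\<alpha>, \<beta>}"
proof -
  obtain B where B: "B \<subseteq> W" "vec.independent B" "W \<subseteq> vec.span B" "card B = vec.dim W"
    using vec.basis_exists[of W] by auto
  then obtain u v where uv: "B = {u, v}" "u \<noteq> v"
    using assms(2) by (auto simp: card_2_iff)
  have W: "W = vec.span {u, v}"
    using B uv assms(1) by (metis vec.span_subspace)
  obtain i j where "u $ i * v $ j - u $ j * v $ i \<noteq> 0"
    using independent_pair_iff[of u v] B uv by auto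
  then obtain d where d: "d \<noteq> 0" "d = u $ i * v $ j - u $ j * v $ i"
    by auto
  \<comment> \<open>Cramer's rule for the block of coordinates i, j.\<close>
  define \<alpha> where "\<alpha> = (v $ j / d) *s u + (- u $ j / d) *s v"
  define \<beta> where "\<beta> = (- v $ i / d) *s u + (u $ i / d) *s v"
  have *: "\<alpha> $ i = 1" "\<alpha> $ j = 0" "\<beta> $ i = 0" "\<beta> $ j = 1"
  proof -
    have "u $ i * v $ j / d - u $ j * v $ i / d = 1"
      using d(1) unfolding diff_divide_distrib[symmetric] d(2)[symmetric] by simp
    then show "\<alpha> $ i = 1" "\<alpha> $ j = 0" "\<beta> $ i = 0" "\<beta> $ j = 1"
      by (simp_all add: \<alpha>_def \<beta>_def mult.commute algebra_simps)
  qed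
  have "\<alpha> \<in> vec.span {u, v}" "\<beta> \<in> vec.span {u, v}"
    unfolding span_pair \<alpha>_def \<beta>_def by blast+
  then have "vec.span {\<alpha>, \<beta>} \<subseteq> vec.span {u, v}"
    by (intro vec.span_minimal vec.subspace_span) auto
  have "x $ i * \<alpha> $ k + x $ j * \<beta> $ k =
      ((x $ i * v $ j - x $ j * v $ i) * u $ k + (u $ i * x $ j - u $ j * x $ i) * v $ k) / d" for x k
    by (simp add: \<alpha>_def \<beta>_def algebra_simps add_divide_distrib diff_divide_distrib)
  note comb = this
  have "u $ i * \<alpha> $ k + u $ j * \<beta> $ k = u $ k * d / d" for k
    unfolding comb d(2) by (simp add: algebra_simps)
  moreover have "v $ i * \<alpha> $ k + v $ j * \<beta> $ k = v $ k * d / d" for k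
    unfolding comb d(2) by (simp add: algebra_simps)
  ultimately have "u = (u $ i) *s \<alpha> + (u $ j) *s \<beta>" "v = (v $ i) *s \<alpha> + (v $ j) *s \<beta>"
    using d(1) by (simp_all add: vec_eq_iff)
  then have "u \<in> vec.span {\<alpha>, \<beta>}" "v \<in> vec.span {\<alpha>, \<beta>}"
    unfolding span_pair by blast+
  then have "vec.span {u, v} \<subseteq> vec.span {\<alpha>, \<beta>}"
    by (intro vec.span_minimal vec.subspace_span) auto
  with \<open>vec.span {\<alpha>, \<beta>} \<subseteq> vec.span {u, v}\<close> have "W = vec.span {\<alpha>, \<beta>}"
    using W by blast
  moreover have "i \<noteq> j"
    using * by auto
  ultimately show ?thesis
    using that * by blast
qed

lemma linform_prescribed:
  fixes u v :: "complex ^ 4"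
  assumes "u \<noteq> v" "vec.independent {u, v}"
  obtains w where "ev (linform w) u = a" "ev (linform w) v = b"
proof -
  obtain i j where "u $ i * v $ j - u $ j * v $ i \<noteq> 0"
    using independent_pair_iff assms by blast
  then obtain d where d: "d \<noteq> 0" "d = u $ i * v $ j - u $ j * v $ i"
    by auto
  define w where "w = ((a * v $ j - b * u $ j) / d) *s axis i 1 + ((b * u $ i - a * v $ i) / d) *s axis j 1"
  have "ev (linform w) z =
      ((a * v $ j - b * u $ j) * z $ i + (b * u $ i - a * v $ i) * z $ j) / d" for z
    unfolding w_def ev_linform_left ev_linform_axis by (simp add: add_divide_distrib)
  moreover have "(a * v $ j - b * u $ j) * u $ i + (b * u $ i - a * v $ i) * u $ j = a * d"
    "(a * v $ j - b * u $ j) * v $ i + (b * u $ i - a * v $ i) * v $ j = b * d"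
    unfolding d(2) by (simp_all add: algebra_simps)
  ultimately have "ev (linform w) u = a * d / d" "ev (linform w) v = b * d / d"
    by simp_all
  then show ?thesis
    using d(1) that by simp
qed

section \<open>Forms restricted to a plane\<close>

definition binform :: "nat \<Rightarrow> (complex \<Rightarrow> complex \<Rightarrow> complex) \<Rightarrow> bool" where
  "binform n \<phi> \<longleftrightarrow> (\<exists>a. \<forall>s t. \<phi> s t = (\<Sum>i\<le>n. a i * s ^ i * t ^ (n - i)))"

lemma binform_0: "binform n (\<lambda>s t. 0)"
  unfolding binform_def by (rule exI[of _ "\<lambda>_. 0"]) simp

lemma binform_add:
  assumes "binform n \<phi>" "binform n \<psi>"
  shows "binform n (\<lambda>s t. \<phi> s t + \<psi> s t)"
proof -
  obtain a b where "\<forall>s t. \<phi> s t = (\<Sum>i\<le>n. a i * s ^ i * t ^ (n - i))"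
    "\<forall>s t. \<psi> s t = (\<Sum>i\<le>n. b i * s ^ i * t ^ (n - i))"
    using assms unfolding binform_def by blast
  then show ?thesis
    unfolding binform_def
    by (intro exI[of _ "\<lambda>i. a i + b i"]) (simp add: algebra_simps sum.distrib)
qed

lemma binform_sum:
  "(\<And>i. i \<in> I \<Longrightarrow> binform n (\<phi> i)) \<Longrightarrow> binform n (\<lambda>s t. \<Sum>i\<in>I. \<phi> i s t)"
  by (induction I rule: infinite_finite_induct) (auto intro: binform_0 binform_add)

lemma binform_monom:
  assumes "k + l = n"
  shows "binform n (\<lambda>s t. c * s ^ k * t ^ l)"
proof -
  have "(\<Sum>i\<le>n. of_bool (i = k) * c * s ^ i * t ^ (n - i)) = (\<Sum>i\<in>{k}. c * s ^ i * t ^ (n - i))" for s t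
    using assms by (intro sum.mono_neutral_cong_right) auto
  moreover have "n - k = l"
    using assms by auto
  ultimately show ?thesis
    unfolding binform_def by (intro exI[of _ "\<lambda>i. of_bool (i = k) * c"]) auto
qed

lemma binform_mult:
  assumes "binform n \<phi>" "binform m \<psi>"
  shows "binform (n + m) (\<lambda>s t. \<phi> s t * \<psi> s t)"
proof -
  obtain a b where "\<forall>s t. \<phi> s t = (\<Sum>i\<le>n. a i * s ^ i * t ^ (n - i))"
    "\<forall>s t. \<psi> s t = (\<Sum>j\<le>m. b j * s ^ j * t ^ (m - j))"
    using assms unfolding binform_def by blast
  then have "(\<lambda>s t. \<phi> s t * \<psi> s t) =
      (\<lambda>s t. \<Sum>i\<le>n. \<Sum>j\<le>m. (a i * b j) * s ^ (i + j) * t ^ ((n - i) + (m - j)))"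
    by (intro ext) (simp only: sum_product power_add mult_ac)
  moreover have "binform (n + m) (\<lambda>s t. \<Sum>i\<le>n. \<Sum>j\<le>m. (a i * b j) * s ^ (i + j) * t ^ ((n - i) + (m - j)))"
    by (intro binform_sum binform_monom) auto
  ultimately show ?thesis
    by simp
qed

lemma binform_const: "binform 0 (\<lambda>s t. c)"
  using binform_monom[of 0 0 0 c] by simp

lemma binform_cmult: "binform n \<phi> \<Longrightarrow> binform n (\<lambda>s t. c * \<phi> s t)"
  using binform_mult[OF binform_const] by force

lemma binform_linear: "binform 1 (\<lambda>s t. s * a + t * b)"
  using binform_add[OF binform_monom[of 1 0 1 a] binform_monom[of 0 1 1 b]] by (simp add: mult.commute)

lemma binform_power: "binform n \<phi> \<Longrightarrow> binform (n * k) (\<lambda>s t. \<phi> s t ^ k)"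
  by (induction k) (auto intro: binform_const binform_mult)

lemma binform_prod:
  "(\<And>i. i \<in> I \<Longrightarrow> binform (n i) (\<phi> i)) \<Longrightarrow> binform (\<Sum>i\<in>I. n i) (\<lambda>s t. \<Prod>i\<in>I. \<phi> i s t)"
  by (induction I rule: infinite_finite_induct) (auto intro: binform_const binform_mult)

lemma binform_ev:
  assumes "homogeneous n f"
  shows "binform n (\<lambda>s t. ev f (s *s u + t *s v))"
  unfolding poly_eval_def
proof (intro binform_sum binform_cmult)
  fix m assume m: "m \<in> Poly_Mapping.keys f"
  have "binform (\<Sum>l\<in>Poly_Mapping.keys m. 1 * Poly_Mapping.lookup m l)
      (\<lambda>s t. \<Prod>l\<in>Poly_Mapping.keys m. (s * u $ l + t * v $ l) ^ Poly_Mapping.lookup m l)"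
    by (intro binform_prod binform_power binform_linear)
  then show "binform n (\<lambda>s t. \<Prod>l\<in>Poly_Mapping.keys m. (s *s u + t *s v) $ l ^ Poly_Mapping.lookup m l)"
    using assms m by (simp add: homogeneous_def)
qed

lemma ev_line_poly:
  assumes "homogeneous n f"
  obtains p where "degree p \<le> n" "\<And>t. ev f (u + t *s v) = poly p t"
proof -
  obtain a where a: "\<forall>s t. ev f (s *s u + t *s v) = (\<Sum>i\<le>n. a i * s ^ i * t ^ (n - i))"
    using binform_ev[OF assms] unfolding binform_def by blast
  let ?p = "\<Sum>i\<le>n. Polynomial.monom (a i) (n - i)"
  have "degree ?p \<le> n"
    by (rule degree_sum_le) (auto intro: order_trans[OF degree_monom_le])
  moreover have "ev f (u + t *s v) = poly ?p t" for t
    using a[rule_format, of 1 t] by (simp add: poly_sum poly_monom)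
  ultimately show ?thesis
    using that by blast
qed

text \<open>Binary forms of degree e have e + 1 coefficients, so the restrictions of
  \<open>f\<close> and of the e + 1 forms \<phi> are linearly dependent. Evaluating the relation at
  \<open>y r\<close> kills the coefficient of \<open>\<phi> r\<close>, and only \<open>f\<close> is
  left.\<close>

lemma vanishes_on_plane:
  assumes f: "homogeneous e f" "\<And>r. r \<le> e \<Longrightarrow> ev f (y r) = 0"
    and \<phi>: "\<And>s. s \<le> e \<Longrightarrow> homogeneous e (\<phi> s)"
      "\<And>r s. r \<le> e \<Longrightarrow> s \<le> e \<Longrightarrow> ev (\<phi> s) (y r) = of_bool (r = s)"
    and y: "\<And>r. r \<le> e \<Longrightarrow> y r \<in> vec.span {u, v}"
    and z: "z \<in> vec.span {u, v}"
  shows "ev f z = 0"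
proof -
  define \<psi> where "\<psi> s = (if s \<le> e then \<phi> s else f)" for s
  have "\<forall>s. \<exists>a. \<forall>x t. ev (\<psi> s) (x *s u + t *s v) = (\<Sum>i\<le>e. a i * x ^ i * t ^ (e - i))"
  proof
    fix s
    have "homogeneous e (\<psi> s)"
      using f \<phi> by (simp add: \<psi>_def)
    from binform_ev[OF this] show "\<exists>a. \<forall>x t. ev (\<psi> s) (x *s u + t *s v) = (\<Sum>i\<le>e. a i * x ^ i * t ^ (e - i))"
      unfolding binform_def .
  qed
  then obtain a where a: "\<And>s x t. ev (\<psi> s) (x *s u + t *s v) = (\<Sum>i\<le>e. a s i * x ^ i * t ^ (e - i))"
    by metis
  obtain c where c: "\<exists>s\<le>Suc e. c s \<noteq> 0" "\<And>i. i \<le> e \<Longrightarrow> (\<Sum>s\<le>Suc e. a s i * c s) = 0"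
    using underdetermined_system[of "{..e}" "{..Suc e}" a] by auto
  have rel: "(\<Sum>s\<le>Suc e. c s * ev (\<psi> s) z) = 0" if z_in: "z \<in> vec.span {u, v}" for z
  proof -
    obtain x t where z: "z = x *s u + t *s v"
      using z_in unfolding span_pair by blast
    have "(\<Sum>s\<le>Suc e. c s * ev (\<psi> s) z) =
        (\<Sum>s\<le>Suc e. \<Sum>i\<le>e. a s i * c s * (x ^ i * t ^ (e - i)))"
      unfolding z a sum_distrib_left by (intro sum.cong) (auto simp: mult_ac)
    also have "\<dots> = (\<Sum>i\<le>e. (\<Sum>s\<le>Suc e. a s i * c s) * (x ^ i * t ^ (e - i)))"
      by (subst sum.swap) (simp only: sum_distrib_right)
    also have "\<dots> = 0"
      using c(2) by (intro sum.neutral) auto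
    finally show ?thesis .
  qed
  have c0: "c r = 0" if r: "r \<le> e" for r
  proof -
    have "(\<Sum>s\<le>e. c s * ev (\<psi> s) (y r)) = (\<Sum>s\<in>{r}. c s)"
      using \<phi>(2) r by (intro sum.mono_neutral_cong_right) (auto simp: \<psi>_def)
    then show ?thesis
      using rel[OF y[OF r]] f(2) r by (simp add: \<psi>_def)
  qed
  then have "c (Suc e) \<noteq> 0"
    using c(1) by (metis le_Suc_eq)
  moreover have "(\<Sum>s\<le>e. c s * ev (\<psi> s) z) = 0"
    using c0 by (intro sum.neutral) auto
  ultimately show ?thesis
    using rel[OF z] by (simp add: \<psi>_def)
qed

text \<open>The values at \<open>u\<close> and \<open>v\<close> are the two extreme coefficients of
  the binary form; if they vanish, s t divides it. Linear forms that restrict to s and t extend the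
  quotient from the plane to the whole space.\<close>

lemma divide_by_coordinates:
  assumes uv: "u \<noteq> v" "vec.independent {u, v}"
    and f: "homogeneous (e + 2) f" "ev f u = 0" "ev f v = 0"
  obtains h where "homogeneous e h" "\<And>s t. ev f (s *s u + t *s v) = s * t * ev h (s *s u + t *s v)"
proof -
  obtain a where a: "\<forall>s t. ev f (s *s u + t *s v) = (\<Sum>i\<le>e+2. a i * s ^ i * t ^ (e + 2 - i))"
    using binform_ev[OF f(1)] unfolding binform_def by blast
  obtain w where w: "ev (linform w) u = 1" "ev (linform w) v = 0"
    using linform_prescribed[OF uv] .
  obtain w' where w': "ev (linform w') u = 0" "ev (linform w') v = 1"
    using linform_prescribed[OF uv] .
  have split: "(\<Sum>i\<le>e+2. g i) = g 0 + (\<Sum>i\<le>e. g (Suc i)) + g (e + 2)" for g :: "nat \<Rightarrow> complex"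
  proof -
    have "(\<Sum>i\<le>e+2. g i) = (\<Sum>i\<le>Suc e. g i) + g (e + 2)"
      by simp
    then show ?thesis
      by (simp only: sum.atMost_Suc_shift)
  qed
  have "a (e + 2) = 0"
    using a[rule_format, of 1 0] f(2) unfolding split by (simp add: power_0_left)
  have "a 0 = 0"
    using a[rule_format, of 0 1] f(3) unfolding split by (simp add: power_0_left)
  define h where "h = (\<Sum>i\<le>e. pconst (a (Suc i)) * (linform w ^ i * linform w' ^ (e - i)))"
  have "homogeneous i (linform w ^ i)" for i w
    using whom_power[of "\<lambda>_. 1" 1 "linform w" i] homogeneous_linform by (simp add: homogeneous_iff_whom)
  then have "homogeneous (i + (e - i)) (linform w ^ i * linform w' ^ (e - i))" for i
    by (intro homogeneous_mult)
  then have "homogeneous e (linform w ^ i * linform w' ^ (e - i))" if "i \<le> e" for i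
    using that by (metis le_add_diff_inverse)
  then have "homogeneous e h"
    unfolding h_def by (intro homogeneous_sum homogeneous_cmult) auto
  moreover have "ev f (s *s u + t *s v) = s * t * ev h (s *s u + t *s v)" for s t
  proof -
    have "ev f (s *s u + t *s v) = (\<Sum>i\<le>e. a (Suc i) * s ^ Suc i * t ^ (e + 1 - i))"
      using a[rule_format, of s t] \<open>a 0 = 0\<close> \<open>a (e + 2) = 0\<close> unfolding split by simp
    also have "\<dots> = (\<Sum>i\<le>e. s * t * (a (Suc i) * (s ^ i * t ^ (e - i))))"
      by (intro sum.cong) (auto simp: Suc_diff_le)
    also have "\<dots> = s * t * ev h (s *s u + t *s v)"
      by (simp add: h_def ev_linform_combination w w' sum_distrib_left del: poly_eval_power)
        (simp add: ev_linform_combination w w')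
    finally show ?thesis .
  qed
  ultimately show ?thesis
    using that by blast
qed

lemma lagrange_on_line:
  assumes uv: "u \<noteq> v" "vec.independent {u, v}" and "r \<le> e"
  obtains g where "homogeneous e g" "\<And>s. s \<le> e \<Longrightarrow> ev g (u + of_nat s *s v) = of_bool (s = r)"
proof -
  \<comment> \<open>On the points \<open>u + t v\<close> the form takes the value (t - s) / (r - s).
    For s = r both quotients are 0 by convention; that factor is left out of the product.\<close>
  have "\<exists>w. ev (linform w) u = - of_nat s / (of_nat r - of_nat s) \<and>
      ev (linform w) v = 1 / (of_nat r - of_nat s)" for s
    using linform_prescribed[OF uv] by metis
  then obtain w where w: "\<And>s. ev (linform (w s)) u = - of_nat s / (of_nat r - of_nat s)"
      "\<And>s. ev (linform (w s)) v = 1 / (of_nat r - of_nat s)"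
    by metis
  define g where "g = (\<Prod>s\<in>{..e} - {r}. linform (w s))"
  have "homogeneous (card ({..e} - {r})) g"
    unfolding g_def by (intro homogeneous_prod1 homogeneous_linform)
  then have "homogeneous e g"
    using assms by simp
  moreover have "ev g (u + of_nat t *s v) = of_bool (t = r)" if "t \<le> e" for t
  proof -
    have *: "ev (linform (w s)) (u + of_nat t *s v) = (of_nat t - of_nat s) / (of_nat r - of_nat s)" for s
      using ev_linform_combination[of "w s" 1 u "of_nat t" v] w[of s] by (simp add: diff_divide_distrib)
    show ?thesis
    proof (cases "t = r")
      case True
      then show ?thesis
        unfolding g_def poly_eval_prod * by simp
    next
      case False
      then have "(\<Prod>s\<in>{..e} - {r}. (of_nat t - of_nat s) / (of_nat r - of_nat s) :: complex) = 0"
        using that by (intro prod_zero) auto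
      then show ?thesis
        unfolding g_def poly_eval_prod * using False by simp
    qed
  qed
  ultimately show ?thesis
    using that by blast
qed

section \<open>Independent lines\<close>

text \<open>Surjectivity of the restriction from forms of degree e to the direct sum of their
  restrictions to the lines, tested on one summand at a time. Lines are given by their planes in
  affine 4-space.\<close>

definition indep_lines :: "nat \<Rightarrow> nat \<Rightarrow> (nat \<Rightarrow> (complex ^ 4) set) \<Rightarrow> bool" where
  "indep_lines e k W \<longleftrightarrow> (\<forall>a<k. \<forall>g. homogeneous e g \<longrightarrow> (\<exists>G. homogeneous e G \<and>
     (\<forall>b<k. b \<noteq> a \<longrightarrow> (\<forall>z\<in>W b. ev G z = 0)) \<and> (\<forall>z\<in>W a. ev G z = ev g z)))"

lemma indep_linesD:
  assumes "indep_lines e k W" "a < k" "homogeneous e g"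
  obtains G where "homogeneous e G" "\<And>b z. b < k \<Longrightarrow> b \<noteq> a \<Longrightarrow> z \<in> W b \<Longrightarrow> ev G z = 0"
    "\<And>z. z \<in> W a \<Longrightarrow> ev G z = ev g z"
proof -
  have "\<exists>G. homogeneous e G \<and> (\<forall>b<k. b \<noteq> a \<longrightarrow> (\<forall>z\<in>W b. ev G z = 0)) \<and> (\<forall>z\<in>W a. ev G z = ev g z)"
    using assms unfolding indep_lines_def by simp
  then show ?thesis
    using that by auto
qed

text \<open>A form of degree e on a line is determined by its values at e + 1 points that admit dual
  forms, so finitely many values decide. This turns independence into the non-vanishing of a
  determinant.\<close>

lemma indep_linesI:
  assumes W: "\<And>a. a < k \<Longrightarrow> W a = vec.span {u a, v a}"
    and y: "\<And>a s. a < k \<Longrightarrow> s \<le> e \<Longrightarrow> y a s \<in> W a"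
    and f: "\<And>a s. a < k \<Longrightarrow> s \<le> e \<Longrightarrow> homogeneous e (f a s)"
      "\<And>a s b t. a < k \<Longrightarrow> s \<le> e \<Longrightarrow> b < k \<Longrightarrow> t \<le> e \<Longrightarrow>
         ev (f a s) (y b t) = of_bool (a = b \<and> s = t)"
  shows "indep_lines e k W"
  unfolding indep_lines_def
proof (intro allI impI)
  fix a and g :: "4 cpoly" assume a: "a < k" and g: "homogeneous e g"
  define G where "G = (\<Sum>s\<le>e. pconst (ev g (y a s)) * f a s)"
  have G: "homogeneous e G"
    unfolding G_def using f(1) a by (intro homogeneous_sum homogeneous_cmult) auto
  have ev_G: "ev G (y b t) = of_bool (a = b) * ev g (y a t)" if "b < k" "t \<le> e" for b t
  proof -
    have "ev G (y b t) = (\<Sum>s\<le>e. ev g (y a s) * of_bool (a = b \<and> s = t))"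
      unfolding G_def using f(2) a that by simp
    also have "\<dots> = (\<Sum>s\<in>{t}. ev g (y a s) * of_bool (a = b))"
      using that by (intro sum.mono_neutral_cong_right) auto
    finally show ?thesis
      by simp
  qed
  have vanish: "ev F z = 0" if "b < k" "homogeneous e F" "\<And>t. t \<le> e \<Longrightarrow> ev F (y b t) = 0" "z \<in> W b" for b F z
  proof (rule vanishes_on_plane[of e F "y b" "f b" "u b" "v b"])
    show "ev (f b s) (y b r) = of_bool (r = s)" if "r \<le> e" "s \<le> e" for r s
      using f(2)[of b s b r] that \<open>b < k\<close> by auto
  qed (use that W y f(1) in auto)
  have "ev G z = 0" if "b < k" "b \<noteq> a" "z \<in> W b" for b z
    using vanish[of b G z] that G ev_G by auto
  moreover have "ev (G - g) z = 0" if "z \<in> W a" for z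
    using vanish[of a "G - g" z] that a homogeneous_diff[OF G g] ev_G by auto
  ultimately show "\<exists>G. homogeneous e G \<and> (\<forall>b<k. b \<noteq> a \<longrightarrow> (\<forall>z\<in>W b. ev G z = 0)) \<and> (\<forall>z\<in>W a. ev G z = ev g z)"
    using G by (intro exI[of _ G]) auto
qed

text \<open>Converse of \<open>indep_linesI\<close> for the points \<open>u + t v\<close>: a
  Lagrange form of one line is extended by zero on the other lines.\<close>

lemma indep_lines_dual:
  assumes "indep_lines e k W"
    and W: "\<And>a. a < k \<Longrightarrow> W a = vec.span {u a, v a}"
    and uv: "\<And>a. a < k \<Longrightarrow> u a \<noteq> v a \<and> vec.independent {u a, v a}"
    and "a < k" "s \<le> e"
  shows "\<exists>f. homogeneous e f \<and> (\<forall>b<k. \<forall>t\<le>e. ev f (u b + of_nat t *s v b) = of_bool (a = b \<and> s = t))"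
proof -
  obtain g where g: "homogeneous e g" "\<And>t. t \<le> e \<Longrightarrow> ev g (u a + of_nat t *s v a) = of_bool (t = s)"
    using lagrange_on_line uv assms(4,5) by metis
  obtain G where G: "homogeneous e G" "\<And>b z. b < k \<Longrightarrow> b \<noteq> a \<Longrightarrow> z \<in> W b \<Longrightarrow> ev G z = 0"
    "\<And>z. z \<in> W a \<Longrightarrow> ev G z = ev g z"
    using indep_linesD[OF assms(1,4) g(1)] by blast
  have "u b + of_nat t *s v b \<in> W b" if "b < k" for b t
    unfolding W[OF that] span_pair by (intro exI[of _ 1] exI[of _ "of_nat t"]) simp
  then show ?thesis
  proof (intro exI[of _ G] conjI allI impI)
    fix b t assume b: "b < k" and t: "t \<le> e"
    show "ev G (u b + of_nat t *s v b) = of_bool (a = b \<and> s = t)"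
    proof (cases "b = a")
      case True
      then show ?thesis
        using G(3) g(2)[OF t] \<open>\<And>t b. b < k \<Longrightarrow> u b + of_nat t *s v b \<in> W b\<close> b by auto
    next
      case False
      then show ?thesis
        using G(2)[OF b] \<open>\<And>t b. b < k \<Longrightarrow> u b + of_nat t *s v b \<in> W b\<close> b by auto
    qed
  qed (rule G(1))
qed

lemma indep_lines_mono:
  assumes "indep_lines e k W" "k' \<le> k"
  shows "indep_lines e k' W"
  unfolding indep_lines_def
proof (intro allI impI)
  fix a and g :: "4 cpoly" assume "a < k'" "homogeneous e g"
  moreover from this have "a < k"
    using assms(2) by simp
  ultimately obtain G where G: "homogeneous e G"
    "\<And>b z. b < k \<Longrightarrow> b \<noteq> a \<Longrightarrow> z \<in> W b \<Longrightarrow> ev G z = 0"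
    "\<And>z. z \<in> W a \<Longrightarrow> ev G z = ev g z"
    using indep_linesD[OF assms(1), of a g] by blast
  show "\<exists>G. homogeneous e G \<and> (\<forall>b<k'. b \<noteq> a \<longrightarrow> (\<forall>z\<in>W b. ev G z = 0)) \<and> (\<forall>z\<in>W a. ev G z = ev g z)"
    using G(1,3) G(2)[OF less_le_trans[OF _ assms(2)]] by (intro exI[of _ G]) blast
qed

section \<open>Finite families of forms that detect base points\<close>

lemma pconst_add: "pconst (a + b) = pconst a + pconst b"
  by (simp add: pconst_def single_add)

lemma pconst_mult: "pconst (a * b) = pconst a * pconst b"
  by (simp add: pconst_def mult_single)

lemma pconst_1: "pconst 1 = 1"
  by (simp add: pconst_def)

interpretation cpoly: vector_space "\<lambda>c f. pconst c * (f :: 'v cpoly)"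
  by unfold_locales (simp_all add: pconst_add pconst_mult pconst_1 algebra_simps)

lemma finite_monomials_of_degree:
  "finite {m :: 'v::finite \<Rightarrow>\<^sub>0 nat. (\<Sum>v\<in>Poly_Mapping.keys m. Poly_Mapping.lookup m v) = n}"
proof (rule finite_imageD)
  show "inj_on Poly_Mapping.lookup
      {m :: 'v \<Rightarrow>\<^sub>0 nat. (\<Sum>v\<in>Poly_Mapping.keys m. Poly_Mapping.lookup m v) = n}"
    by (rule inj_onI, rule poly_mapping_eqI) (rule fun_cong)
  have "Poly_Mapping.lookup m v \<le> (\<Sum>v\<in>Poly_Mapping.keys m. Poly_Mapping.lookup m v)"
    for m :: "'v \<Rightarrow>\<^sub>0 nat" and v
    by (cases "v \<in> Poly_Mapping.keys m") (auto intro: member_le_sum simp: in_keys_iff)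
  then have "Poly_Mapping.lookup ` {m :: 'v \<Rightarrow>\<^sub>0 nat.
      (\<Sum>v\<in>Poly_Mapping.keys m. Poly_Mapping.lookup m v) = n} \<subseteq> PiE UNIV (\<lambda>_. {..n})"
    by auto
  then show "finite (Poly_Mapping.lookup ` {m :: 'v \<Rightarrow>\<^sub>0 nat.
      (\<Sum>v\<in>Poly_Mapping.keys m. Poly_Mapping.lookup m v) = n})"
    by (rule finite_subset) (simp add: finite_PiE)
qed

text \<open>Only base points are compared, not spans. A finite family makes the set of bad
  coefficient vectors a finite union of thin sets.\<close>

definition generates_forms :: "nat \<Rightarrow> (complex ^ 4) set \<Rightarrow> 4 cpoly set \<Rightarrow> bool" where
  "generates_forms n X \<G> \<longleftrightarrow> finite \<G> \<and>
     (\<forall>G\<in>\<G>. homogeneous n G \<and> (\<forall>x\<in>X. ev G x = 0)) \<and>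
     (\<forall>G z. homogeneous n G \<longrightarrow> (\<forall>x\<in>X. ev G x = 0) \<longrightarrow> ev G z \<noteq> 0 \<longrightarrow> (\<exists>H\<in>\<G>. ev H z \<noteq> 0))"

lemma generates_formsD:
  assumes "generates_forms n X \<G>"
  shows "finite \<G>" "\<And>G. G \<in> \<G> \<Longrightarrow> homogeneous n G"
    "\<And>G x. G \<in> \<G> \<Longrightarrow> x \<in> X \<Longrightarrow> ev G x = 0"
    "\<And>G z. homogeneous n G \<Longrightarrow> (\<And>x. x \<in> X \<Longrightarrow> ev G x = 0) \<Longrightarrow> ev G z \<noteq> 0 \<Longrightarrow> \<exists>H\<in>\<G>. ev H z \<noteq> 0"
  using assms unfolding generates_forms_def by simp_all

lemma ex_generates_forms: "\<exists>\<G>. generates_forms n X \<G>"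
proof -
  define V where "V = {G. homogeneous n G \<and> (\<forall>x\<in>X. ev G x = 0)}"
  define T where "T = (\<lambda>m. Poly_Mapping.single m 1 :: 4 cpoly) `
      {m. (\<Sum>v\<in>Poly_Mapping.keys m. Poly_Mapping.lookup m v) = n}"
  have "finite T"
    unfolding T_def by (intro finite_imageI finite_monomials_of_degree)
  have "f \<in> cpoly.span T" if f: "homogeneous n f" for f
  proof -
    have "(\<Sum>m\<in>Poly_Mapping.keys f. pconst (Poly_Mapping.lookup f m) * Poly_Mapping.single m 1)
        \<in> cpoly.span T"
    proof (intro cpoly.span_sum cpoly.span_scale cpoly.span_base)
      fix m assume "m \<in> Poly_Mapping.keys f"
      then show "Poly_Mapping.single m 1 \<in> T"
        using f by (auto simp: T_def homogeneous_def)
    qed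
    moreover have "(\<Sum>m\<in>Poly_Mapping.keys f. pconst (Poly_Mapping.lookup f m) * Poly_Mapping.single m 1) = f"
      using poly_mapping_sum_singles[of f] by (simp add: pconst_def mult_single)
    ultimately show ?thesis
      by simp
  qed
  then have "V \<subseteq> cpoly.span T"
    by (auto simp: V_def)
  obtain B where B: "B \<subseteq> V" "cpoly.independent B" "V \<subseteq> cpoly.span B"
    using cpoly.maximal_independent_subset[of V] by auto
  have "finite B"
    using cpoly.independent_span_bound[OF \<open>finite T\<close> B(2)] B(1) \<open>V \<subseteq> cpoly.span T\<close> by auto
  moreover have "\<exists>H\<in>B. ev H z \<noteq> 0"
    if "homogeneous n G" "\<And>x. x \<in> X \<Longrightarrow> ev G x = 0" "ev G z \<noteq> 0" for G z
  proof (rule ccontr)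
    assume *: "\<not> ?thesis"
    have "G \<in> cpoly.span B"
      using that B(3) by (auto simp: V_def)
    then have "ev G z = 0"
      by (induction rule: cpoly.span_induct_alt) (use * in auto)
    then show False
      using that by simp
  qed
  ultimately show ?thesis
    using B(1) unfolding generates_forms_def V_def by (intro exI[of _ B]) auto
qed

section \<open>Forms that vanish on independent lines\<close>

text \<open>Equations of the plane in its echelon chart. For k = i and k = j they are trivial; the
  other two have the identity as Jacobian matrix in the coordinates other than i, j.\<close>

definition echform :: "4 \<Rightarrow> 4 \<Rightarrow> complex ^ 4 \<Rightarrow> complex ^ 4 \<Rightarrow> 4 \<Rightarrow> 4 cpoly" where
  "echform i j \<alpha> \<beta> k = pvar k - (pconst (\<alpha> $ k) * pvar i + pconst (\<beta> $ k) * pvar j)"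

lemma ev_echform: "ev (echform i j \<alpha> \<beta> k) z = z $ k - (\<alpha> $ k * z $ i + \<beta> $ k * z $ j)"
  by (simp add: echform_def)

lemma homogeneous_echform: "homogeneous 1 (echform i j \<alpha> \<beta> k)"
  unfolding echform_def
  by (intro homogeneous_diff homogeneous_add homogeneous_cmult homogeneous_pvar)

lemma echform_plane:
  assumes "\<alpha> $ i = 1" "\<alpha> $ j = 0" "\<beta> $ i = 0" "\<beta> $ j = 1"
  shows "z \<in> vec.span {\<alpha>, \<beta>} \<longleftrightarrow> (\<forall>k. ev (echform i j \<alpha> \<beta> k) z = 0)"
proof
  assume "z \<in> vec.span {\<alpha>, \<beta>}"
  then show "\<forall>k. ev (echform i j \<alpha> \<beta> k) z = 0"
    using assms unfolding span_pair by (auto simp: ev_echform)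
next
  assume *: "\<forall>k. ev (echform i j \<alpha> \<beta> k) z = 0"
  have eq: "z $ k = z $ i * \<alpha> $ k + z $ j * \<beta> $ k" for k
    using *[rule_format, of k] by (simp add: ev_echform mult.commute)
  have "z = (z $ i) *s \<alpha> + (z $ j) *s \<beta>"
    unfolding vec_eq_iff vector_add_component vector_smult_component by (rule allI, rule eq)
  then show "z \<in> vec.span {\<alpha>, \<beta>}"
    unfolding span_pair by blast
qed

lemma linform_separates:
  fixes W :: "(complex ^ 4) set"
  assumes "vec.subspace W" "vec.dim W = 2" "z \<notin> W"
  obtains l where "homogeneous 1 l" "\<And>x. x \<in> W \<Longrightarrow> ev l x = 0" "ev l z \<noteq> 0"
proof -
  obtain i j \<alpha> \<beta> where *: "\<alpha> $ i = 1" "\<alpha> $ j = 0" "\<beta> $ i = 0" "\<beta> $ j = 1" "W = vec.span {\<alpha>, \<beta>}"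
    using plane_echelon[OF assms(1,2)] by metis
  then show ?thesis
    using echform_plane[OF *(1-4)] assms(3) homogeneous_echform that by blast
qed

lemma multiply_up:
  assumes "homogeneous n G" "n \<le> n'" "z \<noteq> 0" "ev G z \<noteq> 0"
  obtains H where "homogeneous n' H" "\<And>x. ev G x = 0 \<Longrightarrow> ev H x = 0" "ev H z \<noteq> 0"
proof -
  obtain i where "z $ i \<noteq> 0"
    using assms(3) by (auto simp: vec_eq_iff)
  moreover have "homogeneous n' (G * pvar i ^ (n' - n))"
    using homogeneous_mult[OF assms(1) homogeneous_pvar_power[of "n' - n" i]] assms(2) by simp
  ultimately show ?thesis
    using assms(4) by (intro that[of "G * pvar i ^ (n' - n)"]) auto
qed

text \<open>A power of a coordinate that is nonzero at \<open>z\<close> is prescribed on line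
  \<open>a\<close>, and zero on the others. In particular independent lines are disjoint.\<close>

lemma indep_lines_nonzero_at:
  assumes "indep_lines e k W" "a < k" "z \<in> W a" "z \<noteq> 0" "e \<le> n"
  obtains G where "homogeneous n G" "\<And>b x. b < k \<Longrightarrow> b \<noteq> a \<Longrightarrow> x \<in> W b \<Longrightarrow> ev G x = 0" "ev G z \<noteq> 0"
proof -
  obtain i where i: "z $ i \<noteq> 0"
    using assms(4) by (auto simp: vec_eq_iff)
  obtain G where G: "homogeneous e G" "\<And>b x. b < k \<Longrightarrow> b \<noteq> a \<Longrightarrow> x \<in> W b \<Longrightarrow> ev G x = 0"
    "\<And>x. x \<in> W a \<Longrightarrow> ev G x = ev (pvar i ^ e) x"
    using indep_linesD[OF assms(1,2) homogeneous_pvar_power[of e i]] by blast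
  then have "ev G z \<noteq> 0"
    using i assms(3) by simp
  from multiply_up[OF G(1) assms(5,4) this] G(2) that show ?thesis
    by metis
qed

text \<open>Off the lines, the forms of degree \<open>e + 1\<close> through them have no base point: if all forms of
  degree \<open>e\<close> through the lines vanish at \<open>z\<close>, then some form of degree \<open>e\<close> through all lines but
  one does not, and it can be multiplied by a linear form that vanishes on the remaining line.\<close>

lemma indep_lines_base_point_free:
  assumes indep: "indep_lines e k W"
    and W: "\<And>a. a < k \<Longrightarrow> vec.subspace (W a) \<and> vec.dim (W a) = 2"
    and z: "z \<noteq> 0" "\<And>a. a < k \<Longrightarrow> z \<notin> W a" and n: "e + 1 \<le> n"
  obtains G where "homogeneous n G" "\<And>a x. a < k \<Longrightarrow> x \<in> W a \<Longrightarrow> ev G x = 0" "ev G z \<noteq> 0"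
proof -
  have "\<exists>m G. m \<le> n \<and> homogeneous m G \<and> (\<forall>a<k. \<forall>x\<in>W a. ev G x = 0) \<and> ev G z \<noteq> 0"
  proof (cases "\<exists>a<k. \<exists>G. homogeneous e G \<and> (\<forall>b<k. b \<noteq> a \<longrightarrow> (\<forall>x\<in>W b. ev G x = 0)) \<and> ev G z \<noteq> 0")
    case True
    then obtain a G where G: "a < k" "homogeneous e G" "ev G z \<noteq> 0"
      "\<And>b x. b < k \<Longrightarrow> b \<noteq> a \<Longrightarrow> x \<in> W b \<Longrightarrow> ev G x = 0"
      by blast
    obtain l where l: "homogeneous 1 l" "\<And>x. x \<in> W a \<Longrightarrow> ev l x = 0" "ev l z \<noteq> 0"
      using linform_separates W[OF G(1)] z(2)[OF G(1)] by metis
    have "ev (G * l) x = 0" if "b < k" "x \<in> W b" for b x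
      using G(4) l(2) that by (cases "b = a") auto
    then show ?thesis
      using homogeneous_mult[OF G(2) l(1)] G(3) l(3) n
      by (intro exI[of _ "e + 1"] exI[of _ "G * l"]) auto
  next
    case False
    obtain i where i: "z $ i \<noteq> 0"
      using z(1) by (auto simp: vec_eq_iff)
    let ?g = "pvar i ^ e"
    have "\<forall>a. \<exists>G. a < k \<longrightarrow> homogeneous e G \<and> (\<forall>b<k. b \<noteq> a \<longrightarrow> (\<forall>x\<in>W b. ev G x = 0)) \<and>
        (\<forall>x\<in>W a. ev G x = ev ?g x)"
      using indep homogeneous_pvar_power[of e i] unfolding indep_lines_def by blast
    then obtain G where G: "\<And>a. a < k \<Longrightarrow> homogeneous e (G a)"
      "\<And>a b x. a < k \<Longrightarrow> b < k \<Longrightarrow> b \<noteq> a \<Longrightarrow> x \<in> W b \<Longrightarrow> ev (G a) x = 0"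
      "\<And>a x. a < k \<Longrightarrow> x \<in> W a \<Longrightarrow> ev (G a) x = ev ?g x"
      by metis
    have zero: "ev (G a) z = 0" if "a < k" for a
      using False G(1,2) that by blast
    \<comment> \<open>The corrections \<open>G a\<close> make \<open>?g\<close> vanish on every line
      and, in the present case, are themselves zero at \<open>z\<close>, so the value there is
      unchanged.\<close>
    let ?F = "?g - (\<Sum>a<k. G a)"
    have "ev ?F x = 0" if "b < k" "x \<in> W b" for b x
    proof -
      have "(\<Sum>a<k. ev (G a) x) = (\<Sum>a\<in>{b}. ev ?g x)"
        using G(2,3) that by (intro sum.mono_neutral_cong_right) auto
      then show ?thesis
        by simp
    qed
    moreover have "homogeneous e ?F"
      by (intro homogeneous_diff homogeneous_pvar_power homogeneous_sum G(1)) simp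
    moreover have "ev ?F z \<noteq> 0"
      using i zero by simp
    ultimately show ?thesis
      using n by (intro exI[of _ e] exI[of _ ?F]) auto
  qed
  then obtain m G where "m \<le> n" "homogeneous m G" "\<forall>a<k. \<forall>x\<in>W a. ev G x = 0" "ev G z \<noteq> 0"
    by blast
  then show ?thesis
    using multiply_up[of m G n z] z(1) that by metis
qed

section \<open>Bad members of a linear system\<close>

definition lincomb :: "'i set \<Rightarrow> ('i \<Rightarrow> 4 cpoly) \<Rightarrow> ('i \<Rightarrow> complex) \<Rightarrow> 4 cpoly" where
  "lincomb I H c = (\<Sum>i\<in>I. pconst (c i) * H i)"

lemma ev_lincomb: "ev (lincomb I H c) z = (\<Sum>i\<in>I. c i * ev (H i) z)"
  by (simp add: lincomb_def)

lemma ev_partial_lincomb: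
  "ev (partial_derivative v (lincomb I H c)) z = (\<Sum>i\<in>I. c i * ev (partial_derivative v (H i)) z)"
  by (simp add: lincomb_def poly_eval_partial_derivative_linear)

text \<open>Write F = F0 + L G, where L is the linear form with the four coefficients c (\<kappa>
  v). Eliminating L(z) from F = 0 and from the vanishing of the partial derivatives gives c
  (\<kappa> v) G^2 = F0 * dG/dv - G * dF0/dv. So four coefficients are determined by the other ones
  and by the three coordinates of z in the chart where coordinate p is 1.\<close>

lemma thin_singular_off_base_locus:
  fixes H :: "'i \<Rightarrow> 4 cpoly" and \<kappa> :: "4 \<Rightarrow> 'i"
  assumes "finite I" "inj \<kappa>" "range \<kappa> \<subseteq> I" and H: "\<And>v. H (\<kappa> v) = pvar v * G"
  shows "thin {c. \<exists>z. z $ p = 1 \<and> ev G z \<noteq> 0 \<and> ev (lincomb I H c) z = 0 \<and>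
     (\<forall>v. ev (partial_derivative v (lincomb I H c)) z = 0)}" (is "thin ?B")
proof -
  let ?J = "range \<kappa>" and ?W = "UNIV - {p}"
  define Z where "Z x = (\<chi> v. if v = p then 1 else x (Inl v))" for x :: "4 + 'i \<Rightarrow> complex"
  \<comment> \<open>The contribution of the indices outside \<open>?J\<close> to the value
    (\<open>f\<close> = \<open>id\<close>) or to a partial derivative.\<close>
  define F0 where "F0 f x = (\<Sum>i\<in>I - ?J. x (Inr i) * ev (f (H i)) (Z x))" for f x
  define g where "g j x = F0 id x * ev (partial_derivative (inv \<kappa> j) G) (Z x) -
      ev G (Z x) * F0 (partial_derivative (inv \<kappa> j)) x" for j x
  define h where "h j x = ev G (Z x) ^ 2" for j :: 'i and x
  let ?X = "Inl ` ?W \<union> Inr ` (I - ?J)"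
  have fin: "finite ?X"
    using assms(1) by auto
  have Z: "polyfn ?X (\<lambda>x. Z x $ v)" for v
    using fin by (cases "v = p") (auto simp: Z_def intro: polyfn_intros)
  have evZ: "polyfn ?X (\<lambda>x. ev f (Z x))" for f
    using fin Z by (intro polyfn_poly_eval)
  have F0: "polyfn ?X (F0 f)" for f
    unfolding F0_def using fin evZ by (intro polyfn_sum polyfn_mult polyfn_var) auto
  have "card ?J = 4"
    using assms(2) by (simp add: card_image)
  moreover have "card ?W = 3"
    by (subst card_Diff_singleton) auto
  ultimately have card: "card ?W < card ?J"
    by simp
  have "thin {c. \<exists>y. \<forall>j\<in>?J. h j (case_sum y c) \<noteq> 0 \<and>
      c j * h j (case_sum y c) = g j (case_sum y c)}"
    using card assms(1,3)
    by (intro thin_graph[where I = I and W = ?W]) (auto simp: g_def[abs_def] h_def[abs_def] intro!: polyfn_intros evZ F0 Z)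
  then show ?thesis
  proof (rule thin_subset, safe)
    fix c z
    assume z: "z $ p = 1" "ev G z \<noteq> 0" "ev (lincomb I H c) z = 0"
      and sing: "\<forall>v. ev (partial_derivative v (lincomb I H c)) z = 0"
    let ?x = "case_sum (($) z) c"
    have Zx: "Z ?x = z"
      using z(1) by (simp add: Z_def vec_eq_iff)
    have F0x: "F0 f ?x = (\<Sum>i\<in>I - ?J. c i * ev (f (H i)) z)" for f
      by (simp add: F0_def Zx)
    have split: "(\<Sum>i\<in>I. c i * \<phi> i) = (\<Sum>i\<in>I - ?J. c i * \<phi> i) + (\<Sum>v\<in>UNIV. c (\<kappa> v) * \<phi> (\<kappa> v))"
      for \<phi> :: "'i \<Rightarrow> complex"
      using sum.subset_diff[OF assms(3,1), of "\<lambda>i. c i * \<phi> i"] assms(2) by (simp add: sum.reindex)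
    define L where "L = (\<Sum>v\<in>UNIV. c (\<kappa> v) * z $ v)"
    have val: "F0 id ?x + L * ev G z = 0"
      using z(3) unfolding ev_lincomb split F0x L_def by (simp add: H sum_distrib_right mult.assoc)
    have der: "F0 (partial_derivative v) ?x + c (\<kappa> v) * ev G z + L * ev (partial_derivative v G) z = 0" for v
    proof -
      have "(\<Sum>u\<in>UNIV. c (\<kappa> u) * ev (partial_derivative v (H (\<kappa> u))) z) =
          (\<Sum>u\<in>UNIV. (if u = v then c (\<kappa> u) * ev G z else 0)) +
          (\<Sum>u\<in>UNIV. c (\<kappa> u) * z $ u * ev (partial_derivative v G) z)"
        unfolding sum.distrib[symmetric]
        by (rule sum.cong)
          (auto simp: H poly_eval_partial_derivative_mult poly_eval_partial_derivative_pvar algebra_simps)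
      then show ?thesis
        using sing[rule_format, of v] unfolding ev_partial_lincomb split F0x L_def
        by (simp add: sum_distrib_right add.assoc)
    qed
    have "c (\<kappa> v) * ev G z ^ 2 = F0 id ?x * ev (partial_derivative v G) z -
        ev G z * F0 (partial_derivative v) ?x" for v
    proof -
      have "c (\<kappa> v) * ev G z = - F0 (partial_derivative v) ?x - L * ev (partial_derivative v G) z"
        using der[of v] by (simp add: algebra_simps add_eq_0_iff)
      then have "c (\<kappa> v) * ev G z * ev G z =
          (- F0 (partial_derivative v) ?x - L * ev (partial_derivative v G) z) * ev G z"
        by (rule arg_cong[where f = "\<lambda>x. x * ev G z"])
      also have "\<dots> = - F0 (partial_derivative v) ?x * ev G z - (L * ev G z) * ev (partial_derivative v G) z"
        by (simp add: algebra_simps)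
      finally have "c (\<kappa> v) * ev G z * ev G z =
          - F0 (partial_derivative v) ?x * ev G z - (L * ev G z) * ev (partial_derivative v G) z" .
      moreover have "L * ev G z = - F0 id ?x"
        using val by (simp add: add_eq_0_iff)
      ultimately show ?thesis
        by (simp add: power2_eq_square algebra_simps)
    qed
    then show "\<exists>y. \<forall>j\<in>?J. h j (case_sum y c) \<noteq> 0 \<and> c j * h j (case_sum y c) = g j (case_sum y c)"
      using z(2) assms(2) by (intro exI[of _ "($) z"]) (auto simp: g_def h_def Zx)
  qed
qed

text \<open>On the line the equations \<open>echform\<close> vanish, so a partial derivative of such
  an equation times \<open>G\<close> is the derivative of the equation times \<open>G\<close>. The
  two coordinates other than i, j thus give a diagonal system for two coefficients, against the
  single parameter t.\<close>

lemma thin_singular_on_line: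
  fixes H :: "'i \<Rightarrow> 4 cpoly" and \<kappa> :: "4 \<Rightarrow> 'i"
  assumes "finite I" "inj \<kappa>" "\<kappa> ` (UNIV - {i, j}) \<subseteq> I" "i \<noteq> j"
    and H: "\<And>v. H (\<kappa> v) = echform i j \<alpha> \<beta> v * G"
    and line: "\<And>t v. ev (echform i j \<alpha> \<beta> v) (p + t *s q) = 0"
  shows "thin {c. \<exists>t. ev G (p + t *s q) \<noteq> 0 \<and>
     (\<forall>v. ev (partial_derivative v (lincomb I H c)) (p + t *s q) = 0)}" (is "thin ?B")
proof -
  let ?K = "UNIV - {i, j}"
  let ?J = "\<kappa> ` ?K"
  define Z where "Z x = p + x (Inl ()) *s q" for x :: "unit + 'i \<Rightarrow> complex"
  define g where "g l x = - (\<Sum>m\<in>I - ?J. x (Inr m) * ev (partial_derivative (inv \<kappa> l) (H m)) (Z x))" for l x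
  define h where "h l x = ev G (Z x)" for l :: 'i and x
  let ?X = "Inl ` {()} \<union> Inr ` (I - ?J)"
  have fin: "finite ?X"
    using assms(1) by auto
  have Z: "polyfn ?X (\<lambda>x. Z x $ v)" for v
    unfolding Z_def using fin by (auto intro!: polyfn_intros)
  have evZ: "polyfn ?X (\<lambda>x. ev f (Z x))" for f
    using fin Z by (intro polyfn_poly_eval)
  have "card ?J = card ?K"
    using assms(2) by (simp add: card_image inj_on_subset)
  also have "\<dots> = 2"
    using assms(4) by (simp add: card_Diff_subset)
  finally have card: "card {()} < card ?J"
    by simp
  have "polyfn ?X (g l)" "polyfn ?X (h l)" for l
    unfolding g_def[abs_def] h_def[abs_def] using fin evZ
    by (auto intro!: polyfn_uminus polyfn_sum polyfn_mult polyfn_var)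
  then have "thin {c. \<exists>y. \<forall>l\<in>?J. h l (case_sum y c) \<noteq> 0 \<and>
      c l * h l (case_sum y c) = g l (case_sum y c)}"
    using card assms(1,3) by (intro thin_graph[where I = I and W = "{()}"]) auto
  then show ?thesis
  proof (rule thin_subset, safe)
    fix c t
    let ?z = "p + t *s q"
    assume G: "ev G ?z \<noteq> 0"
      and sing: "\<forall>v. ev (partial_derivative v (lincomb I H c)) ?z = 0"
    let ?x = "case_sum (\<lambda>_. t) c"
    have Zx: "Z ?x = ?z"
      by (simp add: Z_def)
    have "c (\<kappa> v) * ev G ?z = - (\<Sum>m\<in>I - ?J. c m * ev (partial_derivative v (H m)) ?z)"
      if v: "v \<in> ?K" for v
    proof -
      have "(\<Sum>m\<in>?J. c m * ev (partial_derivative v (H m)) ?z) =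
          (\<Sum>u\<in>?K. c (\<kappa> u) * ev (partial_derivative v (H (\<kappa> u))) ?z)"
        using assms(2) by (subst sum.reindex) (auto intro: inj_on_subset)
      also have "\<dots> = (\<Sum>u\<in>?K. if u = v then c (\<kappa> u) * ev G ?z else 0)"
      proof (rule sum.cong)
        fix u assume "u \<in> ?K"
        have "ev (partial_derivative v (echform i j \<alpha> \<beta> u)) ?z = of_bool (u = v)"
          by (rule partial_derivative_eqI)
            (use v in \<open>auto simp: echform_def intro!: derivative_eq_intros\<close>)
        then show "c (\<kappa> u) * ev (partial_derivative v (H (\<kappa> u))) ?z = (if u = v then c (\<kappa> u) * ev G ?z else 0)"
          by (auto simp: H poly_eval_partial_derivative_mult line)
      qed simp
      also have "\<dots> = c (\<kappa> v) * ev G ?z"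
        using v by simp
      finally show ?thesis
        using sing[rule_format, of v] sum.subset_diff[OF assms(3,1), of "\<lambda>m. c m * ev (partial_derivative v (H m)) ?z"]
        unfolding ev_partial_lincomb by (simp add: add_eq_0_iff)
    qed
    then show "\<exists>y. \<forall>l\<in>?J. h l (case_sum y c) \<noteq> 0 \<and> c l * h l (case_sum y c) = g l (case_sum y c)"
      using G assms(2) by (intro exI[of _ "\<lambda>_. t"]) (auto simp: g_def h_def Zx)
  qed
qed

text \<open>In the echelon chart of i, j the point \<open>\<alpha> + s \<beta>\<close> has i-th
  coordinate 1 and j-th coordinate s, so these forms interpolate on all lines of the chart at
  once.\<close>

definition lagrange_form :: "4 \<Rightarrow> 4 \<Rightarrow> nat set \<Rightarrow> nat \<Rightarrow> 4 cpoly" where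
  "lagrange_form i j T r =
     (\<Prod>s\<in>T - {r}. pconst (1 / (of_nat r - of_nat s)) * (pvar j - pconst (of_nat s) * pvar i))"

lemma homogeneous_lagrange_form:
  assumes "finite T" "r \<in> T"
  shows "homogeneous (card T - 1) (lagrange_form i j T r)"
proof -
  have "homogeneous (card (T - {r})) (lagrange_form i j T r)"
    unfolding lagrange_form_def
    by (intro homogeneous_prod1 homogeneous_cmult homogeneous_diff homogeneous_pvar)
  then show ?thesis
    using assms by simp
qed

lemma ev_lagrange_form:
  assumes "finite T" "t \<in> T" "z $ i = 1" "z $ j = of_nat t"
  shows "ev (lagrange_form i j T r) z = of_bool (r = t)"
proof (cases "r = t")
  case True
  then show ?thesis
    using assms by (auto simp: lagrange_form_def intro!: prod.neutral)
next
  case False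
  then have "\<exists>s\<in>T - {r}. 1 / (of_nat r - of_nat s) * (of_nat t - of_nat s) = (0::complex)"
    using assms by (intro bexI[of _ t]) auto
  then show ?thesis
    using assms False by (simp add: lagrange_form_def)
qed

text \<open>At the five points of a line indexed by \<open>T\<close>, the Lagrange forms give a
  diagonal system with entries \<open>G\<close>, which determines five coefficients from the four
  parameters of the line and the other coefficients.\<close>

lemma thin_contains_line:
  fixes H :: "'i \<Rightarrow> 4 cpoly" and \<kappa> :: "nat \<Rightarrow> 'i"
  assumes "finite I" "inj \<kappa>" "\<kappa> ` T \<subseteq> I" "finite T" "card T = 5" "i \<noteq> j"
    and H: "\<And>r. r \<in> T \<Longrightarrow> H (\<kappa> r) = lagrange_form i j T r * G"
  shows "thin {c. \<exists>\<alpha> \<beta>. \<alpha> $ i = 1 \<and> \<alpha> $ j = 0 \<and> \<beta> $ i = 0 \<and> \<beta> $ j = 1 \<and>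
     (\<forall>r\<in>T. ev G (\<alpha> + of_nat r *s \<beta>) \<noteq> 0 \<and> ev (lincomb I H c) (\<alpha> + of_nat r *s \<beta>) = 0)}"
proof -
  let ?J = "\<kappa> ` T" and ?W = "(UNIV - {i, j}) \<times> (UNIV :: bool set)"
  \<comment> \<open>The parameters are the entries outside i, j: \<open>False\<close> marks those of
    \<alpha>, \<open>True\<close> those of \<beta>.\<close>
  define Z where "Z r x = (\<chi> v. if v = i then 1 else if v = j then of_nat r
      else x (Inl (v, False)) + of_nat r * x (Inl (v, True)))" for r and x :: "4 \<times> bool + 'i \<Rightarrow> complex"
  define g where "g l x = - (\<Sum>m\<in>I - ?J. x (Inr m) * ev (H m) (Z (inv \<kappa> l) x))" for l x
  define h where "h l x = ev G (Z (inv \<kappa> l) x)" for l :: 'i and x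
  let ?X = "Inl ` ?W \<union> Inr ` (I - ?J)"
  have fin: "finite ?X"
    using assms(1) by auto
  have Z: "polyfn ?X (\<lambda>x. Z r x $ v)" for r v
    unfolding Z_def using fin by (cases "v = i"; cases "v = j") (auto intro!: polyfn_intros)
  have evZ: "polyfn ?X (\<lambda>x. ev f (Z r x))" for f r
    using fin Z by (intro polyfn_poly_eval)
  have "card ?J = 5"
    using assms(2,5) by (simp add: card_image inj_on_subset)
  moreover have "card ?W = 4"
    using assms(6) by (simp add: card_cartesian_product card_Diff_subset)
  ultimately have card: "card ?W < card ?J"
    by simp
  have "polyfn ?X (g l)" "polyfn ?X (h l)" for l
    unfolding g_def[abs_def] h_def[abs_def] using fin evZ
    by (auto intro!: polyfn_uminus polyfn_sum polyfn_mult polyfn_var)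
  then have "thin {c. \<exists>y. \<forall>l\<in>?J. h l (case_sum y c) \<noteq> 0 \<and>
      c l * h l (case_sum y c) = g l (case_sum y c)}"
    using card assms(1,3) by (intro thin_graph[where I = I and W = ?W]) auto
  then show ?thesis
  proof (rule thin_subset, safe)
    fix c and \<alpha> \<beta> :: "complex ^ 4"
    assume *: "\<alpha> $ i = 1" "\<alpha> $ j = 0" "\<beta> $ i = 0" "\<beta> $ j = 1"
      and G: "\<forall>r\<in>T. ev G (\<alpha> + of_nat r *s \<beta>) \<noteq> 0 \<and> ev (lincomb I H c) (\<alpha> + of_nat r *s \<beta>) = 0"
    define y where "y = (\<lambda>(v, b). if b then \<beta> $ v else \<alpha> $ v)"
    have Zx: "Z r (case_sum y c) = \<alpha> + of_nat r *s \<beta>" for r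
      using * by (auto simp: Z_def y_def vec_eq_iff)
    have "c (\<kappa> r) * ev G (\<alpha> + of_nat r *s \<beta>) = - (\<Sum>m\<in>I - ?J. c m * ev (H m) (\<alpha> + of_nat r *s \<beta>))"
      if r: "r \<in> T" for r
    proof -
      let ?z = "\<alpha> + of_nat r *s \<beta>"
      have "(\<Sum>m\<in>?J. c m * ev (H m) ?z) = (\<Sum>s\<in>T. c (\<kappa> s) * ev (H (\<kappa> s)) ?z)"
        using assms(2) by (subst sum.reindex) (auto intro: inj_on_subset)
      also have "\<dots> = (\<Sum>s\<in>T. if s = r then c (\<kappa> s) * ev G ?z else 0)"
        using ev_lagrange_form[OF assms(4) r, of ?z i j] *
        by (intro sum.cong) (auto simp: H)
      also have "\<dots> = c (\<kappa> r) * ev G ?z"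
        using r assms(4) by simp
      finally show ?thesis
        using G r sum.subset_diff[OF assms(3,1), of "\<lambda>m. c m * ev (H m) ?z"]
        unfolding ev_lincomb by (simp add: add_eq_0_iff)
    qed
    then show "\<exists>y. \<forall>l\<in>?J. h l (case_sum y c) \<noteq> 0 \<and> c l * h l (case_sum y c) = g l (case_sum y c)"
      using G assms(2) by (intro exI[of _ y]) (auto simp: g_def h_def Zx)
  qed
qed

section \<open>Lines of a ruling and chords of a quadric\<close>

text \<open>Affine chart of the Segre parametrization of the quadric; fixing s gives the lines of
  one ruling.\<close>

definition seg :: "complex \<Rightarrow> complex \<Rightarrow> complex ^ 4" where
  "seg s t = (\<chi> i. if i = 1 then 1 else if i = 2 then s else if i = 3 then t else s * t)"

lemma seg_nth [simp]: "seg s t $ 1 = 1" "seg s t $ 2 = s" "seg s t $ 3 = t" "seg s t $ 4 = s * t"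
  by (simp_all add: seg_def)

lemma seg_eq_iff: "seg s t = seg s' t' \<longleftrightarrow> s = s' \<and> t = t'"
  by (metis seg_nth(2,3))

definition quadric :: "4 cpoly" where
  "quadric = pvar 1 * pvar 4 - pvar 2 * pvar 3"

lemma homogeneous_quadric: "homogeneous 2 quadric"
proof -
  have "homogeneous (1 + 1) quadric"
    unfolding quadric_def by (intro homogeneous_diff homogeneous_mult homogeneous_pvar)
  then show ?thesis
    by (simp only: one_add_one)
qed

text \<open>Both end points lie on the quadric, so only the mixed term survives. If both parameters
  differ, the chord meets the quadric in its end points only.\<close>

lemma ev_quadric_secant:
  "ev quadric (x *s seg s t + y *s seg s' t') = x * y * ((s - s') * (t - t'))"
  by (simp add: quadric_def algebra_simps)

lemma independent_seg:
  assumes "seg s t \<noteq> seg s' t'"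
  shows "vec.independent {seg s t, seg s' t'}"
proof -
  obtain i where "seg s t $ i \<noteq> seg s' t' $ i"
    using assms by (auto simp: vec_eq_iff)
  then have "seg s t $ 1 * seg s' t' $ i - seg s t $ i * seg s' t' $ 1 \<noteq> 0"
    by simp
  then show ?thesis
    using independent_pair_iff by blast
qed

abbreviation ruling_line :: "nat \<Rightarrow> (complex ^ 4) set" where
  "ruling_line a \<equiv> vec.span {seg (of_nat a) 0, seg (of_nat a) 1}"

lemma seg_in_ruling_line: "seg (of_nat a) t \<in> ruling_line a"
  unfolding span_pair
  by (intro exI[of _ "1 - t"] exI[of _ t]) (simp add: vec_eq_iff forall_4 algebra_simps)

lemma quadric_ruling_line: "z \<in> ruling_line a \<Longrightarrow> ev quadric z = 0"
  unfolding span_pair by (auto simp: ev_quadric_secant simp del: poly_eval_diff)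

text \<open>On the grid, the Lagrange polynomial of bidegree \<open>(e, e)\<close> is a product of \<open>e\<close> factors
  \<open>(s - m) (t - n)\<close>, each of which is the restriction of a linear form.\<close>

lemma grid_form:
  assumes "i \<le> e" "j \<le> e"
  shows "\<exists>f. homogeneous e f \<and> (\<forall>i'\<le>e. \<forall>j'\<le>e. ev f (seg (of_nat i') (of_nat j')) = of_bool (i' = i \<and> j' = j))"
proof -
  \<comment> \<open>\<open>skip i\<close> enumerates the numbers other than i in increasing order,
    so its first e values are exactly the numbers up to e other than i.\<close>
  define skip :: "nat \<Rightarrow> nat \<Rightarrow> nat" where "skip i m = (if m < i then m else m + 1)" for i m
  have skip_neq: "skip i m \<noteq> i" for i m
    by (auto simp: skip_def)
  have skip_hit: "\<exists>m<e. skip i m = i'" if "i \<le> e" "i' \<le> e" "i' \<noteq> i" for i i'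
    using that by (intro exI[of _ "if i' < i then i' else i' - 1"]) (auto simp: skip_def)
  define L :: "nat \<Rightarrow> nat \<Rightarrow> 4 cpoly" where "L m n = pvar 4 - pconst (of_nat n) * pvar 2 - pconst (of_nat m) * pvar 3
      + pconst (of_nat m * of_nat n) * pvar 1" for m n
  have L: "ev (L m n) (seg s t) = (s - of_nat m) * (t - of_nat n)" for m n s t
    by (simp add: L_def algebra_simps)
  define F where "F = (\<Prod>m<e. L (skip i m) (skip j m))"
  have F: "ev F (seg s t) = (\<Prod>m<e. (s - of_nat (skip i m)) * (t - of_nat (skip j m)))" for s t
    by (simp add: F_def L)
  have "homogeneous (card {..<e}) F"
    unfolding F_def L_def
    by (intro homogeneous_prod1 homogeneous_add homogeneous_diff homogeneous_cmult homogeneous_pvar)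
  then have "homogeneous e F"
    by simp
  moreover have "ev F (seg (of_nat i) (of_nat j)) \<noteq> 0"
    using skip_neq by (auto simp: F) metis+
  moreover have "ev F (seg (of_nat i') (of_nat j')) = 0" if "i' \<le> e" "j' \<le> e" "i' \<noteq> i \<or> j' \<noteq> j" for i' j'
  proof -
    have "\<exists>m<e. skip i m = i' \<or> skip j m = j'"
      using skip_hit[of i i'] skip_hit[of j j'] assms that by blast
    then show ?thesis
      by (auto simp: F)
  qed
  ultimately show ?thesis
    by (intro exI[of _ "pconst (1 / ev F (seg (of_nat i) (of_nat j))) * F"])
      (auto intro: homogeneous_cmult)
qed

lemma grid_form_vanishes:
  assumes f: "homogeneous e f" "\<And>t. t \<le> e \<Longrightarrow> ev f (seg (of_nat a) (of_nat t)) = 0"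
    and "a \<le> e" "z \<in> ruling_line a"
  shows "ev f z = 0"
proof -
  have "\<exists>\<phi>. \<forall>s. s \<le> e \<longrightarrow> homogeneous e (\<phi> s) \<and> (\<forall>i'\<le>e. \<forall>j'\<le>e. ev (\<phi> s) (seg (of_nat i') (of_nat j')) = of_bool (i' = a \<and> j' = s))"
    using grid_form[OF assms(3)] by (intro choice) auto
  then obtain \<phi> where \<phi>: "\<And>s. s \<le> e \<Longrightarrow> homogeneous e (\<phi> s)"
    "\<And>s i' j'. s \<le> e \<Longrightarrow> i' \<le> e \<Longrightarrow> j' \<le> e \<Longrightarrow> ev (\<phi> s) (seg (of_nat i') (of_nat j')) = of_bool (i' = a \<and> j' = s)"
    by blast
  show ?thesis
    by (rule vanishes_on_plane[of e f "\<lambda>t. seg (of_nat a) (of_nat t)" \<phi>, OF f \<phi>(1) _ seg_in_ruling_line assms(4)])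
      (use \<phi>(2) assms(3) in auto)
qed

text \<open>The (e + 1) ^ 2 grid points provide e + 1 points on each of the e + 1 lines, and
  \<open>grid_form\<close> the forms dual to them.\<close>

lemma indep_ruling_lines: "indep_lines e (e + 1) ruling_line"
proof -
  have "\<exists>f. \<forall>ij. fst ij \<le> e \<longrightarrow> snd ij \<le> e \<longrightarrow> homogeneous e (f ij) \<and>
      (\<forall>i'\<le>e. \<forall>j'\<le>e. ev (f ij) (seg (of_nat i') (of_nat j')) = of_bool (i' = fst ij \<and> j' = snd ij))"
    using grid_form by (intro choice) auto
  then obtain f where f: "\<And>i j. i \<le> e \<Longrightarrow> j \<le> e \<Longrightarrow> homogeneous e (f (i, j))"
    "\<And>i j i' j'. i \<le> e \<Longrightarrow> j \<le> e \<Longrightarrow> i' \<le> e \<Longrightarrow> j' \<le> e \<Longrightarrow>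
        ev (f (i, j)) (seg (of_nat i') (of_nat j')) = of_bool (i' = i \<and> j' = j)"
    by fastforce
  show ?thesis
    by (rule indep_linesI[where y = "\<lambda>a s. seg (of_nat a) (of_nat s)" and f = "\<lambda>a s. f (a, s)",
          OF refl seg_in_ruling_line]) (auto simp: f)
qed

text \<open>A form of degree \<open>e + 2\<close> on a chord that vanishes at both end points is a multiple of the quadric,
  so, once the values at the end points are right, it remains to solve a problem in degree \<open>e\<close>.\<close>

lemma indep_lines_add_ruling:
  fixes s t :: "nat \<Rightarrow> bool \<Rightarrow> complex"
  defines "p b c \<equiv> seg (s b c) (t b c)"
  assumes A: "A \<le> e + 3"
    and transversal: "\<And>b. b < n \<Longrightarrow> (s b False - s b True) * (t b False - t b True) \<noteq> 0"
    and indep: "indep_lines e n (\<lambda>b. vec.span {p b False, p b True})"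
    and points: "\<And>b c. b < n \<Longrightarrow> \<exists>g. homogeneous (e + 2) g \<and>
      (\<forall>a<A. \<forall>z\<in>ruling_line a. ev g z = 0) \<and> (\<forall>b'<n. \<forall>c'. ev g (p b' c') = of_bool (b' = b \<and> c' = c))"
  shows "indep_lines (e + 2) (A + n)
     (\<lambda>a. if a < A then ruling_line a else vec.span {p (a - A) False, p (a - A) True})"
    (is "indep_lines _ _ ?W")
proof -
  let ?K = "\<lambda>b. vec.span {p b False, p b True}"
  let ?B = "\<lambda>b. (s b False - s b True) * (t b False - t b True)"
  have p_neq: "p b False \<noteq> p b True" if "b < n" for b
    using transversal[OF that] by (auto simp: p_def seg_eq_iff)
  have "\<exists>g. \<forall>bc. fst bc < n \<longrightarrow> homogeneous (e + 2) (g bc) \<and>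
      (\<forall>a<A. \<forall>z\<in>ruling_line a. ev (g bc) z = 0) \<and>
      (\<forall>b'<n. \<forall>c'. ev (g bc) (p b' c') = of_bool (b' = fst bc \<and> c' = snd bc))"
    using points by (intro choice) auto
  then obtain \<gamma> where \<gamma>: "\<And>b c. b < n \<Longrightarrow> homogeneous (e + 2) (\<gamma> (b, c))"
    "\<And>b c a z. b < n \<Longrightarrow> a < A \<Longrightarrow> z \<in> ruling_line a \<Longrightarrow> ev (\<gamma> (b, c)) z = 0"
    "\<And>b c b' c'. b < n \<Longrightarrow> b' < n \<Longrightarrow> ev (\<gamma> (b, c)) (p b' c') = of_bool (b' = b \<and> c' = c)"
    by fastforce
  have ruling: "indep_lines (e + 2) A ruling_line"
    using A by (intro indep_lines_mono[OF indep_ruling_lines[of "e + 2"]]) simp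
  have key: "\<exists>G. homogeneous (e + 2) G \<and> (\<forall>a<A. \<forall>z\<in>ruling_line a. ev G z = ev G0 z) \<and>
      (\<forall>b<n. \<forall>z\<in>?K b. ev G z = ev (g b) z)"
    if G0: "homogeneous (e + 2) G0" and g: "\<And>b. b < n \<Longrightarrow> homogeneous (e + 2) (g b)" for G0 g
  proof -
    \<comment> \<open>The forms \<gamma> vanish on the ruling lines, so the values at the end points
      of the chords can be corrected without disturbing those lines.\<close>
    define G1 where "G1 = G0 + (\<Sum>b<n. \<Sum>c\<in>UNIV. pconst (ev (g b) (p b c) - ev G0 (p b c)) * \<gamma> (b, c))"
    have hom_G1: "homogeneous (e + 2) G1"
      unfolding G1_def using G0 \<gamma>(1) by (intro homogeneous_add homogeneous_sum homogeneous_cmult) auto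
    have G1_ruling: "ev G1 z = ev G0 z" if "a < A" "z \<in> ruling_line a" for a z
      unfolding G1_def using \<gamma>(2)[OF _ that] by simp
    have G1_p: "ev G1 (p b c) = ev (g b) (p b c)" if "b < n" for b c
    proof -
      have "(\<Sum>b'<n. \<Sum>c'\<in>UNIV. (ev (g b') (p b' c') - ev G0 (p b' c')) * ev (\<gamma> (b', c')) (p b c)) =
          (\<Sum>b'\<in>{b}. \<Sum>c'\<in>{c}. ev (g b') (p b' c') - ev G0 (p b' c'))"
        using that by (intro sum.mono_neutral_cong_right) (auto simp: \<gamma>(3) intro!: sum.neutral)
      then show ?thesis
        by (simp add: G1_def)
    qed
    have "\<exists>h. homogeneous e h \<and> (\<forall>x y. ev (g b - G1) (x *s p b False + y *s p b True) =
        x * y * ev h (x *s p b False + y *s p b True))" if b: "b < n" for b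
    proof -
      have indep_p: "vec.independent {p b False, p b True}"
        unfolding p_def by (rule independent_seg) (use p_neq[OF b] in \<open>simp add: p_def\<close>)
      have zero: "ev (g b - G1) (p b c) = 0" for c
        using G1_p[OF b] by simp
      obtain h where "homogeneous e h" "\<And>x y. ev (g b - G1) (x *s p b False + y *s p b True) =
          x * y * ev h (x *s p b False + y *s p b True)"
        using divide_by_coordinates[OF p_neq[OF b] indep_p homogeneous_diff[OF g[OF b] hom_G1] zero zero] by blast
      then show ?thesis
        by (intro exI[of _ h]) simp
    qed
    then obtain h where h: "\<And>b. b < n \<Longrightarrow> homogeneous e (h b)"
      "\<And>b x y. b < n \<Longrightarrow> ev (g b - G1) (x *s p b False + y *s p b True) =
        x * y * ev (h b) (x *s p b False + y *s p b True)"
      by metis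
    \<comment> \<open>On chord b the quadric is x y times the constant \<open>?B b\<close>; dividing
      by it makes the quadric times h' equal to the missing part x y h.\<close>
    have "\<exists>h'. homogeneous e h' \<and> (\<forall>b'<n. b' \<noteq> b \<longrightarrow> (\<forall>z\<in>?K b'. ev h' z = 0)) \<and>
        (\<forall>z\<in>?K b. ev h' z = ev (h b) z / ?B b)" if b: "b < n" for b
    proof -
      obtain h' where "homogeneous e h'" "\<And>b' z. b' < n \<Longrightarrow> b' \<noteq> b \<Longrightarrow> z \<in> ?K b' \<Longrightarrow> ev h' z = 0"
        "\<And>z. z \<in> ?K b \<Longrightarrow> ev h' z = ev (pconst (1 / ?B b) * h b) z"
        using indep_linesD[OF indep b homogeneous_cmult[OF h(1)[OF b], of "1 / ?B b"]] by blast
      then show ?thesis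
        by (intro exI[of _ h']) simp
    qed
    then obtain h' where h': "\<And>b. b < n \<Longrightarrow> homogeneous e (h' b)"
      "\<And>b b' z. b < n \<Longrightarrow> b' < n \<Longrightarrow> b' \<noteq> b \<Longrightarrow> z \<in> ?K b' \<Longrightarrow> ev (h' b) z = 0"
      "\<And>b z. b < n \<Longrightarrow> z \<in> ?K b \<Longrightarrow> ev (h' b) z = ev (h b) z / ?B b"
      by metis
    define G where "G = G1 + quadric * (\<Sum>b<n. h' b)"
    have "homogeneous (2 + e) (quadric * (\<Sum>b<n. h' b))"
      using h'(1) by (intro homogeneous_mult homogeneous_quadric homogeneous_sum) auto
    then have "homogeneous (e + 2) G"
      unfolding G_def using hom_G1 by (intro homogeneous_add) (simp_all add: add.commute)
    moreover have "ev G z = ev G0 z" if "a < A" "z \<in> ruling_line a" for a z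
      using G1_ruling[OF that] quadric_ruling_line[OF that(2)] by (simp add: G_def)
    moreover have "ev G z = ev (g b) z" if b: "b < n" "z \<in> ?K b" for b z
    proof -
      obtain x y where z: "z = x *s p b False + y *s p b True"
        using b(2) unfolding span_pair by blast
      obtain B where B: "B = ?B b" "B \<noteq> 0"
        using transversal[OF b(1)] by blast
      have "(\<Sum>b'<n. ev (h' b') z) = (\<Sum>b'\<in>{b}. ev (h b) z / ?B b)"
        using h'(2,3) b by (intro sum.mono_neutral_cong_right) auto
      moreover have "ev quadric z = x * y * ?B b"
        unfolding z p_def ev_quadric_secant ..
      moreover have "ev (g b) z - ev G1 z = x * y * ev (h b) z"
        using h(2)[OF b(1), of x y] unfolding z by simp
      ultimately show ?thesis
        unfolding B(1)[symmetric] using B(2) by (simp add: G_def diff_eq_eq)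
    qed
    ultimately show ?thesis
      by blast
  qed
  show ?thesis
    unfolding indep_lines_def
  proof (intro allI impI)
    fix a and g :: "4 cpoly"
    assume a: "a < A + n" and g: "homogeneous (e + 2) g"
    obtain G0 where G0: "homogeneous (e + 2) G0" "\<And>a' z. a' < A \<Longrightarrow> a' \<noteq> a \<Longrightarrow> z \<in> ruling_line a' \<Longrightarrow> ev G0 z = 0"
      "\<And>z. a < A \<Longrightarrow> z \<in> ruling_line a \<Longrightarrow> ev G0 z = ev g z"
    proof (cases "a < A")
      case True
      obtain G where G: "homogeneous (e + 2) G"
        "\<And>a' z. a' < A \<Longrightarrow> a' \<noteq> a \<Longrightarrow> z \<in> ruling_line a' \<Longrightarrow> ev G z = 0"
        "\<And>z. z \<in> ruling_line a \<Longrightarrow> ev G z = ev g z"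
        using indep_linesD[OF ruling True g] by blast
      show ?thesis
        by (rule that[of G]; (rule G(1) | rule G(2) | rule G(3)))
    next
      case False
      then show ?thesis
        by (intro that[of 0]) (auto intro: homogeneous_0)
    qed
    define g' where "g' b = (if a = A + b then g else 0)" for b
    have "homogeneous (e + 2) (g' b)" for b
      using g by (simp add: g'_def homogeneous_0)
    then obtain G where G: "homogeneous (e + 2) G" "\<And>a z. a < A \<Longrightarrow> z \<in> ruling_line a \<Longrightarrow> ev G z = ev G0 z"
      "\<And>b z. b < n \<Longrightarrow> z \<in> ?K b \<Longrightarrow> ev G z = ev (g' b) z"
      using key[OF G0(1), of g'] by blast
    have "ev G z = 0" if "b < A + n" "b \<noteq> a" "z \<in> ?W b" for b z
    proof (cases "b < A")
      case True
      then show ?thesis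
        using that G(2) G0(2) by auto
    next
      case False
      then show ?thesis
        using that G(3)[of "b - A" z] by (auto simp: g'_def)
    qed
    moreover have "ev G z = ev g z" if "z \<in> ?W a" for z
    proof (cases "a < A")
      case True
      then show ?thesis
        using that G(2) G0(3) by auto
    next
      case False
      then show ?thesis
        using that a G(3)[of "a - A" z] by (auto simp: g'_def)
    qed
    ultimately show "\<exists>G. homogeneous (e + 2) G \<and> (\<forall>b<A + n. b \<noteq> a \<longrightarrow> (\<forall>z\<in>?W b. ev G z = 0)) \<and>
        (\<forall>z\<in>?W a. ev G z = ev g z)"
      using G(1) by (intro exI[of _ G]) blast
  qed
qed

text \<open>A family of \<open>k\<close> pairs of points of the quadric is a point \<open>x\<close> of an affine space with
  coordinates indexed by line number, end point, and which of the two parameters \<open>s\<close>, \<open>t\<close> is meant.\<close>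

type_synonym chord_var = "nat \<times> bool \<times> bool"

abbreviation chord_point :: "(chord_var \<Rightarrow> complex) \<Rightarrow> nat \<Rightarrow> bool \<Rightarrow> complex ^ 4" where
  "chord_point x b c \<equiv> seg (x (b, c, False)) (x (b, c, True))"

abbreviation chord :: "(chord_var \<Rightarrow> complex) \<Rightarrow> nat \<Rightarrow> (complex ^ 4) set" where
  "chord x b \<equiv> vec.span {chord_point x b False, chord_point x b True}"

definition chord_coord :: "nat \<Rightarrow> bool \<Rightarrow> 4 \<Rightarrow> chord_var cpoly" where
  "chord_coord b c v = (if v = 1 then 1 else if v = 2 then pvar (b, c, False)
     else if v = 3 then pvar (b, c, True) else pvar (b, c, False) * pvar (b, c, True))"

lemma chord_coord: "poly_eval (chord_coord b c v) x = chord_point x b c $ v"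
  by (simp add: chord_coord_def seg_def)

section \<open>Chords in general position\<close>

lemma poly_eval_common_nonzero:
  assumes "poly_eval P x \<noteq> 0" "poly_eval Q y \<noteq> 0"
  shows "\<exists>z. poly_eval P z \<noteq> 0 \<and> poly_eval Q z \<noteq> 0"
  by (rule linepoly_common_nonzero[of "poly_eval P" "poly_eval Q" x y])
    (intro linepoly_poly_eval assms)+

text \<open>The matrix of the values of \<open>f l\<close> at the points \<open>Y i\<close> is
  polynomial in x and is the identity at \<open>x0\<close>, so dual combinations exist off a
  hypersurface. A trivial grading suffices here.\<close>

lemma generic_dual_forms:
  fixes f :: "'i \<Rightarrow> 4 cpoly" and Y :: "'i \<Rightarrow> 4 \<Rightarrow> 'v cpoly"
  assumes "finite J"
    and dual: "\<And>l i. l \<in> J \<Longrightarrow> i \<in> J \<Longrightarrow> poly_eval (f l) (\<lambda>v. poly_eval (Y i v) x0) = of_bool (l = i)"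
  obtains D where "poly_eval D x0 \<noteq> 0" "\<And>x j. poly_eval D x \<noteq> 0 \<Longrightarrow> j \<in> J \<Longrightarrow>
     \<exists>c. \<forall>i\<in>J. poly_eval (\<Sum>l\<in>J. pconst (c l) * f l) (\<lambda>v. poly_eval (Y i v) x) = of_bool (i = j)"
proof -
  have "\<exists>D (\<delta> :: unit). True \<and> poly_eval D x0 = 1 \<and> (\<forall>x. poly_eval D x \<noteq> 0 \<longrightarrow>
     (\<forall>j\<in>J. \<exists>c. \<forall>i\<in>J. (\<Sum>l\<in>J. c l * poly_eval (psubst (f l) (Y i)) x) = of_bool (i = j)))"
    by (rule generic_dual_basis[where G = "\<lambda>_ _. True" and pl = "\<lambda>_ _. ()" and d = "\<lambda>_. ()"])
      (use assms in \<open>simp_all add: poly_eval_psubst\<close>)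
  then obtain D where "poly_eval D x0 = 1" "\<And>x j. poly_eval D x \<noteq> 0 \<Longrightarrow> j \<in> J \<Longrightarrow>
      \<exists>c. \<forall>i\<in>J. (\<Sum>l\<in>J. c l * poly_eval (psubst (f l) (Y i)) x) = of_bool (i = j)"
    by blast
  then show ?thesis
    by (intro that[of D]) (simp_all add: poly_eval_psubst)
qed

text \<open>Independence amounts to forms dual to e + 1 points on each chord, and these points
  depend polynomially on the end points. Distinct end points suffice at \<open>x0\<close>, so its
  chords may lie on the quadric.\<close>

lemma indep_chords_generic:
  assumes indep: "indep_lines e n (chord x0)"
    and distinct: "\<And>b. b < n \<Longrightarrow> chord_point x0 b False \<noteq> chord_point x0 b True"
  obtains D where "poly_eval D x0 \<noteq> 0" "\<And>x. poly_eval D x \<noteq> 0 \<Longrightarrow> indep_lines e n (chord x)"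
proof -
  let ?J = "{..<n} \<times> {..e}"
  have "\<exists>f. i \<in> ?J \<longrightarrow> homogeneous e f \<and> (\<forall>b<n. \<forall>t\<le>e.
      ev f (chord_point x0 b False + of_nat t *s chord_point x0 b True) = of_bool (fst i = b \<and> snd i = t))" for i
  proof (cases "i \<in> ?J")
    case True
    then have "fst i < n" "snd i \<le> e"
      by auto
    from indep_lines_dual[OF indep refl _ this] show ?thesis
      using distinct independent_seg by blast
  qed simp
  then have "\<exists>f. \<forall>i. i \<in> ?J \<longrightarrow> homogeneous e (f i) \<and> (\<forall>b<n. \<forall>t\<le>e.
      ev (f i) (chord_point x0 b False + of_nat t *s chord_point x0 b True) = of_bool (fst i = b \<and> snd i = t))"
    by (intro choice allI)
  then obtain f where f: "\<And>i. i \<in> ?J \<Longrightarrow> homogeneous e (f i)"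
    "\<And>i b t. i \<in> ?J \<Longrightarrow> b < n \<Longrightarrow> t \<le> e \<Longrightarrow>
      ev (f i) (chord_point x0 b False + of_nat t *s chord_point x0 b True) = of_bool (fst i = b \<and> snd i = t)"
    by blast
  define Y where "Y = (\<lambda>(b, t) v. chord_coord b False v + pconst (of_nat t) * chord_coord b True v)"
  have Y: "(\<lambda>v. poly_eval (Y (b, t) v) x) = ($) (chord_point x b False + of_nat t *s chord_point x b True)" for b t x
    by (rule ext) (simp add: Y_def chord_coord)
  obtain D where D: "poly_eval D x0 \<noteq> 0" "\<And>x j. poly_eval D x \<noteq> 0 \<Longrightarrow> j \<in> ?J \<Longrightarrow>
     \<exists>c. \<forall>i\<in>?J. poly_eval (\<Sum>l\<in>?J. pconst (c l) * f l) (\<lambda>v. poly_eval (Y i v) x) = of_bool (i = j)"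
  proof (rule generic_dual_forms[of ?J f Y x0])
    fix l i assume "l \<in> ?J" "i \<in> ?J"
    then show "poly_eval (f l) (\<lambda>v. poly_eval (Y i v) x0) = of_bool (l = i)"
      using f(2)[of l "fst i" "snd i"] Y[of "fst i" "snd i" x0] by (auto simp: prod_eq_iff)
  qed auto
  have "indep_lines e n (chord x)" if x: "poly_eval D x \<noteq> 0" for x
  proof -
    have "\<exists>c. \<forall>j. j \<in> ?J \<longrightarrow> (\<forall>i\<in>?J. poly_eval (\<Sum>l\<in>?J. pconst (c j l) * f l) (\<lambda>v. poly_eval (Y i v) x) = of_bool (i = j))"
      using D(2)[OF x] by (intro choice allI) auto
    then obtain c where c: "\<And>j i. j \<in> ?J \<Longrightarrow> i \<in> ?J \<Longrightarrow>
        poly_eval (\<Sum>l\<in>?J. pconst (c j l) * f l) (\<lambda>v. poly_eval (Y i v) x) = of_bool (i = j)"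
      by blast
    define F where "F j = (\<Sum>l\<in>?J. pconst (c j l) * f l)" for j
    show ?thesis
    proof (rule indep_linesI[where y = "\<lambda>a s. chord_point x a False + of_nat s *s chord_point x a True"
          and f = "\<lambda>a s. F (a, s)", OF refl])
      show "chord_point x a False + of_nat s *s chord_point x a True \<in> chord x a" for a and s :: nat
        unfolding span_pair by (intro exI[of _ 1] exI[of _ "of_nat s"]) simp
      show "homogeneous e (F (a, s))" for a s
        unfolding F_def using f(1) by (intro homogeneous_sum homogeneous_cmult)
      show "ev (F (a, s)) (chord_point x b False + of_nat t *s chord_point x b True) = of_bool (a = b \<and> s = t)"
        if "a < n" "s \<le> e" "b < n" "t \<le> e" for a b s t
        using c[of "(a, s)" "(b, t)"] that unfolding Y F_def by auto
    qed
  qed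
  then show ?thesis
    using D(1) that by blast
qed

text \<open>At the special \<open>x0\<close> the 2 n end points are distinct grid points in the
  columns A, ..., e; there are (e + 1 - A) (e + 1) such points. Their grid forms vanish on the
  ruling lines below A, and so do all linear combinations.\<close>

lemma interpolation_generic:
  assumes A: "A \<le> e + 1" and n: "2 * n \<le> (e + 1 - A) * (e + 1)"
  obtains D x0 where "poly_eval D x0 \<noteq> 0" "\<And>x b c. poly_eval D x \<noteq> 0 \<Longrightarrow> b < n \<Longrightarrow>
     \<exists>g. homogeneous e g \<and> (\<forall>a<A. \<forall>z\<in>ruling_line a. ev g z = 0) \<and>
       (\<forall>b'<n. \<forall>c'. ev g (chord_point x b' c') = of_bool (b' = b \<and> c' = c))"
proof -
  let ?J = "{..<n} \<times> (UNIV :: bool set)"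
  have "card ?J \<le> card ({A..e} \<times> {..e})"
    using A n by (simp add: card_cartesian_product Suc_diff_le)
  then obtain \<iota> where \<iota>: "\<iota> ` ?J \<subseteq> {A..e} \<times> {..e}" "inj_on \<iota> ?J"
    using card_le_inj[of ?J "{A..e} \<times> {..e}"] by auto
  have \<iota>_le: "A \<le> fst (\<iota> l)" "fst (\<iota> l) \<le> e" "snd (\<iota> l) \<le> e" if "l \<in> ?J" for l
  proof -
    have "\<iota> l \<in> {A..e} \<times> {..e}"
      using \<iota>(1) that by blast
    then show "A \<le> fst (\<iota> l)" "fst (\<iota> l) \<le> e" "snd (\<iota> l) \<le> e"
      by (simp_all add: mem_Times_iff)
  qed
  have "\<exists>f. \<forall>l. l \<in> ?J \<longrightarrow> homogeneous e (f l) \<and> (\<forall>i'\<le>e. \<forall>j'\<le>e.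
      ev (f l) (seg (of_nat i') (of_nat j')) = of_bool (i' = fst (\<iota> l) \<and> j' = snd (\<iota> l)))"
    using grid_form[OF \<iota>_le(2,3)] by (intro choice allI) blast
  then obtain f where f: "\<And>l. l \<in> ?J \<Longrightarrow> homogeneous e (f l)"
    "\<And>l i' j'. l \<in> ?J \<Longrightarrow> i' \<le> e \<Longrightarrow> j' \<le> e \<Longrightarrow>
      ev (f l) (seg (of_nat i') (of_nat j')) = of_bool (i' = fst (\<iota> l) \<and> j' = snd (\<iota> l))"
    by blast
  have f_ruling: "ev (f l) z = 0" if "l \<in> ?J" "a < A" "z \<in> ruling_line a" for l a z
    by (rule grid_form_vanishes[OF f(1)[OF that(1)] _ _ that(3)])
      (use that \<iota>_le[OF that(1)] A in \<open>auto simp: f(2)\<close>)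
  define x0 where "x0 = (\<lambda>(b, c, d). of_nat (if d then snd (\<iota> (b, c)) else fst (\<iota> (b, c))) :: complex)"
  define Y where "Y = (\<lambda>(b, c). chord_coord b c)"
  have Y: "(\<lambda>v. poly_eval (Y (b, c) v) x) = ($) (chord_point x b c)" for b c x
    by (simp add: Y_def chord_coord)
  obtain D where D: "poly_eval D x0 \<noteq> 0" "\<And>x j. poly_eval D x \<noteq> 0 \<Longrightarrow> j \<in> ?J \<Longrightarrow>
     \<exists>c. \<forall>i\<in>?J. poly_eval (\<Sum>l\<in>?J. pconst (c l) * f l) (\<lambda>v. poly_eval (Y i v) x) = of_bool (i = j)"
  proof (rule generic_dual_forms[of ?J f Y x0])
    fix l i assume li: "l \<in> ?J" "i \<in> ?J"
    obtain b c where bc: "i = (b, c)"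
      by fastforce
    have "poly_eval (f l) (\<lambda>v. poly_eval (Y i v) x0) = of_bool (\<iota> i = \<iota> l)"
      unfolding bc Y using f(2)[OF li(1) \<iota>_le(2,3)[OF li(2)]] by (simp add: x0_def bc prod_eq_iff)
    then show "poly_eval (f l) (\<lambda>v. poly_eval (Y i v) x0) = of_bool (l = i)"
      using inj_on_eq_iff[OF \<iota>(2) li] by auto
  qed auto
  show ?thesis
  proof (rule that[OF D(1)])
    fix x b c assume x: "poly_eval D x \<noteq> 0" and b: "b < n"
    obtain w where w: "\<And>i. i \<in> ?J \<Longrightarrow> poly_eval (\<Sum>l\<in>?J. pconst (w l) * f l) (\<lambda>v. poly_eval (Y i v) x) = of_bool (i = (b, c))"
      using D(2)[OF x, of "(b, c)"] b by blast
    let ?g = "\<Sum>l\<in>?J. pconst (w l) * f l"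
    have "homogeneous e ?g"
      using f(1) by (intro homogeneous_sum homogeneous_cmult)
    moreover have "ev ?g z = 0" if "a < A" "z \<in> ruling_line a" for a z
      using f_ruling[OF _ that] by simp
    moreover have "ev ?g (chord_point x b' c') = of_bool (b' = b \<and> c' = c)" if "b' < n" for b' c'
      using w[of "(b', c')"] that unfolding Y by simp
    ultimately show "\<exists>g. homogeneous e g \<and> (\<forall>a<A. \<forall>z\<in>ruling_line a. ev g z = 0) \<and>
       (\<forall>b'<n. \<forall>c'. ev g (chord_point x b' c') = of_bool (b' = b \<and> c' = c))"
      by (intro exI[of _ ?g]) blast
  qed
qed

text \<open>Compared with the Hartshorne--Hirschowitz bound \<open>k (e + 1) \<le> (e + 3 choose 3)\<close> this bound is
  weaker by a linear term in \<open>e\<close>, which absorbs all rounding in the induction.\<close>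

lemma ex_indep_chords:
  assumes "6 * k \<le> (e - 1) * (e - 2)"
  shows "\<exists>x. (\<forall>b<k. chord_point x b False \<noteq> chord_point x b True) \<and> indep_lines e k (chord x)"
  using assms
proof (induction e arbitrary: k rule: induct_nat_012)
  \<comment> \<open>Truncated subtraction makes the bound 0 for e = 0 and for e = 1, so there are no
    lines.\<close>
  case 0
  then show ?case
    by (simp add: indep_lines_def)
next
  case 1
  then show ?case
    by (simp add: indep_lines_def)
next
  case (ge2 e)
  \<comment> \<open>As many lines as the induction hypothesis allows in degree e; the remaining
    \<open>A\<close> come from the ruling.\<close>
  define n where "n = min k (((e - 1) * (e - 2)) div 6)"
  define A where "A = k - n"
  have k: "k = A + n"
    by (simp add: A_def n_def)
  have n6: "6 * n \<le> (e - 1) * (e - 2)"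
    unfolding n_def by linarith
  have k6: "6 * k \<le> (e + 1) * e"
    using ge2.prems by simp
  have A6: "6 * A \<le> 4 * e + 3"
  proof (cases "k \<le> ((e - 1) * (e - 2)) div 6")
    case True
    then show ?thesis
      by (simp add: A_def n_def)
  next
    case False
    then have "(e - 1) * (e - 2) \<le> 6 * n + 5"
      unfolding n_def by linarith
    \<comment> \<open>For positive e the two sides agree. For e = 0 truncation turns the product (e
      - 1) (e - 2) into 0 instead of 2, hence the extra 2. The bound 4 e + 3 then includes a
      rounding loss of 5 from the division by 6.\<close>
    moreover have "(e + 1) * e + 2 \<le> (e - 1) * (e - 2) + 4 * e + (if e = 0 then 2 else 0)"
    proof (cases "e < 2")
      case True
      then have "e = 0 \<or> e = 1"
        by auto
      then show ?thesis
        by auto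
    next
      case False
      then obtain m where "e = m + 2"
        by (metis add.commute le_add_diff_inverse not_less)
      then show ?thesis
        by (simp add: algebra_simps)
    qed
    ultimately show ?thesis
      using k6 k by (cases "e = 0") auto
  qed
  have "6 * n \<le> e * e + 2"
  proof (cases "e < 2")
    case True
    then show ?thesis
      using n6 by (cases "e = 0") auto
  next
    case False
    then obtain m where "e = m + 2"
      by (metis add.commute le_add_diff_inverse not_less)
    then show ?thesis
      using n6 by (simp add: algebra_simps)
  qed
  moreover have "6 * A * (e + 3) \<le> (4 * e + 3) * (e + 3)"
    using A6 by (rule mult_right_mono) simp
  \<comment> \<open>In degree e + 2 the \<open>A\<close> lines use up A (e + 3) of the (e + 3) ^ 2
    grid points; the 2 n end points fit into the rest.\<close>
  ultimately have "6 * (2 * n + A * (e + 3)) \<le> 6 * ((e + 3) * (e + 3))"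
    by (simp add: algebra_simps)
  then have "2 * n \<le> (e + 3) * (e + 3) - A * (e + 3)"
    by (intro add_le_imp_le_diff) (rule mult_left_le_imp_le[of 6], simp_all only: zero_less_numeral)
  then have n2: "2 * n \<le> (e + 2 + 1 - A) * (e + 2 + 1)"
    by (simp only: diff_mult_distrib add.assoc) simp
  have A_le: "A \<le> e + 3"
    using A6 by simp
  obtain x1 where x1: "\<And>b. b < n \<Longrightarrow> chord_point x1 b False \<noteq> chord_point x1 b True"
    "indep_lines e n (chord x1)"
    using ge2.IH(1)[OF n6] by blast
  obtain D1 where D1: "poly_eval D1 x1 \<noteq> 0" "\<And>x. poly_eval D1 x \<noteq> 0 \<Longrightarrow> indep_lines e n (chord x)"
    using indep_chords_generic[OF x1(2,1)] by blast
  obtain D2 x2 where D2: "poly_eval D2 x2 \<noteq> 0" "\<And>x b c. poly_eval D2 x \<noteq> 0 \<Longrightarrow> b < n \<Longrightarrow>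
     \<exists>g. homogeneous (e + 2) g \<and> (\<forall>a<A. \<forall>z\<in>ruling_line a. ev g z = 0) \<and>
       (\<forall>b'<n. \<forall>c'. ev g (chord_point x b' c') = of_bool (b' = b \<and> c' = c))"
    using interpolation_generic[of A "e + 2" n] A_le n2 by auto
  \<comment> \<open>Transversality: both parameters of the end points differ. The witness gives
    every chord the end points with parameters (0, 0) and (1, 1).\<close>
  define D3 :: "chord_var cpoly" where "D3 = (\<Prod>b<n. (pvar (b, False, False) - pvar (b, True, False)) *
      (pvar (b, False, True) - pvar (b, True, True)))"
  have D3: "poly_eval D3 (\<lambda>(b, c, d). of_bool c) \<noteq> 0"
    by (simp add: D3_def)
  obtain x4 where x4: "poly_eval D1 x4 \<noteq> 0" "poly_eval D2 x4 \<noteq> 0"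
    using poly_eval_common_nonzero[OF D1(1) D2(1)] by blast
  then have "poly_eval (D1 * D2) x4 \<noteq> 0"
    by simp
  then obtain x where x: "poly_eval (D1 * D2) x \<noteq> 0" "poly_eval D3 x \<noteq> 0"
    using poly_eval_common_nonzero[OF _ D3] by blast
  have transversal: "(x (b, False, False) - x (b, True, False)) * (x (b, False, True) - x (b, True, True)) \<noteq> 0"
    if "b < n" for b
    using x(2) that by (auto simp: D3_def)
  have indep: "indep_lines (e + 2) (A + n) (\<lambda>a. if a < A then ruling_line a else chord x (a - A))"
  proof (rule indep_lines_add_ruling[of A e n "\<lambda>b c. x (b, c, False)" "\<lambda>b c. x (b, c, True)"])
    show "A \<le> e + 3"
      by (rule A_le)
    show "(x (b, False, False) - x (b, True, False)) * (x (b, False, True) - x (b, True, True)) \<noteq> 0"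
      if "b < n" for b
      using that by (rule transversal)
    show "indep_lines e n (chord x)"
      using x(1) by (intro D1(2)) simp
    show "\<exists>g. homogeneous (e + 2) g \<and> (\<forall>a<A. \<forall>z\<in>ruling_line a. ev g z = 0) \<and>
       (\<forall>b'<n. \<forall>c'. ev g (chord_point x b' c') = of_bool (b' = b \<and> c' = c))" if "b < n" for b c
      using x(1) that by (intro D2(2)) simp_all
  qed
  \<comment> \<open>Ruling lines are recorded as degenerate chords with end points t = 0 and t = 1,
    so the statement is again about chords. They lie on the quadric; the next induction step moves
    them off it by \<open>indep_chords_generic\<close>.\<close>
  define y where "y = (\<lambda>(b, c, d). if b < A then (if d then of_bool c else of_nat b) else x (b - A, c, d))"
  have "chord y = (\<lambda>a. if a < A then ruling_line a else chord x (a - A))"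
    by (rule ext) (simp add: y_def)
  then have "indep_lines (e + 2) k (chord y)"
    using indep k by simp
  moreover have "chord_point y b False \<noteq> chord_point y b True" if "b < k" for b
  proof (cases "b < A")
    case True
    then show ?thesis
      by (simp add: y_def seg_eq_iff)
  next
    case False
    then show ?thesis
      using transversal[of "b - A"] that k by (auto simp: y_def seg_eq_iff)
  qed
  ultimately show ?case
    by (intro exI[of _ y]) simp
qed

section \<open>Smooth forms through independent lines\<close>

lemma thin_Un: "thin A \<Longrightarrow> thin B \<Longrightarrow> thin (A \<union> B)"
  using thin_UN[of "{A, B}" "\<lambda>s. s"] by auto

text \<open>One constructor per kind of bad event: singular points off the lines, singular points on
  a line, extra lines. Formal indices make the maps \<kappa> injective even if some of the forms
  coincide.\<close>

datatype system_index =
  Off "4 cpoly" 4 | On nat "4 cpoly" 4 | Ln "4 cpoly" 4 4 "nat set" nat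

text \<open>The linear system contains a block of products for every possible nonvanishing factor
  \<open>G\<close>. Each bad event at a point or line then has some block in which its conditions
  can be solved for coefficients.\<close>

lemma smooth_form_through_indep_lines:
  assumes indep: "indep_lines e k W"
    and W: "\<And>a. a < k \<Longrightarrow> vec.subspace (W a) \<and> vec.dim (W a) = 2"
  obtains F where "homogeneous (e + 5) F" "\<And>a x. a < k \<Longrightarrow> x \<in> W a \<Longrightarrow> ev F x = 0"
    "\<And>z. z \<noteq> 0 \<Longrightarrow> ev F z = 0 \<Longrightarrow> \<exists>i. ev (partial_derivative i F) z \<noteq> 0"
    "\<And>M. vec.subspace M \<Longrightarrow> vec.dim M = 2 \<Longrightarrow> (\<And>a. a < k \<Longrightarrow> M \<inter> W a \<subseteq> {0}) \<Longrightarrow>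
       \<exists>z\<in>M. ev F z \<noteq> 0"
proof -
  have "\<exists>i j \<alpha> \<beta>. a < k \<longrightarrow> i \<noteq> j \<and> \<alpha> $ i = 1 \<and> \<alpha> $ j = 0 \<and> \<beta> $ i = 0 \<and> \<beta> $ j = 1 \<and>
      W a = vec.span {\<alpha>, \<beta>}" for a
  proof (cases "a < k")
    case True
    then show ?thesis
      using plane_echelon[of "W a"] W[OF True] by metis
  qed simp
  then obtain i j :: "nat \<Rightarrow> 4" and \<alpha> \<beta> :: "nat \<Rightarrow> complex ^ 4" where ech: "\<And>a. a < k \<Longrightarrow>
      i a \<noteq> j a \<and> \<alpha> a $ i a = 1 \<and> \<alpha> a $ j a = 0 \<and> \<beta> a $ i a = 0 \<and> \<beta> a $ j a = 1 \<and>
      W a = vec.span {\<alpha> a, \<beta> a}"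
    by metis
  have on_line: "ev (echform (i a) (j a) (\<alpha> a) (\<beta> a) v) x = 0" if "a < k" "x \<in> W a" for a v x
    using echform_plane[of "\<alpha> a" "i a" "j a" "\<beta> a" x] ech[OF that(1)] that(2) by auto
  let ?Z = "\<Union>a<k. W a" and ?Z' = "\<lambda>a. \<Union>b\<in>{..<k} - {a}. W b"
  obtain \<G>1 where "generates_forms (e + 4) ?Z \<G>1"
    using ex_generates_forms by blast
  note \<G>1 = generates_formsD[OF this]
  obtain \<G>2 where "generates_forms (e + 1) ?Z \<G>2"
    using ex_generates_forms by blast
  note \<G>2 = generates_formsD[OF this]
  have "\<forall>a. \<exists>\<G>. generates_forms (e + 4) (?Z' a) \<G>"
    by (intro allI ex_generates_forms)
  then obtain \<G>3 where "\<forall>a. generates_forms (e + 4) (?Z' a) (\<G>3 a)"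
    by (rule choice[THEN exE])
  note \<G>3 = generates_formsD[OF this[rule_format]]
  \<comment> \<open>The possible sets of five test points: of the e + 6 integers up to e + 5, at
    most e + 1 are roots of a form of degree e + 1 on a line.\<close>
  define \<T> where "\<T> = {T. T \<subseteq> {..e + 5} \<and> card T = 5}"
  have "finite \<T>"
    by (rule finite_subset[of _ "Pow {..e + 5}"]) (auto simp: \<T>_def)
  have fin_T: "finite T" if "T \<in> \<T>" for T
    using that finite_subset by (auto simp: \<T>_def)
  define H where "H x = (case x of Off G v \<Rightarrow> pvar v * G
      | On a G v \<Rightarrow> echform (i a) (j a) (\<alpha> a) (\<beta> a) v * G
      | Ln G p q T r \<Rightarrow> lagrange_form p q T r * G)" for x
  have H_simps: "H (Off G v) = pvar v * G" "H (On a G v) = echform (i a) (j a) (\<alpha> a) (\<beta> a) v * G"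
      "H (Ln G p q T r) = lagrange_form p q T r * G" for G v a p q T r
    by (simp_all add: H_def)
  define I1 where "I1 = (\<Union>G\<in>\<G>1. range (Off G))"
  define I2 where "I2 = (\<Union>a<k. \<Union>G\<in>\<G>3 a. range (On a G))"
  define I3 where "I3 = (\<Union>G\<in>\<G>2. \<Union>p. \<Union>q. \<Union>T\<in>\<T>. Ln G p q T ` T)"
  define I where "I = I1 \<union> I2 \<union> I3"
  have "finite I"
    unfolding I_def I1_def I2_def I3_def using \<G>1(1) \<G>2(1) \<G>3(1) \<open>finite \<T>\<close> fin_T by auto
  have hom_H: "homogeneous (e + 5) (H x)" if "x \<in> I" for x
    using that unfolding I_def
  proof (elim UnE)
    assume "x \<in> I1"
    then obtain G v where "G \<in> \<G>1" "x = Off G v"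
      by (auto simp: I1_def)
    then show ?thesis
      using homogeneous_mult[OF homogeneous_pvar[of v] \<G>1(2)[of G]] by (simp add: H_simps add.commute)
  next
    assume "x \<in> I2"
    then obtain a G v where "G \<in> \<G>3 a" "x = On a G v"
      by (auto simp: I2_def)
    then show ?thesis
      using homogeneous_mult[OF homogeneous_echform[of "i a" "j a" "\<alpha> a" "\<beta> a" v] \<G>3(2)[of G a]]
      by (simp add: H_simps add.commute)
  next
    assume "x \<in> I3"
    then obtain G p q T r where *: "G \<in> \<G>2" "T \<in> \<T>" "r \<in> T" "x = Ln G p q T r"
      by (auto simp: I3_def)
    then have "card T - 1 = 4"
      by (simp add: \<T>_def)
    then show ?thesis
      using homogeneous_mult[OF homogeneous_lagrange_form[OF fin_T[OF *(2)] *(3), of p q] \<G>2(2)[OF *(1)]] *(4)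
      by (simp add: H_simps add.commute)
  qed
  have van_H: "ev (H x) z = 0" if "x \<in> I" "a < k" "z \<in> W a" for x a z
    using that(1) unfolding I_def
  proof (elim UnE)
    assume "x \<in> I1"
    then obtain G v where "G \<in> \<G>1" "x = Off G v"
      by (auto simp: I1_def)
    then show ?thesis
      using \<G>1(3)[of G z] that by (auto simp: H_simps)
  next
    assume "x \<in> I2"
    then obtain b G v where "b < k" "G \<in> \<G>3 b" "x = On b G v"
      by (auto simp: I2_def)
    then show ?thesis
      using \<G>3(3)[of G b z] on_line[of b z v] that by (cases "a = b") (auto simp: H_simps)
  next
    assume "x \<in> I3"
    then obtain G p q T r where *: "G \<in> \<G>2" "x = Ln G p q T r"
      by (auto simp: I3_def)
    then show ?thesis
      using \<G>2(3)[of G z] that by (auto simp: H_simps)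
  qed
  define B1 where "B1 G p = {c. \<exists>z. z $ p = 1 \<and> ev G z \<noteq> 0 \<and> ev (lincomb I H c) z = 0 \<and>
     (\<forall>v. ev (partial_derivative v (lincomb I H c)) z = 0)}" for G and p :: 4
  define B2 where "B2 G p q = {c. \<exists>t. ev G (p + t *s q) \<noteq> 0 \<and>
     (\<forall>v. ev (partial_derivative v (lincomb I H c)) (p + t *s q) = 0)}" for G p q
  define B3 where "B3 G p q T = {c. \<exists>\<alpha> \<beta>. \<alpha> $ p = 1 \<and> \<alpha> $ q = 0 \<and> \<beta> $ p = 0 \<and> \<beta> $ q = 1 \<and>
     (\<forall>r\<in>T. ev G (\<alpha> + of_nat r *s \<beta>) \<noteq> 0 \<and> ev (lincomb I H c) (\<alpha> + of_nat r *s \<beta>) = 0)}"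
    for G and p q :: 4 and T :: "nat set"
  have "thin (B1 G p)" if "G \<in> \<G>1" for G p
    unfolding B1_def
    by (rule thin_singular_off_base_locus[OF \<open>finite I\<close>, of "Off G"])
      (use that in \<open>auto simp: I_def I1_def H_simps inj_def\<close>)
  then have thin1: "thin (\<Union>G\<in>\<G>1. \<Union>p. B1 G p)"
    using \<G>1(1) by (intro thin_UN) auto
  have B2: "thin (B2 G p q)" if "a < k" "G \<in> \<G>3 a" "p \<in> W a" "q \<in> W a" for a G p q
    unfolding B2_def
  proof (rule thin_singular_on_line[OF \<open>finite I\<close>, of "On a G"])
    show "ev (echform (i a) (j a) (\<alpha> a) (\<beta> a) v) (p + t *s q) = 0" for t v
      using W[OF that(1)] that by (intro on_line) (auto intro: vec.subspace_add vec.subspace_scale)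
  qed (use that ech[OF that(1)] in \<open>auto simp: I_def I2_def H_simps inj_def\<close>)
  have \<alpha>\<beta>: "\<alpha> a \<in> W a" "\<beta> a \<in> W a" if "a < k" for a
    using ech[OF that] by (auto intro: vec.span_base)
  \<comment> \<open>The points \<open>p + t q\<close> miss the class of \<open>q\<close>; exchanging
    the two basis vectors covers the whole projective line.\<close>
  have thin2: "thin (\<Union>a<k. \<Union>G\<in>\<G>3 a. B2 G (\<alpha> a) (\<beta> a) \<union> B2 G (\<beta> a) (\<alpha> a))"
    using \<G>3(1) \<alpha>\<beta> by (intro thin_UN thin_Un B2) auto
  have "thin (B3 G p q T)" if "G \<in> \<G>2" "T \<in> \<T>" "p \<noteq> q" for G p q T
    unfolding B3_def
  proof (rule thin_contains_line[OF \<open>finite I\<close>, of "Ln G p q T"])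
    show "Ln G p q T ` T \<subseteq> I"
      unfolding I_def I3_def using that by blast
  qed (use that fin_T[OF that(2)] in \<open>auto simp: \<T>_def H_simps inj_def\<close>)
  then have thin3: "thin (\<Union>G\<in>\<G>2. \<Union>p. \<Union>q\<in>- {p}. \<Union>T\<in>\<T>. B3 G p q T)"
    using \<G>2(1) \<open>finite \<T>\<close> by (intro thin_UN) auto
  obtain c where "c \<notin> (\<Union>G\<in>\<G>1. \<Union>p. B1 G p) \<union>
      ((\<Union>a<k. \<Union>G\<in>\<G>3 a. B2 G (\<alpha> a) (\<beta> a) \<union> B2 G (\<beta> a) (\<alpha> a)) \<union>
       (\<Union>G\<in>\<G>2. \<Union>p. \<Union>q\<in>- {p}. \<Union>T\<in>\<T>. B3 G p q T))"
    using thin_not_UNIV[OF thin_Un[OF thin1 thin_Un[OF thin2 thin3]]] by (rule exE)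
  then have c: "c \<notin> (\<Union>G\<in>\<G>1. \<Union>p. B1 G p)"
    "c \<notin> (\<Union>a<k. \<Union>G\<in>\<G>3 a. B2 G (\<alpha> a) (\<beta> a) \<union> B2 G (\<beta> a) (\<alpha> a))"
    "c \<notin> (\<Union>G\<in>\<G>2. \<Union>p. \<Union>q\<in>- {p}. \<Union>T\<in>\<T>. B3 G p q T)"
    by (simp_all only: Un_iff de_Morgan_disj not_False_eq_True)
  let ?F = "lincomb I H c"
  have hom_F: "homogeneous (e + 5) ?F"
    unfolding lincomb_def using hom_H by (intro homogeneous_sum homogeneous_cmult)
  show ?thesis
  proof (rule that[of ?F])
    show "homogeneous (e + 5) ?F"
      by (rule hom_F)
    show "ev ?F x = 0" if "a < k" "x \<in> W a" for a x
      unfolding ev_lincomb using van_H that by (intro sum.neutral) auto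
    show "\<exists>v. ev (partial_derivative v ?F) z \<noteq> 0" if z: "z \<noteq> 0" "ev ?F z = 0" for z
    proof (rule ccontr)
      assume "\<not> ?thesis"
      \<comment> \<open>By homogeneity all multiples of \<open>z\<close> are singular, so
        \<open>z\<close> can be rescaled to fit the normalizations in \<open>B1\<close> and
        \<open>B2\<close>.\<close>
      then have sing: "ev (partial_derivative v ?F) (s *s z) = 0" for v s
        using ev_scale[OF homogeneous_partial_derivative[OF hom_F]] by auto
      show False
      proof (cases "\<exists>a<k. z \<in> W a")
        case True
        then obtain a where a: "a < k" "z \<in> W a"
          by blast
        obtain G0 where "homogeneous (e + 4) G0" "\<And>b x. b < k \<Longrightarrow> b \<noteq> a \<Longrightarrow> x \<in> W b \<Longrightarrow> ev G0 x = 0"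
          "ev G0 z \<noteq> 0"
          using indep_lines_nonzero_at[OF indep a z(1), of "e + 4"] by auto
        then obtain G where G: "G \<in> \<G>3 a" "ev G z \<noteq> 0"
          using \<G>3(4)[of G0 a z] by auto
        have nz: "ev G (s *s z) \<noteq> 0" if "s \<noteq> 0" for s
          using ev_scale[OF \<G>3(2)[OF G(1)]] G(2) that by simp
        obtain s t where st: "z = s *s \<alpha> a + t *s \<beta> a"
          using a(2) ech[OF a(1)] span_pair[of z "\<alpha> a" "\<beta> a"] by auto
        have "c \<in> B2 G (\<alpha> a) (\<beta> a) \<union> B2 G (\<beta> a) (\<alpha> a)"
        proof (cases "s = 0")
          case True
          then have "t \<noteq> 0" "\<beta> a + 0 *s \<alpha> a = (1 / t) *s z"
            using st z(1) by auto
          then show ?thesis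
            unfolding B2_def using nz[of "1 / t"] sing by (intro UnI2 CollectI exI[of _ 0]) simp
        next
          case False
          then have "\<alpha> a + (t / s) *s \<beta> a = (1 / s) *s z"
            using st by (simp add: vec.scale_right_distrib)
          then show ?thesis
            unfolding B2_def using nz[of "1 / s"] sing False by (intro UnI1 CollectI exI[of _ "t / s"]) simp
        qed
        then show False
          using c(2) a(1) G(1) by blast
      next
        case False
        obtain G0 where "homogeneous (e + 4) G0" "\<And>a x. a < k \<Longrightarrow> x \<in> W a \<Longrightarrow> ev G0 x = 0" "ev G0 z \<noteq> 0"
          using indep_lines_base_point_free[OF indep W z(1), of "e + 4"] False by auto
        then obtain G where G: "G \<in> \<G>1" "ev G z \<noteq> 0"
          using \<G>1(4)[of G0 z] by auto
        obtain p where p: "z $ p \<noteq> 0"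
          using z(1) by (auto simp: vec_eq_iff)
        have "ev G ((1 / z $ p) *s z) \<noteq> 0" "ev ?F ((1 / z $ p) *s z) = 0"
          using ev_scale[OF \<G>1(2)[OF G(1)], of "1 / z $ p" z] ev_scale[OF hom_F, of "1 / z $ p" z] G(2) p z(2)
          by auto
        then have "c \<in> B1 G p"
          unfolding B1_def using sing p by (intro CollectI exI[of _ "(1 / z $ p) *s z"]) auto
        then show False
          using c(1) G(1) by blast
      qed
    qed
    show "\<exists>z\<in>M. ev ?F z \<noteq> 0"
      if M: "vec.subspace M" "vec.dim M = 2" "\<And>a. a < k \<Longrightarrow> M \<inter> W a \<subseteq> {0}" for M
    proof (rule ccontr)
      assume contra: "\<not> ?thesis"
      obtain p q u v where uv: "p \<noteq> q" "u $ p = 1" "u $ q = 0" "v $ p = 0" "v $ q = 1" "M = vec.span {u, v}"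
        using plane_echelon[OF M(1,2)] .
      have "u \<noteq> 0" "u \<in> M"
        using uv by (auto intro: vec.span_base)
      moreover from this have "u \<notin> W a" if "a < k" for a
        using M(3)[OF that] by blast
      ultimately obtain G0 where "homogeneous (e + 1) G0" "\<And>a x. a < k \<Longrightarrow> x \<in> W a \<Longrightarrow> ev G0 x = 0" "ev G0 u \<noteq> 0"
        using indep_lines_base_point_free[OF indep W, of u "e + 1"] by auto
      then obtain G where G: "G \<in> \<G>2" "ev G u \<noteq> 0"
        using \<G>2(4)[of G0 u] by auto
      obtain P where P: "degree P \<le> e + 1" "\<And>t. ev G (u + t *s v) = poly P t"
        using ev_line_poly[OF \<G>2(2)[OF G(1)], of u v] by blast
      have "P \<noteq> 0"
        using P(2)[of 0] G(2) by auto
      define R where "R = {r \<in> {..e + 5}. poly P (of_nat r) = 0}"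
      have "card R = card ((of_nat :: nat \<Rightarrow> complex) ` R)"
        by (rule card_image[symmetric]) (auto simp: inj_on_def)
      also have "\<dots> \<le> card {t. poly P t = 0}"
        using \<open>P \<noteq> 0\<close> by (intro card_mono poly_roots_finite) (auto simp: R_def)
      also have "\<dots> \<le> e + 1"
        using card_poly_roots_bound[OF \<open>P \<noteq> 0\<close>] P(1) by simp
      finally have "5 \<le> card ({..e + 5} - R)"
        by (subst card_Diff_subset) (auto simp: R_def)
      then obtain T where T: "T \<subseteq> {..e + 5} - R" "card T = 5"
        by (meson obtain_subset_with_card_n)
      have "u + t *s v \<in> M" for t
        unfolding uv(6) span_pair by (intro exI[of _ 1] exI[of _ t]) simp
      then have "c \<in> B3 G p q T"
        unfolding B3_def using uv T contra P(2) by (intro CollectI exI[of _ u] exI[of _ v]) (auto simp: R_def)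
      moreover have "T \<in> \<T>"
        using T by (auto simp: \<T>_def)
      ultimately have "c \<in> (\<Union>G\<in>\<G>2. \<Union>p. \<Union>q\<in>- {p}. \<Union>T\<in>\<T>. B3 G p q T)"
        using uv(1) by (intro UN_I[OF G(1)] UN_I[of p UNIV] UN_I[of q "- {p}"] UN_I[of T \<T>]) auto
      then show False
        using c(3) by (rule notE[rotated])
    qed
  qed
qed

section \<open>From planes in affine space to lines in projective space\<close>

lemma mem_hpoint: "z \<in> hpoint z"
  by (simp add: hpoint_def vec.span_base)

lemma hpoint_eqD: "hpoint z = hpoint w \<Longrightarrow> \<exists>c. z = c *s w"
  using mem_hpoint[of z] by (auto simp: hpoint_def vec.span_singleton)

lemma hpoint_in_projectivization:
  assumes "vec.subspace W" "z \<noteq> 0"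
  shows "hpoint z \<in> projectivization W \<longleftrightarrow> z \<in> W"
proof
  assume "hpoint z \<in> projectivization W"
  then obtain w where "hpoint z = hpoint w" "w \<in> W"
    by (auto simp: projectivization_def)
  then show "z \<in> W"
    using hpoint_eqD[of z w] vec.subspace_scale[OF assms(1)] by auto
qed (use assms in \<open>auto simp: projectivization_def\<close>)

lemma projectivization_subset_zero_locus:
  assumes "homogeneous n F"
  shows "projectivization W \<subseteq> zero_locus F \<longleftrightarrow> (\<forall>z\<in>W. z \<noteq> 0 \<longrightarrow> ev F z = 0)"
proof
  assume sub: "projectivization W \<subseteq> zero_locus F"
  show "\<forall>z\<in>W. z \<noteq> 0 \<longrightarrow> ev F z = 0"
  proof (intro ballI impI)
    fix z assume "z \<in> W" "z \<noteq> 0"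
    then have "hpoint z \<in> zero_locus F"
      using sub by (auto simp: projectivization_def)
    then obtain w where "hpoint z = hpoint w" "ev F w = 0"
      by (auto simp: zero_locus_def)
    then show "ev F z = 0"
      using hpoint_eqD[of z w] ev_scale[OF assms] by auto
  qed
qed (auto simp: projectivization_def zero_locus_def)

lemma dim_span_pair:
  fixes u v :: "complex ^ 4"
  assumes "u \<noteq> v" "vec.independent {u, v}"
  shows "vec.dim (vec.span {u, v}) = 2"
  using assms by (simp add: vec.dim_span vec.dim_eq_card_independent)

section \<open>Multihomogeneous polynomials\<close>

text \<open>\<open>D\<close> is kept explicit because the elimination in
  \<open>generic_dual_basis\<close> adds degrees. Degree 0 in the groups from k on says that their
  variables do not occur.\<close>

definition multidegree :: "nat \<Rightarrow> (nat \<Rightarrow> nat) \<Rightarrow> (nat \<times> 4 \<times> 4) cpoly \<Rightarrow> bool" where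
  "multidegree k D f \<longleftrightarrow> (\<forall>a\<ge>k. D a = 0) \<and> (\<forall>a. whom (\<lambda>v. of_bool (fst v = a)) (D a) f)"

lemma multihomogeneousI:
  assumes "multidegree k D f"
  shows "multihomogeneous k f"
  unfolding multihomogeneous_def
proof (intro conjI exI[of _ D] ballI allI impI)
  fix m a assume m: "m \<in> Poly_Mapping.keys f"
  have "(\<Sum>v\<in>{v \<in> Poly_Mapping.keys m. fst v = a}. Poly_Mapping.lookup m v) =
      wdeg (\<lambda>v. of_bool (fst v = a)) m"
    unfolding wdeg_def by (rule sum.mono_neutral_cong_left) auto
  then show "(\<Sum>v\<in>{v \<in> Poly_Mapping.keys m. fst v = a}. Poly_Mapping.lookup m v) = D a"
    using assms m by (simp add: multidegree_def whom_def)
next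
  fix m v assume m: "m \<in> Poly_Mapping.keys f" and v: "v \<in> Poly_Mapping.keys m"
  show "fst v < k"
  proof (rule ccontr)
    assume "\<not> ?thesis"
    then have "wdeg (\<lambda>u. of_bool (fst u = fst v)) m = 0"
      using assms m by (simp add: multidegree_def whom_def)
    then have "of_bool (fst v = fst v) * Poly_Mapping.lookup m v = 0"
      unfolding wdeg_def using v by (metis (mono_tags, lifting) finite_keys sum_eq_0_iff)
    then show False
      using v by (simp add: in_keys_iff)
  qed
qed

section \<open>The open set\<close>

lemma choose_three: "6 * ((m + 3) choose 3) = (m + 3) * (m + 2) * (m + 1)"
proof -
  have "3 * ((m + 3) choose 3) = (m + 3) * ((m + 2) choose 2)"
    using Suc_times_binomial[of 2 "m + 2"] by (simp add: numeral_3_eq_3 del: binomial_Suc_Suc)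
  moreover have "2 * ((m + 2) choose 2) = (m + 2) * (m + 1)"
    using Suc_times_binomial[of 1 "m + 1"] by (simp add: numeral_2_eq_2 del: binomial_Suc_Suc)
  ultimately show ?thesis
    by algebra
qed

text \<open>With m = d - 9, the divisor m + 1 cancels against the last factor of 6 times the
  binomial coefficient, and m + 3, m + 2 are the two factors on the right.\<close>

lemma nu_j_bound:
  assumes "d \<ge> 10" "k \<le> nu_j d"
  shows "6 * k \<le> (d - 5 - 1) * (d - 5 - 2)"
proof -
  define m where "m = d - 9"
  have d: "d = m + 9"
    using assms(1) by (simp add: m_def)
  have "k \<le> (((m + 3) choose 3) - 1) div (m + 1)"
    using assms by (simp add: nu_j_def nu_def m_def)
  then have "k * (m + 1) \<le> ((m + 3) choose 3) - 1"
    by (simp add: less_eq_div_iff_mult_less_eq)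
  then have "6 * k * (m + 1) \<le> (m + 3) * (m + 2) * (m + 1)"
    unfolding choose_three[symmetric] by linarith
  then have "6 * k \<le> (m + 3) * (m + 2)"
    by (simp only: mult_le_cancel2)
  then show ?thesis
    by (simp add: d numeral_eq_Suc)
qed

text \<open>Contraction of the bivector of \<open>u\<close> and \<open>v\<close> with a linear form:
  the result lies on the line and in the plane where the form vanishes. It yields points of the line
  that are linear in the Pluecker coordinates.\<close>

lemma pluecker_times_vector:
  "(\<chi> i. \<Sum>j\<in>UNIV. w $ j * (u $ i * v $ j - u $ j * v $ i)) =
     ev (linform w) v *s u + (- ev (linform w) u) *s v"
  by (simp add: vec_eq_iff ev_linform sum_distrib_right sum_distrib_left sum_subtractf algebra_simps)

text \<open>Fixed planes cut out e + 1 points on each line, and the forms dual to these points for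
  the chord example are evaluated there. Where the resulting determinant is nonzero, dual forms
  exist and the lines are independent.\<close>

lemma ex_open_indep_lines:
  assumes "6 * k \<le> (e - 1) * (e - 2)"
  obtains U where "zariski_open k U" "U \<noteq> {}"
    "\<And>L. L \<in> U \<Longrightarrow> \<exists>W. (\<forall>a<k. L a = projectivization (W a) \<and> vec.subspace (W a) \<and> vec.dim (W a) = 2) \<and>
       indep_lines e k W"
proof -
  let ?J = "{..<k} \<times> {..e}"
  let ?val = "\<lambda>p :: nat \<Rightarrow> 4 \<times> 4 \<Rightarrow> complex. (\<lambda>(a, ij). p a ij)"
  obtain x where x: "\<And>a. a < k \<Longrightarrow> chord_point x a False \<noteq> chord_point x a True"
    "indep_lines e k (chord x)"
    using ex_indep_chords[OF assms] by blast
  define u v where "u a = chord_point x a False" and "v a = chord_point x a True" for a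
  have uv: "u a \<noteq> v a \<and> vec.independent {u a, v a}" if "a < k" for a
    using x(1)[OF that] independent_seg by (simp add: u_def v_def)
  define p0 where "p0 a = (\<lambda>(i, j). u a $ i * v a $ j - u a $ j * v a $ i)" for a
  have "\<exists>f. i \<in> ?J \<longrightarrow> homogeneous e f \<and> (\<forall>b<k. \<forall>t\<le>e.
      ev f (u b + of_nat t *s v b) = of_bool (fst i = b \<and> snd i = t))" for i
  proof (cases "i \<in> ?J")
    case True
    then have "fst i < k" "snd i \<le> e"
      by auto
    from indep_lines_dual[OF x(2), of u v, OF _ uv this] show ?thesis
      by (auto simp: u_def v_def)
  qed simp
  then have "\<exists>f. \<forall>i. i \<in> ?J \<longrightarrow> homogeneous e (f i) \<and> (\<forall>b<k. \<forall>t\<le>e.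
      ev (f i) (u b + of_nat t *s v b) = of_bool (fst i = b \<and> snd i = t))"
    by (intro choice allI)
  then obtain f where f: "\<And>i. i \<in> ?J \<Longrightarrow> homogeneous e (f i)"
    "\<And>i b t. i \<in> ?J \<Longrightarrow> b < k \<Longrightarrow> t \<le> e \<Longrightarrow>
      ev (f i) (u b + of_nat t *s v b) = of_bool (fst i = b \<and> snd i = t)"
    by blast
  \<comment> \<open>With these values on \<open>u\<close> and \<open>v\<close>, contraction with the
    form produces exactly the point \<open>u + s v\<close> of the example.\<close>
  have "\<exists>w. i \<in> ?J \<longrightarrow> ev (linform w) (u (fst i)) = - of_nat (snd i) \<and> ev (linform w) (v (fst i)) = 1" for i
  proof (cases "i \<in> ?J")
    case True
    then have "fst i < k"
      by auto
    then obtain w where "ev (linform w) (u (fst i)) = - of_nat (snd i)" "ev (linform w) (v (fst i)) = 1"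
      using linform_prescribed[of "u (fst i)" "v (fst i)"] uv by blast
    then show ?thesis
      by blast
  qed simp
  then obtain w where w: "\<And>i. i \<in> ?J \<Longrightarrow>
      ev (linform (w i)) (u (fst i)) = - of_nat (snd i) \<and> ev (linform (w i)) (v (fst i)) = 1"
    by metis
  define Y where "Y i l = (\<Sum>j\<in>UNIV. pconst (w i $ j) * pvar (fst i, l, j))" for i :: "nat \<times> nat" and l :: 4
  have Y: "(\<lambda>l. poly_eval (Y i l) (?val p)) =
      ($) (ev (linform (w i)) v' *s u' + (- ev (linform (w i)) u') *s v')"
    if "p (fst i) = (\<lambda>(i, j). u' $ i * v' $ j - u' $ j * v' $ i)" for i p u' v'
    unfolding pluecker_times_vector[symmetric] by (rule ext) (simp add: Y_def that)
  have "\<exists>D \<delta>. multidegree k \<delta> D \<and> poly_eval D (?val p0) = 1 \<and> (\<forall>y. poly_eval D y \<noteq> 0 \<longrightarrow>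
     (\<forall>j\<in>?J. \<exists>c. \<forall>i\<in>?J. (\<Sum>l\<in>?J. c l * poly_eval (psubst (f l) (Y i)) y) = of_bool (i = j)))"
  \<comment> \<open>Each \<open>Y i\<close> is linear in the coordinates of line
    \<open>fst i\<close>, so column i has degree e in that group and degree 0 in all others.\<close>
  proof (rule generic_dual_basis[where G = "multidegree k" and pl = "\<lambda>D D' a. D a + D' a"
        and e = "\<lambda>_. 0" and d = "\<lambda>i a. of_bool (fst i = a) * e"])
    show "finite ?J"
      by simp
    show "multidegree k (\<lambda>a. D a + D' a) (F * F')" if "multidegree k D F" "multidegree k D' F'" for D D' F F'
      using that by (auto simp: multidegree_def intro: whom_mult)
    show "multidegree k D (F - F')" if "multidegree k D F" "multidegree k D F'" for D F F'
      using that by (auto simp: multidegree_def intro: whom_diff)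
    show "multidegree k (\<lambda>_. 0) 1"
      by (simp add: multidegree_def whom_1)
    show "(\<lambda>a. D a + D' a) = (\<lambda>a. D' a + D a)" for D D' :: "nat \<Rightarrow> nat"
      by (simp add: add.commute)
    fix l i assume li: "l \<in> ?J" "i \<in> ?J"
    have "poly_eval (f l) (\<lambda>v. poly_eval (Y i v) (?val p0)) = ev (f l) (u (fst i) + of_nat (snd i) *s v (fst i))"
      by (subst Y[of p0 i "u (fst i)" "v (fst i)"]) (simp_all add: p0_def w[OF li(2)])
    then show "poly_eval (psubst (f l) (Y i)) (?val p0) = of_bool (l = i)"
      using f(2)[OF li(1), of "fst i" "snd i"] li(2) by (auto simp: poly_eval_psubst prod_eq_iff)
    have Y_hom: "whom (\<lambda>v. of_bool (fst v = a)) (of_bool (fst i = a)) (Y i l')" for a l'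
    proof -
      have "whom (\<lambda>v. of_bool (fst v = a)) (of_bool (fst i = a)) (pvar (fst i, l', j))" for j :: 4
        using whom_pvar[of "\<lambda>v. of_bool (fst v = a)" "(fst i, l', j)"] unfolding fst_conv .
      then show ?thesis
        unfolding Y_def by (intro whom_sum whom_pconst_mult)
    qed
    show "multidegree k (\<lambda>a. of_bool (fst i = a) * e) (psubst (f l) (Y i))"
      unfolding multidegree_def using li whom_psubst[OF f(1)[OF li(1)] Y_hom] by auto
  qed
  then obtain D \<delta> where D: "multidegree k \<delta> D" "poly_eval D (?val p0) = 1"
    "\<And>y j. poly_eval D y \<noteq> 0 \<Longrightarrow> j \<in> ?J \<Longrightarrow>
      \<exists>c. \<forall>i\<in>?J. (\<Sum>l\<in>?J. c l * poly_eval (psubst (f l) (Y i)) y) = of_bool (i = j)"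
    by blast
  \<comment> \<open>The existential choice of coordinates makes the complement say that
    \<open>D\<close> vanishes for all of them, as in \<open>vanishes_at\<close>.\<close>
  define U where "U = {L \<in> Gr24_power k. \<exists>p. (\<forall>a<k. pluecker_coords (L a) (p a)) \<and> poly_eval D (?val p) \<noteq> 0}"
  have "zariski_closed k (Gr24_power k - U)"
    unfolding zariski_closed_def using multihomogeneousI[OF D(1)]
    by (intro exI[of _ "{D}"]) (auto simp: U_def vanishes_at_def)
  then have "zariski_open k U"
    by (auto simp: zariski_open_def U_def)
  moreover have "U \<noteq> {}"
  proof -
    define L where "L = (\<lambda>a\<in>{..<k}. projectivization (vec.span {u a, v a}))"
    have "L \<in> Gr24_power k"
      unfolding L_def Gr24_power_def Gr24_def using dim_span_pair uv by (auto intro: vec.subspace_span)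
    moreover have "pluecker_coords (L a) (p0 a)" if "a < k" for a
      unfolding pluecker_coords_def p0_def using uv[OF that] that
      by (intro exI[of _ "u a"] exI[of _ "v a"]) (simp add: L_def)
    ultimately have "L \<in> U"
      using D(2) by (auto simp: U_def intro!: exI[of _ p0])
    then show ?thesis
      by blast
  qed
  moreover have "\<exists>W. (\<forall>a<k. L a = projectivization (W a) \<and> vec.subspace (W a) \<and> vec.dim (W a) = 2) \<and>
       indep_lines e k W" if L: "L \<in> U" for L
  proof -
    obtain p where p: "\<And>a. a < k \<Longrightarrow> pluecker_coords (L a) (p a)" "poly_eval D (?val p) \<noteq> 0"
      using L by (auto simp: U_def)
    define R where "R a u v \<longleftrightarrow> u \<noteq> v \<and> vec.independent {u, v} \<and> L a = projectivization (vec.span {u, v}) \<and>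
        p a = (\<lambda>(i, j). u $ i * v $ j - u $ j * v $ i)" for a and u v :: "complex ^ 4"
    have "\<exists>u v. R a u v" if "a < k" for a
      using p(1)[OF that] unfolding pluecker_coords_def R_def .
    then obtain u' v' where "\<And>a. a < k \<Longrightarrow> R a (u' a) (v' a)"
      by metis
    then have uv': "\<And>a. a < k \<Longrightarrow> u' a \<noteq> v' a \<and> vec.independent {u' a, v' a} \<and>
        L a = projectivization (vec.span {u' a, v' a}) \<and>
        p a = (\<lambda>(i, j). u' a $ i * v' a $ j - u' a $ j * v' a $ i)"
      unfolding R_def .
    define W where "W a = vec.span {u' a, v' a}" for a
    define y where "y a s = ev (linform (w (a, s))) (v' a) *s u' a + (- ev (linform (w (a, s))) (u' a)) *s v' a" for a s
    have "\<exists>c. \<forall>j. j \<in> ?J \<longrightarrow> (\<forall>i\<in>?J. (\<Sum>l\<in>?J. c j l * poly_eval (psubst (f l) (Y i)) (?val p)) = of_bool (i = j))"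
      using D(3)[OF p(2)] by (intro choice allI) auto
    then obtain c where c: "\<And>j i. j \<in> ?J \<Longrightarrow> i \<in> ?J \<Longrightarrow>
        (\<Sum>l\<in>?J. c j l * poly_eval (psubst (f l) (Y i)) (?val p)) = of_bool (i = j)"
      by blast
    define F where "F j = (\<Sum>l\<in>?J. pconst (c j l) * f l)" for j
    have "indep_lines e k W"
    proof (rule indep_linesI[where y = y and f = "\<lambda>a s. F (a, s)", OF W_def])
      show "y a s \<in> W a" for a s
        unfolding y_def W_def span_pair by blast
      show "homogeneous e (F (a, s))" for a s
        unfolding F_def using f(1) by (intro homogeneous_sum homogeneous_cmult)
      show "ev (F (a, s)) (y b t) = of_bool (a = b \<and> s = t)"
        if "a < k" "s \<le> e" "b < k" "t \<le> e" for a b s t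
      proof -
        have "(\<lambda>l. poly_eval (Y (b, t) l) (?val p)) = ($) (y b t)"
          unfolding y_def using uv'[OF that(3)] by (intro Y) simp
        then show ?thesis
          using c[of "(a, s)" "(b, t)"] that by (auto simp: F_def poly_eval_psubst)
      qed
    qed
    moreover have "L a = projectivization (W a) \<and> vec.subspace (W a) \<and> vec.dim (W a) = 2" if "a < k" for a
      using uv'[OF that] dim_span_pair[of "u' a" "v' a"] by (simp add: W_def vec.subspace_span)
    ultimately show ?thesis
      by blast
  qed
  ultimately show ?thesis
    using that by blast
qed

theorem theorem1p5:
  fixes d k :: nat
  assumes "d \<ge> 10" and "k \<le> nu_j d"
  shows "for_general_twistor_lines k (\<lambda>L.
           \<exists>Y. smooth_surface d Y \<and>
               (\<forall>a<k. L a \<subseteq> Y) \<and>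
               \<not> (\<exists>M\<in>Gr24. M \<subseteq> Y \<and> M \<notin> L ` {..<k} \<and> (\<forall>a<k. M \<inter> L a = {})))"
proof -
  define e where "e = d - 5"
  have d: "d = e + 5"
    using assms(1) by (simp add: e_def)
  have "6 * k \<le> (e - 1) * (e - 2)"
    using nu_j_bound[OF assms] by (simp add: e_def)
  then obtain U where U: "zariski_open k U" "U \<noteq> {}"
    "\<And>L. L \<in> U \<Longrightarrow> \<exists>W. (\<forall>a<k. L a = projectivization (W a) \<and> vec.subspace (W a) \<and> vec.dim (W a) = 2) \<and>
       indep_lines e k W"
    using ex_open_indep_lines[of k e] by blast
  have "inj_on L {..<k} \<and> (\<exists>Y. smooth_surface d Y \<and> (\<forall>a<k. L a \<subseteq> Y) \<and>
      \<not> (\<exists>M\<in>Gr24. M \<subseteq> Y \<and> M \<notin> L ` {..<k} \<and> (\<forall>a<k. M \<inter> L a = {})))" if L: "L \<in> U" for L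
  proof
    obtain W where W: "\<And>a. a < k \<Longrightarrow> L a = projectivization (W a)"
      "\<And>a. a < k \<Longrightarrow> vec.subspace (W a) \<and> vec.dim (W a) = 2" and indep: "indep_lines e k W"
      using U(3)[OF L] by blast
    show "inj_on L {..<k}"
    \<comment> \<open>A common point of lines a and b contradicts a form that vanishes on line b but
      not at this point.\<close>
    proof (rule inj_onI, rule ccontr)
      fix a b assume ab: "a \<in> {..<k}" "b \<in> {..<k}" "L a = L b" "a \<noteq> b"
      obtain z where z: "z \<in> W a" "z \<noteq> 0"
        using W(2)[of a] ab(1) vec.dim_eq_0[of "W a"] by auto
      then have "z \<in> W b"
        using hpoint_in_projectivization[of "W a" z] hpoint_in_projectivization[of "W b" z] W ab by auto
      moreover have "a < k"
        using ab(1) by simp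
      from indep_lines_nonzero_at[OF indep this z order_refl] obtain G where
        "homogeneous e G" "\<And>b x. b < k \<Longrightarrow> b \<noteq> a \<Longrightarrow> x \<in> W b \<Longrightarrow> ev G x = 0" "ev G z \<noteq> 0"
        by blast
      ultimately show False
        using ab by auto
    qed
    obtain F where F: "homogeneous (e + 5) F" "\<And>a x. a < k \<Longrightarrow> x \<in> W a \<Longrightarrow> ev F x = 0"
      "\<And>z. z \<noteq> 0 \<Longrightarrow> ev F z = 0 \<Longrightarrow> \<exists>i. ev (partial_derivative i F) z \<noteq> 0"
      "\<And>M. vec.subspace M \<Longrightarrow> vec.dim M = 2 \<Longrightarrow> (\<And>a. a < k \<Longrightarrow> M \<inter> W a \<subseteq> {0}) \<Longrightarrow> \<exists>z\<in>M. ev F z \<noteq> 0"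
      using smooth_form_through_indep_lines[OF indep W(2)] by blast
    have "F \<noteq> 0"
    proof
      \<comment> \<open>All partial derivatives of 0 vanish, so any nonzero vector contradicts the
        Jacobian criterion.\<close>
      assume "F = 0"
      then have "\<exists>i. ev (partial_derivative i F) (axis 1 1) \<noteq> 0"
        by (intro F(3)) (auto simp: axis_eq_0_iff)
      then show False
        using \<open>F = 0\<close> by (simp add: partial_derivative_def)
    qed
    have "smooth_surface d (zero_locus F)"
      unfolding smooth_surface_def using F(1,3) \<open>F \<noteq> 0\<close> by (intro exI[of _ F]) (simp add: d)
    moreover have "L a \<subseteq> zero_locus F" if "a < k" for a
      using F(2)[OF that] W(1)[OF that] projectivization_subset_zero_locus[OF F(1)] by simp
    moreover have False if M: "M \<in> Gr24" "M \<subseteq> zero_locus F" "\<And>a. a < k \<Longrightarrow> M \<inter> L a = {}" for M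
    proof -
      obtain V where V: "M = projectivization V" "vec.subspace V" "vec.dim V = 2"
        using M(1) by (auto simp: Gr24_def)
      have "V \<inter> W a \<subseteq> {0}" if "a < k" for a
      proof
        fix z assume "z \<in> V \<inter> W a"
        then have "hpoint z \<in> M \<inter> L a" if "z \<noteq> 0"
          using that V(1) W(1)[OF \<open>a < k\<close>] by (auto simp: projectivization_def)
        then show "z \<in> {0}"
          using M(3)[OF that] by auto
      qed
      then obtain z where "z \<in> V" "ev F z \<noteq> 0"
        using F(4)[OF V(2,3)] by blast
      \<comment> \<open>The degree e + 5 is positive, so \<open>F\<close> vanishes at the
        origin.\<close>
      moreover have "z \<noteq> 0"
        using \<open>ev F z \<noteq> 0\<close> ev_scale[OF F(1), of 0 0] by (auto simp: power_0_left)
      ultimately show False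
        using M(2) unfolding V(1) projectivization_subset_zero_locus[OF F(1)] by blast
    qed
    ultimately show "\<exists>Y. smooth_surface d Y \<and> (\<forall>a<k. L a \<subseteq> Y) \<and>
        \<not> (\<exists>M\<in>Gr24. M \<subseteq> Y \<and> M \<notin> L ` {..<k} \<and> (\<forall>a<k. M \<inter> L a = {}))"
      by (intro exI[of _ "zero_locus F"]) (simp, metis)
  qed
  then show ?thesis
    unfolding for_general_twistor_lines_def using U(1,2) by (intro exI[of _ U]) simp
qed

end
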